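(* Under the standing assumptions in the context, there exists a constant $c_7$ depending only on $n,\kappa,c_1,c_2,c_4,W$ and $\Omega$ such that $$\sup_{\Omega\times[0,\infty)}\left(\frac{\varepsilon_i|\nabla u_{\varepsilon_i}|^2}{2}-\frac{W(u_{\varepsilon_i})}{\varepsilon_i}\right)\le c_7\,\varepsilon_i^{-\lambda}$$ for any $0<\varepsilon_i<1$, where $\lambda\in[3/5,1)$ is the exponent in the assumption $\max_{\overline\Omega}\left(\frac{\varepsilon_i|\nabla u_{\varepsilon_i,0}|^2}{2}-\frac{W(u_{\varepsilon_i,0})}{\varepsilon_i}\right)\le c_2\varepsilon_i^{-\lambda}$ on the initial data.
   Context: Setting. $n$ is a positive integer, $\Omega\subset\mathbb{R}^n$ is a bounded domain with smooth boundary (not assumed convex), $\nu$ is the outer unit normal to $\partial\Omega$. $W\in C^3(\mathbb{R})$ satisfies: (W1) $W(\pm1)=0$ and $W(s)>0$ for all $s\ne\pm1$; (W2) for some $-1<\gamma<1$, $W'<0$ on $(\gamma,1)$ and $W'>0$ on $(-1,\gamma)$; (W3) for some $0<\alpha<1$ and $\beta>0$, $W''(s)\ge\beta$ for all $\alpha\le|s|\le1$. Initial data. $\{\varepsilon_i\}_{i\ge1}$ are positive numbers with $\varepsilon_i\to0$, and $u_{\varepsilon_i,0}\in C^1(\overline\Omega)$ satisfy, with constants $D_0,c_1,c_2$ and $\lambda\in[3/5,1)$ independent of $i$: (i) $\|u_{\varepsilon_i,0}\|_{L^\infty(\Omega)}\le1$; (ii) $\sup_i\sup_{x\in\Omega,\,r>0}\omega_{n-1}^{-1}r^{1-n}\int_{B_r(x)\cap\Omega}\frac{\varepsilon_i|\nabla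 u_{\varepsilon_i,0}|^2}{2}+\frac{W(u_{\varepsilon_i,0})}{\varepsilon_i}\,dy\le D_0$; (iii) $\sup_i\max_{\overline\Omega}\varepsilon_i|\nabla u_{\varepsilon_i,0}|\le c_1$; (iv) $\max_{\overline\Omega}\left(\frac{\varepsilon_i|\nabla u_{\varepsilon_i,0}|^2}{2}-\frac{W(u_{\varepsilon_i,0})}{\varepsilon_i}\right)\le c_2\varepsilon_i^{-\lambda}$ for all $i$; (v) $\langle\nabla u_{\varepsilon_i,0},\nu\rangle=0$ on $\partial\Omega$ for all $i$. Here $\omega_{n-1}$ is the volume of the unit ball of $\mathbb{R}^{n-1}$ and $B_r(x)$ is the open ball. Equation. $u_{\varepsilon_i}$ is the unique solution, with regularity $C([0,\infty);C^1(\overline\Omega))\cap C^\infty(\overline\Omega\times(0,\infty))$ as recorded in the paper, of $\partial_tu_{\varepsilon_i}=\Delta u_{\varepsilon_i}-W'(u_{\varepsilon_i})/\varepsilon_i^2$ in $\Omega\times(0,\infty)$, $\langle\nabla u_{\varepsilon_i},\nu\rangle=0$ on $\partial\Omega\times(0,\infty)$, $u_{\varepsilon_i}(\cdot,0)=u_{\varepsilon_i,0}$ in $\Omega$. Geometry. $\kappa:=\|\text{principal curvature of }\partial\Omega\|_{L^\infty(\partial\Omega)}$. $c_4\in(0,(6\kappa)^{-1}]$ is a fixed sufficiently small constant, depending only on $\partial\Omega$, such that every $x$ with $\mathrm{dist}(x,\partial\Omega)<6c_4$ has a unique nearest point $\xi(x)\in\partial\Omega$, i.e. with $\mathrm{dist}(x,\partial\Omega)=|x-\xi(x)|$.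 *)

theory Defs
  imports "HOL-Analysis.Analysis"
begin

(* Derivatives are taken within S.  For S = UNIV or S open this is the usual C^k.  For the closure
   of a smooth bounded domain, or its product with an open interval, it is C^k up to the boundary:
   derivatives at boundary points are one-sided, and coincide there with the continuous extensions
   of the interior derivatives. *)
primrec Ck_on :: "nat \<Rightarrow> ('a::euclidean_space \<Rightarrow> real) \<Rightarrow> 'a set \<Rightarrow> bool" where
  "Ck_on 0 f S \<longleftrightarrow> continuous_on S f"
| "Ck_on (Suc k) f S \<longleftrightarrow> f differentiable_on S \<and>
     (\<forall>b\<in>Basis. Ck_on k (\<lambda>x. frechet_derivative f (at x within S) b) S)"

definition smooth_on :: "('a::euclidean_space \<Rightarrow> real) \<Rightarrow> 'a set \<Rightarrow> bool" where
  "smooth_on f S \<longleftrightarrow> (\<forall>k. Ck_on k f S)"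

definition grad :: "'a::euclidean_space set \<Rightarrow> ('a \<Rightarrow> real) \<Rightarrow> 'a \<Rightarrow> 'a" where
  "grad S f x = (\<Sum>b\<in>Basis. frechet_derivative f (at x within S) b *\<^sub>R b)"

definition laplacian :: "('a::euclidean_space \<Rightarrow> real) \<Rightarrow> 'a \<Rightarrow> real" where
  "laplacian f x =
     (\<Sum>b\<in>Basis. frechet_derivative (\<lambda>y. frechet_derivative f (at y) b) (at x) b)"

definition C1_norm :: "'a::euclidean_space set \<Rightarrow> ('a \<Rightarrow> real) \<Rightarrow> real" where
  "C1_norm S f = (SUP x\<in>S. \<bar>f x\<bar>) + (SUP x\<in>S. norm (grad S f x))"

(* Near each boundary point, in rotated coordinates with last axis e, the domain is the region
   below the graph of a smooth function of the coordinates orthogonal to e. *)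
definition smooth_bounded_domain :: "'a::euclidean_space set \<Rightarrow> bool" where
  "smooth_bounded_domain \<Omega> \<longleftrightarrow>
     open \<Omega> \<and> connected \<Omega> \<and> \<Omega> \<noteq> {} \<and> bounded \<Omega> \<and>
     (\<forall>p\<in>frontier \<Omega>. \<exists>r>0. \<exists>e h. norm e = 1 \<and> smooth_on h UNIV \<and>
        \<Omega> \<inter> ball p r = {x \<in> ball p r. x \<bullet> e < h (x - (x \<bullet> e) *\<^sub>R e)})"

(* Velocities of curves in S through p; for a smooth hypersurface, differentiability at the single
   time 0 already gives the usual tangent space. *)
definition tangent_space :: "'a::euclidean_space set \<Rightarrow> 'a \<Rightarrow> 'a set" where
  "tangent_space S p = {v. \<exists>c::real \<Rightarrow> 'a.
     c 0 = p \<and> (\<forall>\<^sub>F t in nhds 0. c t \<in> S) \<and> (c has_vector_derivative v) (at 0)}"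

definition outer_normal :: "'a::euclidean_space set \<Rightarrow> 'a \<Rightarrow> 'a" where
  "outer_normal \<Omega> p = (THE \<nu>. norm \<nu> = 1 \<and>
     (\<forall>v\<in>tangent_space (frontier \<Omega>) p. \<nu> \<bullet> v = 0) \<and>
     (\<exists>\<delta>>0. \<forall>t\<in>{0<..<\<delta>}. p + t *\<^sub>R \<nu> \<notin> closure \<Omega>))"

(* Eigenvalues of the Weingarten map, the differential of the normal along the boundary.
   A derivative A within the frontier is determined on tangent vectors only, hence the
   restriction on v. *)
definition principal_curvature :: "'a::euclidean_space set \<Rightarrow> 'a \<Rightarrow> real \<Rightarrow> bool" where
  "principal_curvature \<Omega> p k \<longleftrightarrow>
     (\<exists>A v. (outer_normal \<Omega> has_derivative A) (at p within frontier \<Omega>) \<and>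
        v \<in> tangent_space (frontier \<Omega>) p \<and> v \<noteq> 0 \<and> A v = k *\<^sub>R v)"

(* The curvatures are continuous on the boundary, so the L^infinity norm is a supremum.
   Inserting 0 matters only in dimension 1, where there are no principal curvatures. *)
definition curvature_bound :: "'a::euclidean_space set \<Rightarrow> real" where
  "curvature_bound \<Omega> =
     Sup (insert 0 {\<bar>k\<bar> | k p. p \<in> frontier \<Omega> \<and> principal_curvature \<Omega> p k})"

(* The bound c \<le> 1 / (6 \<kappa>) is multiplied out, so that it is no restriction for \<kappa> = 0. *)
definition tubular_constant :: "'a::euclidean_space set \<Rightarrow> real \<Rightarrow> bool" where
  "tubular_constant \<Omega> c \<longleftrightarrow> 0 < c \<and> 6 * curvature_bound \<Omega> * c \<le> 1 \<and>
     (\<forall>x. infdist x (frontier \<Omega>) < 6 * c \<longrightarrow>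
        (\<exists>!\<xi>. \<xi> \<in> frontier \<Omega> \<and> infdist x (frontier \<Omega>) = dist x \<xi>))"

definition double_well :: "(real \<Rightarrow> real) \<Rightarrow> bool" where
  "double_well W \<longleftrightarrow> Ck_on 3 W UNIV \<and>
     W 1 = 0 \<and> W (-1) = 0 \<and> (\<forall>s. s \<noteq> 1 \<and> s \<noteq> -1 \<longrightarrow> W s > 0) \<and>
     (\<exists>\<gamma>. -1 < \<gamma> \<and> \<gamma> < 1 \<and>
        (\<forall>s\<in>{\<gamma><..<1}. deriv W s < 0) \<and> (\<forall>s\<in>{-1<..<\<gamma>}. deriv W s > 0)) \<and>
     (\<exists>\<alpha> \<beta>. 0 < \<alpha> \<and> \<alpha> < 1 \<and> 0 < \<beta> \<and>
        (\<forall>s. \<alpha> \<le> \<bar>s\<bar> \<and> \<bar>s\<bar> \<le> 1 \<longrightarrow> deriv (deriv W) s \<ge> \<beta>))"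

definition energy_density ::
  "'a::euclidean_space set \<Rightarrow> (real \<Rightarrow> real) \<Rightarrow> real \<Rightarrow> ('a \<Rightarrow> real) \<Rightarrow> 'a \<Rightarrow> real" where
  "energy_density \<Omega> W \<epsilon> f x =
     \<epsilon> * (norm (grad (closure \<Omega>) f x))\<^sup>2 / 2 + W (f x) / \<epsilon>"

definition discrepancy ::
  "'a::euclidean_space set \<Rightarrow> (real \<Rightarrow> real) \<Rightarrow> real \<Rightarrow> ('a \<Rightarrow> real) \<Rightarrow> 'a \<Rightarrow> real" where
  "discrepancy \<Omega> W \<epsilon> f x =
     \<epsilon> * (norm (grad (closure \<Omega>) f x))\<^sup>2 / 2 - W (f x) / \<epsilon>"

definition admissible_initial_data ::
  "'a::euclidean_space set \<Rightarrow> (real \<Rightarrow> real) \<Rightarrow> real \<Rightarrow> real \<Rightarrow> real \<Rightarrow> real \<Rightarrow>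
   (nat \<Rightarrow> real) \<Rightarrow> (nat \<Rightarrow> 'a \<Rightarrow> real) \<Rightarrow> bool" where
  "admissible_initial_data \<Omega> W D\<^sub>0 c\<^sub>1 c\<^sub>2 lam \<epsilon> u\<^sub>0 \<longleftrightarrow>
     (\<forall>i. \<epsilon> i > 0) \<and> \<epsilon> \<longlonglongrightarrow> 0 \<and>
     (\<forall>i. Ck_on 1 (u\<^sub>0 i) (closure \<Omega>)) \<and>
     (\<forall>i. AE x in lebesgue_on \<Omega>. \<bar>u\<^sub>0 i x\<bar> \<le> 1) \<and>
     (\<forall>i. \<forall>x\<in>\<Omega>. \<forall>r>0.
        1 / (unit_ball_vol (real (DIM('a) - 1)) * r ^ (DIM('a) - 1)) *
          set_lebesgue_integral lebesgue (ball x r \<inter> \<Omega>) (energy_density \<Omega> W (\<epsilon> i) (u\<^sub>0 i)) \<le> D\<^sub>0) \<and>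
     (\<forall>i. \<forall>x\<in>closure \<Omega>. \<epsilon> i * norm (grad (closure \<Omega>) (u\<^sub>0 i) x) \<le> c\<^sub>1) \<and>
     (\<forall>i. \<forall>x\<in>closure \<Omega>. discrepancy \<Omega> W (\<epsilon> i) (u\<^sub>0 i) x \<le> c\<^sub>2 * \<epsilon> i powr (- lam)) \<and>
     (\<forall>i. \<forall>x\<in>frontier \<Omega>. grad (closure \<Omega>) (u\<^sub>0 i) x \<bullet> outer_normal \<Omega> x = 0)"

(* The first two conjuncts say u \<in> C([0,\<infinity>); C^1(closure of \<Omega>)), the third
   u \<in> C^\<infinity>(closure of \<Omega> \<times> (0,\<infinity>)). *)
definition allen_cahn_solution ::
  "'a::euclidean_space set \<Rightarrow> (real \<Rightarrow> real) \<Rightarrow> real \<Rightarrow> ('a \<Rightarrow> real) \<Rightarrow>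
   ('a \<Rightarrow> real \<Rightarrow> real) \<Rightarrow> bool" where
  "allen_cahn_solution \<Omega> W \<epsilon> u\<^sub>0 u \<longleftrightarrow>
     (\<forall>t\<ge>0. Ck_on 1 (\<lambda>x. u x t) (closure \<Omega>)) \<and>
     (\<forall>s\<ge>0. ((\<lambda>t. C1_norm (closure \<Omega>) (\<lambda>x. u x t - u x s)) \<longlongrightarrow> 0) (at s within {0..})) \<and>
     smooth_on (\<lambda>(x, t). u x t) (closure \<Omega> \<times> {0<..}) \<and>
     (\<forall>x\<in>\<Omega>. \<forall>t>0.
        deriv (u x) t = laplacian (\<lambda>y. u y t) x - deriv W (u x t) / \<epsilon>\<^sup>2) \<and>
     (\<forall>x\<in>frontier \<Omega>. \<forall>t>0. grad (closure \<Omega>) (\<lambda>y. u y t) x \<bullet> outer_normal \<Omega> x = 0) \<and>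
     (\<forall>x\<in>\<Omega>. u x 0 = u\<^sub>0 x)"

end

theory Submission
  imports Defs
begin

text \<open>
  Write \<open>d = \<epsilon> powr (1 - lam)\<close>, \<open>p\<close> for the spatial gradient of \<open>u\<close> and
  \<open>w = \<epsilon>\<^sup>2 |p|\<^sup>2 / 2\<close>.  After multiplication by \<open>\<epsilon>\<close> the claim is \<open>w - W(u) \<le> const * d\<close>, and it is
  proved by a maximum principle for a perturbation of \<open>w - W(u)\<close>.

  In the interior the quantity \<open>w - W(u)\<close> is a subsolution up to a drift: the bad term
  \<open>W'(u)\<^sup>2 / \<epsilon>\<^sup>2\<close> in its evolution is compensated by the Hessian term, since
  \<open>|D\<^sup>2u|\<^sup>2 |p|\<^sup>2 \<ge> |(D\<^sup>2u) p|\<^sup>2\<close> by Cauchy--Schwarz and \<open>\<epsilon>\<^sup>2 (D\<^sup>2u) p = W'(u) p\<close> at a critical point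
  (\<open>hessian_norm_lower_bound\<close>).  At the boundary, differentiating the Neumann condition in the
  tangential direction \<open>p\<close> gives \<open>D\<^sup>2u(p, g) = - D\<^sup>2\<rho>(p, p)\<close> (\<open>normal_derivative_gradient\<close>), where
  \<open>\<rho>\<close> is a function that vanishes on the boundary and is nonnegative inside, and \<open>g\<close> is its gradient.
  This has no sign in a domain that is not convex, but it is at least \<open>- C |p|\<^sup>2\<close>.

  Hence one studies \<open>Q = exp(\<phi>) w - W(u) - G(u)\<close> with two corrections of size \<open>d\<close>.  The weight
  \<open>\<phi> = - M d exp(- \<rho> / d)\<close> has inward slope at least \<open>M\<close> at the boundary, so \<open>M = 2 C + 1\<close> excludes
  a positive maximum there (\<open>boundary_strict\<close>), while \<open>\<bar>\<phi>\<bar> \<le> M d\<close>.  The concave function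
  \<open>G(s) = k d (4 - (s - \<gamma>)\<^sup>2)\<close>, for which \<open>W' G' \<ge> 0\<close> on \<open>[-1, 1]\<close>, produces the good term
  \<open>2 k d |p|\<^sup>2\<close>.  The errors caused by \<open>\<phi>\<close> are of two kinds: those quadratic in \<open>p\<close> are bounded by
  \<open>d |p|\<^sup>2\<close> times a constant independent of \<open>k\<close>, so \<open>k\<close> is chosen to beat them; those linear in \<open>p\<close>
  are absorbed where \<open>w > K d\<close>, because \<open>\<epsilon>\<^sup>2 \<le> d\<^sup>3\<close> then forces \<open>d |p|\<close> to be large
  (\<open>gradient_term_absorbs\<close>).  So \<open>Q\<close> has no interior maximum with a value above \<open>K d\<close>
  (\<open>interior_strict\<close>), and \<open>Q \<le> const * d\<close> for all times (\<open>discrepancy_le\<close>).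

  Three ingredients make this rigorous.  The function \<open>\<rho>\<close> is glued from the local graph
  representations with bump functions (\<open>smooth_bounded_domain_defined\<close>).  The bound \<open>\<bar>u\<bar> \<le> 1\<close> follows
  from the same maximum principle (\<open>signed_solution_le_1\<close>).  Finally the one-sided derivatives of a
  solution satisfy the pointwise identities used above
  (\<open>allen_cahn_solution_neumann_flow\<close>); this uses that derivatives within the closure are unique and
  that mixed partial derivatives commute.
\<close>

section \<open>Second-order tests along lines\<close>

lemma second_derivative_test_max:
  fixes f :: "real \<Rightarrow> real"
  assumes "0 < d"
    and f: "\<And>s. \<bar>s\<bar> < d \<Longrightarrow> (f has_real_derivative f' s) (at s)"
    and f': "(f' has_real_derivative c) (at 0)"
    and max: "\<And>s. \<bar>s\<bar> < d \<Longrightarrow> f s \<le> f 0"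
  shows "f' 0 = 0" and "c \<le> 0"
proof -
  show zero: "f' 0 = 0"
    by (rule DERIV_local_max[OF f[of 0] \<open>0 < d\<close>]) (use assms in auto)
  show "c \<le> 0"
  proof (rule ccontr)
    assume "\<not> c \<le> 0"
    with DERIV_pos_inc_right[OF f'] obtain e where e: "e > 0" "\<And>h. 0 < h \<Longrightarrow> h < e \<Longrightarrow> f' 0 < f' h"
      by auto
    define h where "h = min d e / 2"
    have h: "0 < h" "h < d" "h < e" using \<open>0 < d\<close> e by (auto simp: h_def)
    obtain z where z: "0 < z" "z < h" "f h - f 0 = (h - 0) * f' z"
      using MVT2[OF h(1), of f f'] f h by force
    have "f' z > 0" using e(2)[of z] z h zero by simp
    then have "0 < h * f' z" using z by simp
    with z(3) max[of h] h show False by simp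
  qed
qed

text \<open>
  Two applications of the mean value theorem turn the second difference over a parallelogram into a
  mixed derivative.  The value does not change when \<open>a\<close> and \<open>b\<close> are exchanged, and this is the source of
  the symmetry of mixed derivatives.
\<close>

lemma second_difference_mean_value:
  fixes f :: "'a::real_normed_vector \<Rightarrow> real"
  assumes "0 < h"
    and dom: "\<And>s t. s \<in> {0..h} \<Longrightarrow> t \<in> {0..h} \<Longrightarrow> z + s *\<^sub>R a + t *\<^sub>R b \<in> S"
    and F: "\<And>y. y \<in> S \<Longrightarrow> (f has_derivative F y) (at y)"
    and Fa: "\<And>y. y \<in> S \<Longrightarrow> ((\<lambda>y. F y a) has_derivative Fa y) (at y)"
  obtains s t where "s \<in> {0..h}" "t \<in> {0..h}"
    "f (z + h *\<^sub>R a + h *\<^sub>R b) - f (z + h *\<^sub>R a) - f (z + h *\<^sub>R b) + f z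
      = h * h * Fa (z + s *\<^sub>R a + t *\<^sub>R b) b"
proof -
  have line: "((\<lambda>s. k (y + s *\<^sub>R v)) has_real_derivative K v) (at s)"
    if "(k has_derivative K) (at (y + s *\<^sub>R v))" for k K y v s
  proof -
    have "((\<lambda>s. k (y + s *\<^sub>R v)) has_derivative (\<lambda>x. K (x *\<^sub>R v))) (at s)"
      by (rule has_derivative_compose[where g = k and f = "\<lambda>s. y + s *\<^sub>R v", OF _ that])
        (auto intro!: derivative_eq_intros)
    moreover have "K (x *\<^sub>R v) = K v * x" for x
      using linear_cmul[OF has_derivative_linear[OF that], of x v] by simp
    ultimately show ?thesis by (simp add: has_field_derivative_def)
  qed
  define k where "k s = f (z + h *\<^sub>R b + s *\<^sub>R a) - f (z + s *\<^sub>R a)" for s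
  have k: "(k has_real_derivative (F (z + h *\<^sub>R b + s *\<^sub>R a) a - F (z + s *\<^sub>R a) a)) (at s)"
    if "0 \<le> s" "s \<le> h" for s
    unfolding k_def
    using that \<open>0 < h\<close> dom[of s h] dom[of s 0]
    by (intro DERIV_diff line F) (auto simp: algebra_simps)
  obtain s where s: "0 < s" "s < h"
    "k h - k 0 = (h - 0) * (F (z + h *\<^sub>R b + s *\<^sub>R a) a - F (z + s *\<^sub>R a) a)"
    using MVT2[OF \<open>0 < h\<close> k] by auto
  have k2: "((\<lambda>t. F (z + s *\<^sub>R a + t *\<^sub>R b) a) has_real_derivative Fa (z + s *\<^sub>R a + t *\<^sub>R b) b) (at t)"
    if "0 \<le> t" "t \<le> h" for t
    using line[OF Fa, of "z + s *\<^sub>R a" t b] dom[of s t] that s by simp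
  obtain t where t: "0 < t" "t < h"
    "F (z + s *\<^sub>R a + h *\<^sub>R b) a - F (z + s *\<^sub>R a + 0 *\<^sub>R b) a = (h - 0) * Fa (z + s *\<^sub>R a + t *\<^sub>R b) b"
    using MVT2[OF \<open>0 < h\<close> k2] by blast
  have "k h - k 0 = h * h * Fa (z + s *\<^sub>R a + t *\<^sub>R b) b"
    using s(3) t(3) by (simp add: algebra_simps)
  then show ?thesis
    using that[of s t] s t by (simp add: k_def algebra_simps)
qed

lemma mixed_derivatives_commute:
  fixes f :: "'a::real_normed_vector \<Rightarrow> real"
  assumes "open S" "z \<in> S"
    and F: "\<And>y. y \<in> S \<Longrightarrow> (f has_derivative F y) (at y)"
    and Fa: "\<And>y. y \<in> S \<Longrightarrow> ((\<lambda>y. F y a) has_derivative Fa y) (at y)"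
    and Fb: "\<And>y. y \<in> S \<Longrightarrow> ((\<lambda>y. F y b) has_derivative Fb y) (at y)"
    and cont: "continuous_on S (\<lambda>y. Fa y b)" "continuous_on S (\<lambda>y. Fb y a)"
  shows "Fa z b = Fb z a"
proof (rule ccontr)
  assume neq: "Fa z b \<noteq> Fb z a"
  \<comment> \<open>Within half of the difference the two derivatives, evaluated near \<open>z\<close>, cannot agree.\<close>
  define e where "e = \<bar>Fa z b - Fb z a\<bar> / 2"
  have "e > 0" using neq by (simp add: e_def)
  have "(\<lambda>y. Fa y b) \<midarrow>z\<rightarrow> Fa z b" "(\<lambda>y. Fb y a) \<midarrow>z\<rightarrow> Fb z a"
    using cont assms(1,2) by (metis at_within_open continuous_on)+
  then have "\<forall>\<^sub>F y in at z. dist (Fa y b) (Fa z b) < e" "\<forall>\<^sub>F y in at z. dist (Fb y a) (Fb z a) < e"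
    using \<open>e > 0\<close> by (auto simp: tendsto_iff)
  moreover have "\<forall>\<^sub>F y in at z. y \<in> S" using assms(1,2) by (rule eventually_at_in_open')
  ultimately have "\<forall>\<^sub>F y in at z. dist (Fa y b) (Fa z b) < e \<and> dist (Fb y a) (Fb z a) < e \<and> y \<in> S"
    by eventually_elim auto
  then obtain r where r: "r > 0" and
    near: "\<And>y. y \<noteq> z \<Longrightarrow> dist y z < r \<Longrightarrow> dist (Fa y b) (Fa z b) < e \<and> dist (Fb y a) (Fb z a) < e \<and> y \<in> S"
    unfolding eventually_at by auto
  have near: "dist (Fa y b) (Fa z b) < e \<and> dist (Fb y a) (Fb z a) < e \<and> y \<in> S" if "dist y z < r" for y
    using near[of y] that \<open>e > 0\<close> \<open>z \<in> S\<close> by (cases "y = z") auto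
  define h where "h = r / (2 * (norm a + norm b + 1))"
  have nn: "norm a + norm b + 1 > 0" by (simp add: add_nonneg_pos)
  then have "h > 0" using r by (simp add: h_def)
  have close: "dist (z + s *\<^sub>R a + t *\<^sub>R b) z < r" if "s \<in> {0..h}" "t \<in> {0..h}" for s t
  proof -
    have "dist (z + s *\<^sub>R a + t *\<^sub>R b) z = norm (s *\<^sub>R a + t *\<^sub>R b)"
      by (simp add: dist_norm algebra_simps)
    also have "\<dots> \<le> s * norm a + t * norm b"
      using that by (metis (no_types) norm_triangle_le norm_scaleR order_refl abs_of_nonneg atLeastAtMost_iff add_left_mono)
    also have "\<dots> \<le> h * norm a + h * norm b"
      using that by (intro add_mono mult_right_mono) auto
    also have "\<dots> \<le> h * (norm a + norm b + 1)" using \<open>h > 0\<close> by (simp add: algebra_simps)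
    also have "\<dots> = r / 2" using nn by (simp add: h_def divide_simps)
    also have "\<dots> < r" using r by simp
    finally show ?thesis .
  qed
  have close1: "z + s *\<^sub>R a + t *\<^sub>R b \<in> S" if "s \<in> {0..h}" "t \<in> {0..h}" for s t
    using near[OF close[OF that]] by blast
  obtain s t where 1: "s \<in> {0..h}" "t \<in> {0..h}"
    "f (z + h *\<^sub>R a + h *\<^sub>R b) - f (z + h *\<^sub>R a) - f (z + h *\<^sub>R b) + f z
      = h * h * Fa (z + s *\<^sub>R a + t *\<^sub>R b) b"
    using second_difference_mean_value[OF \<open>h > 0\<close> close1 F Fa] by blast
  have close2: "z + s *\<^sub>R b + t *\<^sub>R a \<in> S" if "s \<in> {0..h}" "t \<in> {0..h}" for s t
    using near[OF close[OF that(2) that(1)]] by (simp add: algebra_simps)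
  obtain s' t' where 2: "s' \<in> {0..h}" "t' \<in> {0..h}"
    "f (z + h *\<^sub>R b + h *\<^sub>R a) - f (z + h *\<^sub>R b) - f (z + h *\<^sub>R a) + f z
      = h * h * Fb (z + s' *\<^sub>R b + t' *\<^sub>R a) a"
    using second_difference_mean_value[OF \<open>h > 0\<close> close2 F Fb] by blast
  have "h * h * Fa (z + s *\<^sub>R a + t *\<^sub>R b) b = h * h * Fb (z + s' *\<^sub>R b + t' *\<^sub>R a) a"
    using 1(3) 2(3) by (simp add: algebra_simps)
  then have "Fa (z + s *\<^sub>R a + t *\<^sub>R b) b = Fb (z + t' *\<^sub>R a + s' *\<^sub>R b) a"
    using \<open>h > 0\<close> by (simp add: algebra_simps)
  moreover have "dist (Fa (z + s *\<^sub>R a + t *\<^sub>R b) b) (Fa z b) < e"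
    using near[OF close] 1 by blast
  moreover have "dist (Fb (z + t' *\<^sub>R a + s' *\<^sub>R b) a) (Fb z a) < e"
    using near[OF close] 2 by blast
  ultimately show False unfolding e_def dist_real_def by argo
qed

section \<open>Functions with continuous second derivatives\<close>

text \<open>
  Gradient and Hessian are carried as explicit fields, so that the rules for products and compositions
  give formulas for them; all derivatives are on the whole space.
\<close>

definition twice_diff :: "('a::euclidean_space \<Rightarrow> real) \<Rightarrow> ('a \<Rightarrow> 'a) \<Rightarrow> ('a \<Rightarrow> 'a \<Rightarrow> 'a) \<Rightarrow> bool" where
  "twice_diff f g H \<longleftrightarrow>
     (\<forall>x. (f has_derivative (\<lambda>v. g x \<bullet> v)) (at x)) \<and>
     (\<forall>x. (g has_derivative H x) (at x)) \<and>
     (\<forall>v. continuous_on UNIV (\<lambda>x. H x v))"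

lemma twice_diffD:
  assumes "twice_diff f g H"
  shows "(f has_derivative (\<lambda>v. g x \<bullet> v)) (at x)" "(g has_derivative H x) (at x)"
    "continuous_on UNIV (\<lambda>x. H x v)" "continuous_on S f" "continuous_on S g" "linear (H x)"
proof -
  show *: "(f has_derivative (\<lambda>v. g x \<bullet> v)) (at x)" "(g has_derivative H x) (at x)"
    "continuous_on UNIV (\<lambda>x. H x v)" for x using assms by (auto simp: twice_diff_def)
  show "continuous_on S f" "continuous_on S g"
    using * by (meson continuous_at_imp_continuous_on has_derivative_continuous)+
  show "linear (H x)" by (rule has_derivative_linear[OF *(2)])
qed

lemma twice_diff_add:
  assumes "twice_diff f g H" "twice_diff f2 g2 H2"
  shows "twice_diff (\<lambda>x. f x + f2 x) (\<lambda>x. g x + g2 x) (\<lambda>x v. H x v + H2 x v)"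
  using assms unfolding twice_diff_def
  by (auto intro!: derivative_eq_intros continuous_intros simp: inner_add_left)

lemma twice_diff_zero: "twice_diff (\<lambda>x. 0) (\<lambda>x. 0) (\<lambda>x v. 0)"
  by (auto simp: twice_diff_def intro!: derivative_eq_intros continuous_intros)

lemma twice_diff_sum:
  assumes "finite J" "\<And>j. j \<in> J \<Longrightarrow> twice_diff (f j) (g j) (H j)"
  shows "twice_diff (\<lambda>x. \<Sum>j\<in>J. f j x) (\<lambda>x. \<Sum>j\<in>J. g j x) (\<lambda>x v. \<Sum>j\<in>J. H j x v)"
  using assms
  by (induction J rule: finite_induct) (auto simp: twice_diff_zero intro: twice_diff_add)

lemma twice_diff_mult:
  assumes "twice_diff f g H" "twice_diff f2 g2 H2"
  shows "twice_diff (\<lambda>x. f x * f2 x) (\<lambda>x. f x *\<^sub>R g2 x + f2 x *\<^sub>R g x)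
    (\<lambda>x v. f x *\<^sub>R H2 x v + (g x \<bullet> v) *\<^sub>R g2 x + f2 x *\<^sub>R H x v + (g2 x \<bullet> v) *\<^sub>R g x)"
  unfolding twice_diff_def
proof (intro conjI allI)
  fix x v
  note [derivative_intros] = twice_diffD(1,2)[OF assms(1)] twice_diffD(1,2)[OF assms(2)]
  show "((\<lambda>x. f x * f2 x) has_derivative (\<bullet>) (f x *\<^sub>R g2 x + f2 x *\<^sub>R g x)) (at x)"
    by (auto intro!: derivative_eq_intros simp: algebra_simps inner_add_left)
  show "((\<lambda>x. f x *\<^sub>R g2 x + f2 x *\<^sub>R g x) has_derivative
     (\<lambda>v. f x *\<^sub>R H2 x v + (g x \<bullet> v) *\<^sub>R g2 x + f2 x *\<^sub>R H x v + (g2 x \<bullet> v) *\<^sub>R g x)) (at x)"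
    by (auto intro!: derivative_eq_intros simp: algebra_simps)
  show "continuous_on UNIV (\<lambda>x. f x *\<^sub>R H2 x v + (g x \<bullet> v) *\<^sub>R g2 x + f2 x *\<^sub>R H x v + (g2 x \<bullet> v) *\<^sub>R g x)"
    by (intro continuous_intros twice_diffD[OF assms(1)] twice_diffD[OF assms(2)])
qed

lemma frechet_derivative_eq_grad:
  assumes "f differentiable (at x within S)"
  shows "(f has_derivative (\<lambda>v. grad S f x \<bullet> v)) (at x within S)"
proof -
  have *: "(f has_derivative frechet_derivative f (at x within S)) (at x within S)"
    using assms by (simp add: frechet_derivative_works)
  have "frechet_derivative f (at x within S) v = grad S f x \<bullet> v" for v
  proof -
    have "frechet_derivative f (at x within S) v
        = frechet_derivative f (at x within S) (\<Sum>b\<in>Basis. (v \<bullet> b) *\<^sub>R b)"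
      by (simp add: euclidean_representation)
    also have "\<dots> = (\<Sum>b\<in>Basis. (v \<bullet> b) * frechet_derivative f (at x within S) b)"
      by (simp add: linear_sum linear_cmul has_derivative_linear[OF *])
    also have "\<dots> = grad S f x \<bullet> v"
      unfolding grad_def inner_sum_left by (intro sum.cong) (simp_all add: inner_commute)
    finally show ?thesis .
  qed
  then have "frechet_derivative f (at x within S) = (\<lambda>v. grad S f x \<bullet> v)" by blast
  with * show ?thesis by simp
qed

lemma smooth_on_twice_diff:
  assumes "smooth_on h UNIV"
  obtains g H where "twice_diff h g H"
proof
  have 2: "Ck_on (Suc (Suc 0)) h UNIV" using assms unfolding smooth_on_def by blast
  define D where "D b x = frechet_derivative h (at x) b" for b x
  have h: "h differentiable (at x)" for x
    using 2 by (simp add: differentiable_on_def)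
  have D: "D b differentiable (at x)" "continuous_on UNIV (\<lambda>x. frechet_derivative (D b) (at x) c)"
    if "b \<in> Basis" "c \<in> Basis" for b c x
    using 2 that by (auto simp: differentiable_on_def D_def[abs_def])
  show "twice_diff h (grad UNIV h) (\<lambda>x v. \<Sum>b\<in>Basis. (grad UNIV (D b) x \<bullet> v) *\<^sub>R b)"
    unfolding twice_diff_def
  proof (intro conjI allI)
    fix x v
    show "(h has_derivative (\<bullet>) (grad UNIV h x)) (at x)"
      using frechet_derivative_eq_grad[of h x UNIV] h by simp
    have "(D b has_derivative (\<lambda>v. grad UNIV (D b) x \<bullet> v)) (at x)" if "b \<in> Basis" for b
      using frechet_derivative_eq_grad[of "D b" x UNIV] D[OF that that] by simp
    then have "((\<lambda>x. \<Sum>b\<in>Basis. D b x *\<^sub>R b) has_derivative (\<lambda>v. \<Sum>b\<in>Basis. (grad UNIV (D b) x \<bullet> v) *\<^sub>R b)) (at x)"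
      by (intro derivative_intros) auto
    then show "(grad UNIV h has_derivative (\<lambda>v. \<Sum>b\<in>Basis. (grad UNIV (D b) x \<bullet> v) *\<^sub>R b)) (at x)"
      by (simp add: grad_def[abs_def] D_def)
    have "continuous_on UNIV (grad UNIV (D b))" if "b \<in> Basis" for b
      unfolding grad_def using D(2)[OF that] by (auto intro!: continuous_intros)
    then show "continuous_on UNIV (\<lambda>x. \<Sum>b\<in>Basis. (grad UNIV (D b) x \<bullet> v) *\<^sub>R b)"
      by (auto intro!: continuous_intros)
  qed
qed

lemma twice_diff_compose_real:
  assumes f: "twice_diff f g H"
    and k: "\<And>s. (k has_real_derivative k' s) (at s)" "\<And>s. (k' has_real_derivative k'' s) (at s)"
    and cont: "continuous_on UNIV k''"
  shows "twice_diff (\<lambda>x. k (f x)) (\<lambda>x. k' (f x) *\<^sub>R g x)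
    (\<lambda>x v. (k'' (f x) * (g x \<bullet> v)) *\<^sub>R g x + k' (f x) *\<^sub>R H x v)"
  unfolding twice_diff_def
proof (intro conjI allI)
  fix x v
  note f' = twice_diffD[OF f]
  have k1: "((\<lambda>x. k (f x)) has_derivative (\<lambda>v. k' (f x) * (g x \<bullet> v))) (at x)"
    using has_derivative_compose[OF f'(1), of k "(*) (k' (f x))"] k(1) by (simp add: has_field_derivative_def)
  have k2: "((\<lambda>x. k' (f x)) has_derivative (\<lambda>v. k'' (f x) * (g x \<bullet> v))) (at x)"
    using has_derivative_compose[OF f'(1), of k' "(*) (k'' (f x))"] k(2) by (simp add: has_field_derivative_def)
  show "((\<lambda>x. k (f x)) has_derivative (\<bullet>) (k' (f x) *\<^sub>R g x)) (at x)"
    using k1 by (rule has_derivative_eq_rhs) (simp add: fun_eq_iff)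
  show "((\<lambda>x. k' (f x) *\<^sub>R g x) has_derivative
      (\<lambda>v. (k'' (f x) * (g x \<bullet> v)) *\<^sub>R g x + k' (f x) *\<^sub>R H x v)) (at x)"
    using f'(2) by (auto intro!: derivative_eq_intros k2 simp: algebra_simps)
  have "continuous_on UNIV k'"
    using k(2) by (meson DERIV_isCont continuous_at_imp_continuous_on)
  then have "continuous_on UNIV (\<lambda>x. k' (f x))" "continuous_on UNIV (\<lambda>x. k'' (f x))"
    using cont f'(4) by (auto intro: continuous_on_compose2)
  then show "continuous_on UNIV (\<lambda>x. (k'' (f x) * (g x \<bullet> v)) *\<^sub>R g x + k' (f x) *\<^sub>R H x v)"
    by (intro continuous_intros f')
qed

text \<open>
  At the origin the difference quotient of the power is the next lower power of the positive part.
\<close>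

lemma DERIV_positive_part_power:
  "((\<lambda>s::real. max 0 s ^ Suc (Suc n)) has_real_derivative of_nat (Suc (Suc n)) * max 0 s ^ Suc n) (at s)"
proof -
  consider "s < 0" | "s > 0" | "s = 0" by linarith
  then show ?thesis
  proof cases
    case 1
    have "((\<lambda>s::real. 0) has_real_derivative of_nat (Suc (Suc n)) * max 0 s ^ Suc n) (at s)"
      using 1 by (auto intro!: derivative_eq_intros)
    then show ?thesis
      by (rule has_field_derivative_transform_within_open[where S = "{..<0}"]) (use 1 in auto)
  next
    case 2
    have "((\<lambda>s::real. s ^ Suc (Suc n)) has_real_derivative of_nat (Suc (Suc n)) * max 0 s ^ Suc n) (at s)"
      using 2 by (auto intro!: derivative_eq_intros simp del: power_Suc)
    then show ?thesis
      by (rule has_field_derivative_transform_within_open[where S = "{0<..}"]) (use 2 in auto)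
  next
    case 3
    have "((\<lambda>h::real. max 0 h ^ Suc n) \<longlongrightarrow> max 0 0 ^ Suc n) (at 0)"
      by (intro tendsto_intros)
    moreover have "max 0 h ^ Suc n = (max 0 (0 + h) ^ Suc (Suc n) - max 0 0 ^ Suc (Suc n)) / h"
      if "h \<noteq> 0" for h :: real
      using that by (cases "h > 0") auto
    ultimately have "((\<lambda>h::real. (max 0 (0 + h) ^ Suc (Suc n) - max 0 0 ^ Suc (Suc n)) / h) \<longlongrightarrow> 0) (at 0)"
      by (subst tendsto_cong[where g = "\<lambda>h. max 0 h ^ Suc n"]) (auto simp: eventually_at_filter)
    then show ?thesis using 3 by (simp add: DERIV_def)
  qed
qed

text \<open>
  The cube of the positive part of \<open>r\<^sup>2 - |x - p|\<^sup>2\<close> is twice continuously differentiable, and scaling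
  makes it at least 1 on the half ball.  The gradient vanishes outside the ball, which is what makes
  gluing on the boundary work.
\<close>

lemma twice_diff_bump:
  obtains bump :: "'a::euclidean_space \<Rightarrow> real" and g H where "twice_diff bump g H"
    "\<And>x. x \<in> ball p r \<Longrightarrow> bump x > 0" "\<And>x. x \<notin> ball p r \<Longrightarrow> bump x = 0 \<and> g x = 0"
    "\<And>x. x \<in> ball p (r / 2) \<Longrightarrow> bump x \<ge> 1"
proof -
  define c where "c = (4 / (3 * r\<^sup>2)) ^ 3"
  define k where "k s = c * max 0 s ^ 3" for s :: real
  have 3: "(k has_real_derivative (c * (3 * max 0 s ^ 2))) (at s)" for s
    unfolding k_def using DERIV_positive_part_power[of 1 s]
    by (intro DERIV_cmult) (simp add: numeral_eq_Suc)
  have 2: "((\<lambda>s. c * (3 * max 0 s ^ 2)) has_real_derivative (c * (6 * max 0 s))) (at s)" for s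
  proof (intro DERIV_cmult)
    have "((\<lambda>s. 3 * max 0 s ^ 2) has_real_derivative 3 * (2 * max 0 s)) (at s)"
      using DERIV_positive_part_power[of 0 s]
      by (intro DERIV_cmult) (simp add: numeral_eq_Suc)
    then show "((\<lambda>s. 3 * max 0 s ^ 2) has_real_derivative (6 * max 0 s)) (at s)" by simp
  qed
  define f where "f x = r\<^sup>2 - (x - p) \<bullet> (x - p)" for x :: 'a
  have f: "twice_diff f (\<lambda>x. (-2) *\<^sub>R (x - p)) (\<lambda>x v. (-2) *\<^sub>R v)"
    unfolding twice_diff_def f_def
    by (auto intro!: derivative_eq_intros continuous_intros simp: inner_diff_left inner_commute algebra_simps)
  have fb: "f x = r\<^sup>2 - (dist p x)\<^sup>2" for x
    by (simp add: f_def dist_norm norm_minus_commute[of p] power2_norm_eq_inner)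
  show ?thesis
  proof (rule that[of "\<lambda>x. if 0 < r then k (f x) else 0"])
    have cont: "continuous_on UNIV (\<lambda>s::real. c * (6 * max 0 s))" by (intro continuous_intros)
    note * = twice_diff_compose_real[OF f 3 2 cont]
    show "twice_diff (\<lambda>x. if 0 < r then k (f x) else 0) 
       (\<lambda>x. if 0 < r then (c * (3 * (max 0 (f x))\<^sup>2)) *\<^sub>R (-2) *\<^sub>R (x - p) else 0)
       (\<lambda>x v. if 0 < r then (c * (6 * max 0 (f x)) * ((-2) *\<^sub>R (x - p) \<bullet> v)) *\<^sub>R (-2) *\<^sub>R (x - p)
          + (c * (3 * (max 0 (f x))\<^sup>2)) *\<^sub>R (-2) *\<^sub>R v else 0)"
      using * twice_diff_zero by (cases "0 < r") (simp_all only: if_True if_False simp_thms)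
    show "(if 0 < r then k (f x) else 0) > 0" if "x \<in> ball p r" for x
    proof -
      have "0 < r" "f x > 0" using that le_less_trans[OF zero_le_dist] 
        by (auto simp: fb intro!: power_strict_mono)
      then show ?thesis by (simp add: k_def c_def)
    qed
    show "(if 0 < r then k (f x) else 0) = 0 \<and>
        (if 0 < r then (c * (3 * (max 0 (f x))\<^sup>2)) *\<^sub>R (-2) *\<^sub>R (x - p) else 0) = 0" if "x \<notin> ball p r" for x
    proof (cases "0 < r")
      case True
      with that have "f x \<le> 0" by (simp add: fb power_mono)
      then show ?thesis by (simp add: k_def)
    qed simp
    show "(if 0 < r then k (f x) else 0) \<ge> 1" if "x \<in> ball p (r / 2)" for x
    proof -
      have r: "0 < r" using that le_less_trans[OF zero_le_dist, of p x "r / 2"] by auto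
      have "(dist p x)\<^sup>2 \<le> (r / 2)\<^sup>2" using that by (intro power_mono) auto
      then have fx: "f x \<ge> 3 * r\<^sup>2 / 4" by (simp add: fb power_divide)
      have "1 = c * (3 * r\<^sup>2 / 4) ^ 3" using r by (simp add: c_def power_divide power_mult_distrib)
      also have "\<dots> \<le> c * (max 0 (f x)) ^ 3"
        using fx r by (intro mult_left_mono power_mono) (auto simp: c_def)
      finally show ?thesis using r by (simp add: k_def)
    qed
  qed
qed

text \<open>
  The orthogonal projection \<open>L\<close> along \<open>e\<close> is self-adjoint; hence it reappears in front of the gradient
  and of the Hessian.
\<close>

lemma twice_diff_graph:
  fixes e :: "'a::euclidean_space"
  assumes h: "twice_diff h g H"
  defines "L \<equiv> \<lambda>x. x - (x \<bullet> e) *\<^sub>R e"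
  shows "twice_diff (\<lambda>x. h (L x) - x \<bullet> e) (\<lambda>x. L (g (L x)) - e) (\<lambda>x v. L (H (L x) (L v)))"
proof -
  note h' = twice_diffD[OF h]
  have L: "bounded_linear L" 
    unfolding L_def by (intro bounded_linear_intros)
  have sym: "L x \<bullet> y = x \<bullet> L y" for x y
    by (simp add: L_def inner_diff_left inner_diff_right inner_commute)
  have dL: "(L has_derivative L) (at x)" for x
    using L by (rule bounded_linear_imp_has_derivative)
  have contL: "continuous_on UNIV L" using L by (rule linear_continuous_on)
  show ?thesis
    unfolding twice_diff_def
  proof (intro conjI allI)
    fix x v
    have "((\<lambda>x. h (L x)) has_derivative (\<lambda>v. g (L x) \<bullet> L v)) (at x)"
      by (rule has_derivative_compose[OF dL h'(1)])
    then have "((\<lambda>x. h (L x) - x \<bullet> e) has_derivative (\<lambda>v. g (L x) \<bullet> L v - v \<bullet> e)) (at x)"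
      by (intro derivative_intros)
    then show "((\<lambda>x. h (L x) - x \<bullet> e) has_derivative (\<bullet>) (L (g (L x)) - e)) (at x)"
      by (rule has_derivative_eq_rhs) (simp add: fun_eq_iff inner_diff_left inner_diff_right inner_commute flip: sym)
    have "((\<lambda>x. L (g (L x))) has_derivative (\<lambda>v. L (H (L x) (L v)))) (at x)"
      by (intro bounded_linear.has_derivative[OF L] has_derivative_compose[OF dL h'(2)])
    then show "((\<lambda>x. L (g (L x)) - e) has_derivative (\<lambda>v. L (H (L x) (L v)))) (at x)"
      by (auto intro!: derivative_eq_intros)
    show "continuous_on UNIV (\<lambda>x. L (H (L x) (L v)))"
      by (intro continuous_on_compose2[OF contL] continuous_on_compose2[OF h'(3) contL]) auto
  qed
qed

section \<open>Boundary charts\<close>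

text \<open>
  The part of the domain in the ball is the superlevel set of \<open>\<sigma>\<close>, the height of the boundary graph
  above the point.  Since \<open>\<sigma>\<close> decreases with unit speed along the axis \<open>e\<close>, its gradient is nonzero,
  and moving a point \<open>x\<close> by \<open>\<sigma> x\<close> along \<open>e\<close> projects it onto the graph.
\<close>

locale graph_chart =
  fixes \<Omega> :: "'a::euclidean_space set" and q :: 'a and r :: real and e :: 'a
    and \<sigma> :: "'a \<Rightarrow> real" and g :: "'a \<Rightarrow> 'a"
  assumes open_domain: "open \<Omega>"
    and norm_axis: "norm e = 1"
    and chart: "\<Omega> \<inter> ball q r = {x \<in> ball q r. 0 < \<sigma> x}"
    and shift: "\<sigma> (x + s *\<^sub>R e) = \<sigma> x - s"
    and deriv: "(\<sigma> has_derivative (\<lambda>v. g x \<bullet> v)) (at x)"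
begin

lemma line_deriv: "((\<lambda>s. \<sigma> (x + s *\<^sub>R v)) has_real_derivative g x \<bullet> v) (at 0)"
proof -
  have "((\<lambda>s. \<sigma> (x + s *\<^sub>R v)) has_derivative (\<lambda>s. g x \<bullet> (s *\<^sub>R v))) (at 0)"
    by (rule has_derivative_compose[where g = \<sigma> and f = "\<lambda>s. x + s *\<^sub>R v"])
       (auto intro!: derivative_eq_intros deriv)
  then show ?thesis
    unfolding has_field_derivative_def by (rule has_derivative_eq_rhs) (simp add: fun_eq_iff)
qed

lemma grad_axis: "g x \<bullet> e = -1"
proof -
  have "((\<lambda>s. \<sigma> (x + s *\<^sub>R e)) has_real_derivative -1) (at 0)"
    by (auto simp: shift intro!: derivative_eq_intros)
  with line_deriv show ?thesis by (rule DERIV_unique)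
qed

lemma norm_grad_ge_1: "norm (g x) \<ge> 1"
  using Cauchy_Schwarz_ineq2[of "g x" e] by (simp add: grad_axis norm_axis)

lemma isCont: "isCont \<sigma> x"
  using deriv by (rule has_derivative_continuous)

lemma eventually_in_chart:
  assumes "x \<in> ball q r"
  shows "\<forall>\<^sub>F t in nhds 0. x + t *\<^sub>R v \<in> ball q r"
proof -
  have "((\<lambda>t. x + t *\<^sub>R v) \<longlongrightarrow> x + 0 *\<^sub>R v) (nhds 0)"
    by (intro tendsto_intros filterlim_ident)
  then show ?thesis using assms by (intro topological_tendstoD) auto
qed

lemma closure_nonneg:
  assumes "x \<in> closure \<Omega>" "x \<in> ball q r"
  shows "\<sigma> x \<ge> 0"
proof (rule ccontr)
  assume "\<not> \<sigma> x \<ge> 0"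
  have "open {y. \<sigma> y < 0}"
    by (intro open_Collect_less continuous_intros) (use isCont in \<open>auto simp: continuous_on_eq_continuous_at\<close>)
  then have "open ({y. \<sigma> y < 0} \<inter> ball q r)" by auto
  moreover have "x \<in> {y. \<sigma> y < 0} \<inter> ball q r" using \<open>\<not> \<sigma> x \<ge> 0\<close> assms by auto
  ultimately have "({y. \<sigma> y < 0} \<inter> ball q r) \<inter> \<Omega> \<noteq> {}"
    using assms(1) open_Int_closure_eq_empty[of "{y. \<sigma> y < 0} \<inter> ball q r" \<Omega>] by auto
  then obtain y where "y \<in> \<Omega> \<inter> ball q r" "\<sigma> y < 0" by blast
  then show False unfolding chart by simp
qed

lemma frontier_iff:
  assumes "x \<in> ball q r"
  shows "x \<in> frontier \<Omega> \<longleftrightarrow> \<sigma> x = 0"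
proof
  assume x: "x \<in> frontier \<Omega>"
  then have "x \<in> closure \<Omega>" "x \<notin> \<Omega>" using open_domain by (auto simp: frontier_def interior_open)
  then show "\<sigma> x = 0" using closure_nonneg[of x] chart assms by force
next
  assume 0: "\<sigma> x = 0"
  have "x \<in> closure \<Omega>"
    unfolding closure_approachable
  proof (intro allI impI)
    fix d :: real assume "d > 0"
    have "\<forall>\<^sub>F t in at_right 0. x + t *\<^sub>R (- e) \<in> ball q r"
      using eventually_in_chart[OF assms, of "- e"] by (simp add: eventually_nhds_conv_at eventually_at_split)
    moreover have "\<forall>\<^sub>F t in at_right (0::real). 0 < t \<and> t < d" using \<open>d > 0\<close>
      by (auto simp: eventually_at_right_field)
    ultimately have "\<forall>\<^sub>F t in at_right 0. x + t *\<^sub>R (- e) \<in> ball q r \<and> 0 < t \<and> t < d"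
      by eventually_elim auto
    then obtain t where t: "x + t *\<^sub>R (- e) \<in> ball q r" "0 < t" "t < d"
      using eventually_happens trivial_limit_at_right_real by blast
    have "\<sigma> (x + t *\<^sub>R (- e)) = t" using shift[of x "- t"] 0 by simp
    then have "x + t *\<^sub>R (- e) \<in> \<Omega>" using t chart by force
    then show "\<exists>y\<in>\<Omega>. dist y x < d"
      using t norm_axis by (intro bexI[of _ "x + t *\<^sub>R (- e)"]) (auto simp: dist_norm)
  qed
  moreover have "x \<notin> \<Omega>" using 0 chart assms by force
  ultimately show "x \<in> frontier \<Omega>" using open_domain by (simp add: frontier_def interior_open)
qed

context
  fixes p assumes p: "p \<in> frontier \<Omega>" "p \<in> ball q r"
begin

lemma inward:
  assumes "g p \<bullet> v > 0"
  shows "\<forall>\<^sub>F t in at_right 0. p + t *\<^sub>R v \<in> \<Omega>"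
proof -
  have "\<sigma> p = 0" using frontier_iff p by blast
  from DERIV_pos_inc_right[OF line_deriv assms]
  obtain d where d: "d > 0" "\<And>h. 0 < h \<Longrightarrow> h < d \<Longrightarrow> \<sigma> (p + h *\<^sub>R v) > 0" 
    using \<open>\<sigma> p = 0\<close> by auto
  then have "\<forall>\<^sub>F t in at_right 0. \<sigma> (p + t *\<^sub>R v) > 0" by (auto simp: eventually_at_right_field)
  moreover have "\<forall>\<^sub>F t in at_right 0. p + t *\<^sub>R v \<in> ball q r"
    using eventually_in_chart[OF p(2), of v] by (simp add: eventually_nhds_conv_at eventually_at_split)
  ultimately show ?thesis by eventually_elim (use chart in blast)
qed

lemma outward:
  assumes "g p \<bullet> v < 0"
  shows "\<forall>\<^sub>F t in at_right 0. p + t *\<^sub>R v \<notin> closure \<Omega>"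
proof -
  have "\<sigma> p = 0" using frontier_iff p by blast
  from DERIV_neg_dec_right[OF line_deriv assms]
  obtain d where d: "d > 0" "\<And>h. 0 < h \<Longrightarrow> h < d \<Longrightarrow> \<sigma> (p + h *\<^sub>R v) < 0" 
    using \<open>\<sigma> p = 0\<close> by auto
  then have "\<forall>\<^sub>F t in at_right 0. \<sigma> (p + t *\<^sub>R v) < 0" by (auto simp: eventually_at_right_field)
  moreover have "\<forall>\<^sub>F t in at_right 0. p + t *\<^sub>R v \<in> ball q r"
    using eventually_in_chart[OF p(2), of v] by (simp add: eventually_nhds_conv_at eventually_at_split)
  ultimately show ?thesis by eventually_elim (use closure_nonneg in force)
qed

text \<open>
  A direction orthogonal to the gradient is realised by the straight line in that direction, projected
  onto the graph along the axis.
\<close>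

lemma tangent_space_eq: "tangent_space (frontier \<Omega>) p = {v. g p \<bullet> v = 0}"
proof (intro set_eqI iffI)
  fix v assume "v \<in> tangent_space (frontier \<Omega>) p"
  then obtain c where c: "c 0 = p" "\<forall>\<^sub>F t in nhds 0. c t \<in> frontier \<Omega>" "(c has_vector_derivative v) (at (0::real))"
    by (auto simp: tangent_space_def)
  have d: "((\<lambda>t. \<sigma> (c t)) has_derivative (\<lambda>t. g p \<bullet> (t *\<^sub>R v))) (at 0)"
    using has_derivative_compose[OF c(3)[unfolded has_vector_derivative_def] deriv[of "c 0"]] 
    by (simp only: c(1))
  have "isCont c 0" using c(3) by (rule has_vector_derivative_continuous)
  then have "(c \<longlongrightarrow> p) (nhds 0)"
    unfolding isCont_def tendsto_at_iff_tendsto_nhds by (simp only: c(1))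
  then have "\<forall>\<^sub>F t in nhds 0. c t \<in> ball q r" using p by (intro topological_tendstoD) auto
  with c(2) have "\<forall>\<^sub>F t in nhds 0. \<sigma> (c t) = 0" by eventually_elim (use frontier_iff in blast)
  moreover have "((\<lambda>t. \<sigma> (c t)) has_real_derivative g p \<bullet> v) (at 0)"
    unfolding has_field_derivative_def using d by (rule has_derivative_eq_rhs) (simp add: fun_eq_iff)
  ultimately have "((\<lambda>t. 0) has_real_derivative g p \<bullet> v) (at 0)"
    using DERIV_cong_ev[of 0 0 "\<lambda>t. \<sigma> (c t)" "\<lambda>t. 0" "g p \<bullet> v" "g p \<bullet> v"] by simp
  then have "g p \<bullet> v = 0" by (rule DERIV_unique[OF _ DERIV_const])
  then show "v \<in> {v. g p \<bullet> v = 0}" by simp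
next
  fix v assume "v \<in> {v. g p \<bullet> v = 0}"
  then have v: "g p \<bullet> v = 0" by simp
  \<comment> \<open>The line in the direction \<open>v\<close>, projected onto the graph along the axis.\<close>
  define c where "c t = p + t *\<^sub>R v + \<sigma> (p + t *\<^sub>R v) *\<^sub>R e" for t :: real
  have 0: "\<sigma> p = 0" using frontier_iff p by blast
  have "((\<lambda>t. \<sigma> (p + t *\<^sub>R v)) has_vector_derivative 0) (at 0)"
    using line_deriv[of p v] v by (simp add: has_real_derivative_iff_has_vector_derivative)
  then have c': "(c has_vector_derivative v) (at 0)"
    unfolding c_def has_vector_derivative_def by (auto intro!: derivative_eq_intros)
  have "\<sigma> (c t) = 0" for t by (simp add: c_def shift)
  moreover have "\<forall>\<^sub>F t in nhds 0. c t \<in> ball q r"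
  proof -
    have "isCont c 0" using c' by (rule has_vector_derivative_continuous)
    then have "(c \<longlongrightarrow> c 0) (nhds 0)" by (simp only: isCont_def tendsto_at_iff_tendsto_nhds)
    moreover have "c 0 = p" by (simp add: c_def 0)
    ultimately have "(c \<longlongrightarrow> p) (nhds 0)" by simp
    then show ?thesis using p by (intro topological_tendstoD) auto
  qed
  ultimately have "\<forall>\<^sub>F t in nhds 0. c t \<in> frontier \<Omega>"
    by (auto simp: frontier_iff elim: eventually_mono)
  then show "v \<in> tangent_space (frontier \<Omega>) p"
    unfolding tangent_space_def using c' 0 by (auto simp: c_def intro!: exI[of _ c])
qed

text \<open>
  Orthogonality to the tangent space leaves only the two unit multiples of the gradient, and the
  inward one is excluded by \<open>inward\<close>.
\<close>

lemma outer_normal_eq: "outer_normal \<Omega> p = - (g p /\<^sub>R norm (g p))"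
proof -
  define n where "n = g p /\<^sub>R norm (g p)"
  have pos: "norm (g p) > 0" using norm_grad_ge_1[of p] by linarith
  have n: "norm n = 1" "g p = norm (g p) *\<^sub>R n" using pos by (auto simp: n_def)
  have gn: "g p \<bullet> v = norm (g p) * (n \<bullet> v)" for v by (subst n(2)) simp
  have nn: "n \<bullet> n = 1" using n(1) by (simp add: dot_square_norm)
  show ?thesis
    unfolding outer_normal_def n_def[symmetric]
  proof (rule the_equality)
    have "\<forall>\<^sub>F t in at_right 0. p + t *\<^sub>R (- n) \<notin> closure \<Omega>"
      by (rule outward) (use gn[of "- n"] nn pos in simp)
    then obtain d where "d > 0" "\<And>t. 0 < t \<Longrightarrow> t < d \<Longrightarrow> p + t *\<^sub>R (- n) \<notin> closure \<Omega>"
      by (auto simp: eventually_at_right_field)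
    moreover have "n \<bullet> v = 0" if "g p \<bullet> v = 0" for v using that gn pos by simp
    ultimately show "norm (- n) = 1 \<and> (\<forall>v\<in>tangent_space (frontier \<Omega>) p. - n \<bullet> v = 0) \<and>
        (\<exists>\<delta>>0. \<forall>t\<in>{0<..<\<delta>}. p + t *\<^sub>R (- n) \<notin> closure \<Omega>)"
      using n by (auto simp: tangent_space_eq)
  next
    fix m assume m: "norm m = 1 \<and> (\<forall>v\<in>tangent_space (frontier \<Omega>) p. m \<bullet> v = 0) \<and>
        (\<exists>\<delta>>0. \<forall>t\<in>{0<..<\<delta>}. p + t *\<^sub>R m \<notin> closure \<Omega>)"
    define k where "k = m \<bullet> n"
    define v where "v = m - k *\<^sub>R n"
    have "n \<bullet> v = 0" by (simp add: v_def k_def inner_diff_right nn inner_commute)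
    then have "g p \<bullet> v = 0" using gn by simp
    then have "m \<bullet> v = 0" using m by (simp add: tangent_space_eq)
    then have "v \<bullet> v = 0" using \<open>n \<bullet> v = 0\<close> by (simp add: v_def inner_diff_left)
    then have m_eq: "m = k *\<^sub>R n" by (simp add: v_def)
    then have "\<bar>k\<bar> = 1" using m n by simp
    moreover have "k \<noteq> 1"
    proof
      assume "k = 1"
      then have "m = n" using m_eq by simp
      obtain d where "d > 0" "\<And>t. 0 < t \<Longrightarrow> t < d \<Longrightarrow> p + t *\<^sub>R n \<notin> closure \<Omega>"
        using m \<open>m = n\<close> by auto
      then have "\<forall>\<^sub>F t in at_right 0. p + t *\<^sub>R n \<notin> closure \<Omega>" by (auto simp: eventually_at_right_field)
      moreover have "\<forall>\<^sub>F t in at_right 0. p + t *\<^sub>R n \<in> \<Omega>"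
        by (rule inward) (use gn[of n] nn pos in simp)
      ultimately have "\<forall>\<^sub>F t in at_right (0::real). False"
        by eventually_elim (use closure_subset in blast)
      then show False by (simp add: trivial_limit_def[symmetric])
    qed
    ultimately show "m = - n" using m_eq by (auto simp: abs_if split: if_splits)
  qed
qed

end

end

section \<open>A global defining function\<close>

text \<open>
  \<open>\<rho>\<close> is nonnegative on the domain and vanishes on its boundary, and \<open>g\<close> and \<open>H\<close> are its gradient and
  Hessian.  Strict positivity inside is not asked for, since a sum of chart functions cut off near the
  boundary vanishes far from it.  All the geometry of the domain enters the estimates through the
  bound \<open>C\<close>.
\<close>

locale defined_domain =
  fixes \<Omega> :: "'a::euclidean_space set" and \<rho> :: "'a \<Rightarrow> real" and g :: "'a \<Rightarrow> 'a"
    and H :: "'a \<Rightarrow> 'a \<Rightarrow> 'a" and C :: real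
  assumes open_domain: "open \<Omega>" and bounded_domain: "bounded \<Omega>"
    and twice_diff: "twice_diff \<rho> g H"
    and nonneg: "x \<in> closure \<Omega> \<Longrightarrow> 0 \<le> \<rho> x"
    and le: "x \<in> closure \<Omega> \<Longrightarrow> \<rho> x \<le> C"
    and grad_le: "x \<in> closure \<Omega> \<Longrightarrow> norm (g x) \<le> C"
    and hess_le: "x \<in> closure \<Omega> \<Longrightarrow> norm (H x v) \<le> C * norm v"
    and frontier_zero: "x \<in> frontier \<Omega> \<Longrightarrow> \<rho> x = 0"
    and frontier_grad: "x \<in> frontier \<Omega> \<Longrightarrow> 1 \<le> norm (g x)"
    and inward: "x \<in> frontier \<Omega> \<Longrightarrow> 0 < g x \<bullet> v \<Longrightarrow> \<forall>\<^sub>F t in at_right 0. x + t *\<^sub>R v \<in> \<Omega>"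
    and tangent: "x \<in> frontier \<Omega> \<Longrightarrow> tangent_space (frontier \<Omega>) x = {v. g x \<bullet> v = 0}"
    and normal: "x \<in> frontier \<Omega> \<Longrightarrow> outer_normal \<Omega> x = - (g x /\<^sub>R norm (g x))"

lemma twice_diff_bounded_on_compact:
  assumes "twice_diff f g H" "compact K"
  obtains C where "C \<ge> 0" "\<And>x. x \<in> K \<Longrightarrow> \<bar>f x\<bar> \<le> C" "\<And>x. x \<in> K \<Longrightarrow> norm (g x) \<le> C"
    "\<And>x v. x \<in> K \<Longrightarrow> norm (H x v) \<le> C * norm v"
proof -
  note f = twice_diffD[OF assms(1)]
  have bd: "\<exists>C\<ge>0. \<forall>x\<in>K. norm (k x) \<le> C" if "continuous_on K k" for k :: "'a \<Rightarrow> 'b::real_normed_vector"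
    using compact_imp_bounded[OF compact_continuous_image[OF that assms(2)]]
    by (meson bounded_pos imageI order_less_imp_le)
  obtain C1 where C1: "C1 \<ge> 0" "\<And>x. x \<in> K \<Longrightarrow> norm (f x) \<le> C1" using bd[OF f(4)] by blast
  obtain C2 where C2: "C2 \<ge> 0" "\<And>x. x \<in> K \<Longrightarrow> norm (g x) \<le> C2" using bd[OF f(5)] by blast
  have "continuous_on K (\<lambda>x. \<Sum>b\<in>Basis. norm (H x b))"
    by (intro continuous_intros continuous_on_subset[OF f(3)]) auto
  from bd[OF this] obtain C3 where C3: "C3 \<ge> 0" "\<And>x. x \<in> K \<Longrightarrow> (\<Sum>b\<in>Basis. norm (H x b)) \<le> C3"
    unfolding real_norm_def by (meson abs_le_D1)
  have H: "norm (H x v) \<le> C3 * norm v" if "x \<in> K" for x v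
  proof -
    have "H x v = H x (\<Sum>b\<in>Basis. (v \<bullet> b) *\<^sub>R b)" by (simp add: euclidean_representation)
    also have "\<dots> = (\<Sum>b\<in>Basis. (v \<bullet> b) *\<^sub>R H x b)"
      by (simp add: linear_sum[OF f(6)] linear_cmul[OF f(6)])
    also have "norm \<dots> \<le> (\<Sum>b\<in>Basis. \<bar>v \<bullet> b\<bar> * norm (H x b))"
      by (rule order_trans[OF norm_sum]) simp
    also have "\<dots> \<le> (\<Sum>b\<in>Basis. norm v * norm (H x b))"
      by (intro sum_mono mult_right_mono Basis_le_norm) auto
    also have "\<dots> \<le> norm v * C3"
      unfolding sum_distrib_left[symmetric] using C3(2)[OF that] by (intro mult_left_mono) auto
    finally show ?thesis by (simp add: mult.commute)
  qed
  show ?thesis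
  proof (rule that[of "C1 + C2 + C3"])
    fix x v assume "x \<in> K"
    show "norm (H x v) \<le> (C1 + C2 + C3) * norm v"
      by (rule order_trans[OF H[OF \<open>x \<in> K\<close>]]) (use C1 C2 in \<open>auto intro!: mult_right_mono\<close>)
    show "\<bar>f x\<bar> \<le> C1 + C2 + C3" using C1(2)[OF \<open>x \<in> K\<close>] C2(1) C3(1) by simp
    show "norm (g x) \<le> C1 + C2 + C3" using C2(2)[OF \<open>x \<in> K\<close>] C1(1) C3(1) by simp
  qed (use C1 C2 C3 in simp)
qed

lemma smooth_bounded_domain_chart:
  assumes "smooth_bounded_domain \<Omega>" "p \<in> frontier \<Omega>"
  shows "\<exists>r e \<sigma> g H. 0 < r \<and> graph_chart \<Omega> p r e \<sigma> g \<and> twice_diff \<sigma> g H"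
proof -
  obtain r e h where r: "r > 0" "norm e = 1" "smooth_on h UNIV"
    "\<Omega> \<inter> ball p r = {x \<in> ball p r. x \<bullet> e < h (x - (x \<bullet> e) *\<^sub>R e)}"
    using assms unfolding smooth_bounded_domain_def by blast
  obtain gh Hh where "twice_diff h gh Hh" using smooth_on_twice_diff r(3) by blast
  note * = twice_diff_graph[OF this, of e]
  have e: "e \<bullet> e = 1" using r(2) by (simp add: dot_square_norm)
  define \<sigma> where "\<sigma> x = h (x - (x \<bullet> e) *\<^sub>R e) - x \<bullet> e" for x
  have "graph_chart \<Omega> p r e \<sigma> (\<lambda>x. gh (x - (x \<bullet> e) *\<^sub>R e) - (gh (x - (x \<bullet> e) *\<^sub>R e) \<bullet> e) *\<^sub>R e - e)"
  proof
    show "open \<Omega>" using assms(1) by (simp add: smooth_bounded_domain_def)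
    show "\<Omega> \<inter> ball p r = {x \<in> ball p r. 0 < \<sigma> x}" using r(4) by (simp add: \<sigma>_def)
    show "\<sigma> (x + s *\<^sub>R e) = \<sigma> x - s" for x s
      by (simp add: \<sigma>_def inner_add_left e algebra_simps)
    show "(\<sigma> has_derivative (\<lambda>v. (gh (x - (x \<bullet> e) *\<^sub>R e) - (gh (x - (x \<bullet> e) *\<^sub>R e) \<bullet> e) *\<^sub>R e - e) \<bullet> v)) (at x)" for x
      unfolding \<sigma>_def by (rule twice_diffD(1)[OF *])
  qed (rule r)
  with * \<open>r > 0\<close> show ?thesis unfolding \<sigma>_def by blast
qed

text \<open>
  Sum the chart functions, multiplied by bumps whose half balls cover the boundary.  At a boundary point
  each chart function vanishes, so the gradient of the sum is a combination with nonnegative weights of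
  chart gradients.  All of these are inward multiples of the same normal, so there is no cancellation.
\<close>

theorem smooth_bounded_domain_defined:
  assumes "smooth_bounded_domain \<Omega>"
  shows "\<exists>\<rho> g H C. defined_domain \<Omega> \<rho> g H C"
proof -
  have bdd: "bounded \<Omega>" and op: "open \<Omega>" using assms by (auto simp: smooth_bounded_domain_def)
  obtain r e \<sigma> g H where ch: "\<And>p. p \<in> frontier \<Omega> \<Longrightarrow> 0 < r p"
    "\<And>p. p \<in> frontier \<Omega> \<Longrightarrow> graph_chart \<Omega> p (r p) (e p) (\<sigma> p) (g p)"
    "\<And>p. p \<in> frontier \<Omega> \<Longrightarrow> twice_diff (\<sigma> p) (g p) (H p)"
    using smooth_bounded_domain_chart[OF assms] by metis
  have "\<exists>bump g H. twice_diff bump g H \<and> (\<forall>x\<in>ball p (r p). bump x > 0) \<and>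
      (\<forall>x. x \<notin> ball p (r p) \<longrightarrow> bump x = 0 \<and> g x = 0) \<and> (\<forall>x\<in>ball p (r p / 2). bump x \<ge> (1::real))" for p
    by (rule twice_diff_bump[of p "r p"], intro exI conjI) auto
  then obtain bump bg bH where bump: "\<And>p. twice_diff (bump p) (bg p) (bH p)"
    "\<And>p x. x \<in> ball p (r p) \<Longrightarrow> bump p x > (0::real)"
    "\<And>p x. x \<notin> ball p (r p) \<Longrightarrow> bump p x = 0 \<and> bg p x = 0"
    "\<And>p x. x \<in> ball p (r p / 2) \<Longrightarrow> bump p x \<ge> 1"
    by metis
  have cover: "frontier \<Omega> \<subseteq> (\<Union>p\<in>frontier \<Omega>. ball p (r p / 2))"
  proof
    fix p assume "p \<in> frontier \<Omega>"
    moreover from this have "p \<in> ball p (r p / 2)" using ch(1) by simp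
    ultimately show "p \<in> (\<Union>p\<in>frontier \<Omega>. ball p (r p / 2))" by blast
  qed
  have "compact (frontier \<Omega>)" using bdd by (rule compact_frontier_bounded)
  then obtain J where J: "J \<subseteq> frontier \<Omega>" "finite J" "frontier \<Omega> \<subseteq> (\<Union>p\<in>J. ball p (r p / 2))"
    by (rule compactE_image[where C = "frontier \<Omega>" and f = "\<lambda>p. ball p (r p / 2)"])
       (use cover in auto)
  define \<rho> where "\<rho> x = (\<Sum>p\<in>J. bump p x * \<sigma> p x)" for x
  define G where "G x = (\<Sum>p\<in>J. bump p x *\<^sub>R g p x + \<sigma> p x *\<^sub>R bg p x)" for x
  define HH where "HH x v = (\<Sum>p\<in>J. bump p x *\<^sub>R H p x v + (bg p x \<bullet> v) *\<^sub>R g p x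
      + \<sigma> p x *\<^sub>R bH p x v + (g p x \<bullet> v) *\<^sub>R bg p x)" for x v
  have td: "twice_diff \<rho> G HH"
    unfolding \<rho>_def G_def HH_def
    by (intro twice_diff_sum twice_diff_mult bump ch) (use J in auto)
  have "compact (closure \<Omega>)" using bdd by simp
  with td obtain C where C: "\<And>x. x \<in> closure \<Omega> \<Longrightarrow> \<bar>\<rho> x\<bar> \<le> C"
    "\<And>x. x \<in> closure \<Omega> \<Longrightarrow> norm (G x) \<le> C"
    "\<And>x v. x \<in> closure \<Omega> \<Longrightarrow> norm (HH x v) \<le> C * norm v"
    by (rule twice_diff_bounded_on_compact) blast
  have nn: "0 \<le> \<rho> x" if "x \<in> closure \<Omega>" for x
    unfolding \<rho>_def
  proof (rule sum_nonneg)
    fix p assume "p \<in> J"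
    then have "p \<in> frontier \<Omega>" using J by auto
    then show "0 \<le> bump p x * \<sigma> p x"
      using graph_chart.closure_nonneg[OF ch(2)[of p] that] bump(2)[of x p] bump(3)[of x p]
      by (cases "x \<in> ball p (r p)") (simp_all del: mem_ball)
  qed
  have zero: "\<rho> x = 0" if "x \<in> frontier \<Omega>" for x
    unfolding \<rho>_def
  proof (rule sum.neutral, rule ballI)
    fix p assume "p \<in> J"
    then have "p \<in> frontier \<Omega>" using J by auto
    then show "bump p x * \<sigma> p x = 0"
      using graph_chart.frontier_iff[OF ch(2)[of p], of x] bump(3)[of x p] that
      by (cases "x \<in> ball p (r p)") (simp_all del: mem_ball)
  qed
  have grad: "\<exists>p\<in>J. \<exists>l>0. x \<in> ball p (r p) \<and> 1 \<le> norm (G x) \<and> G x = l *\<^sub>R g p x" if x: "x \<in> frontier \<Omega>" for x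
  proof -
    define l where "l = (\<Sum>p\<in>J. bump p x * norm (g p x))"
    have "G x = (\<Sum>p\<in>J. (bump p x * norm (g p x)) *\<^sub>R (- outer_normal \<Omega> x))"
      unfolding G_def
    proof (rule sum.cong[OF refl])
      fix p assume "p \<in> J"
      then have p: "p \<in> frontier \<Omega>" using J by auto
      show "bump p x *\<^sub>R g p x + \<sigma> p x *\<^sub>R bg p x = (bump p x * norm (g p x)) *\<^sub>R (- outer_normal \<Omega> x)"
      proof (cases "x \<in> ball p (r p)")
        case True
        then have "\<sigma> p x = 0" using graph_chart.frontier_iff[OF ch(2)[OF p]] x by auto
        moreover have "norm (g p x) *\<^sub>R (- outer_normal \<Omega> x) = g p x"
        proof -
          have "norm (g p x) \<noteq> 0" using graph_chart.norm_grad_ge_1[OF ch(2)[OF p], of x] by linarith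
          then show ?thesis using graph_chart.outer_normal_eq[OF ch(2)[OF p] x True] by simp
        qed
        ultimately show ?thesis by (metis add.right_neutral scaleR_scaleR scaleR_zero_left)
      next
        case False
        then show ?thesis using bump(3) by simp
      qed
    qed
    then have G: "G x = l *\<^sub>R (- outer_normal \<Omega> x)" by (simp only: l_def scaleR_sum_left)
    obtain p where p: "p \<in> J" "x \<in> ball p (r p / 2)" using J(3) x by auto
    then have pf: "p \<in> frontier \<Omega>" using J by auto
    have xb: "x \<in> ball p (r p)" using p ch(1)[OF pf] by auto
    have n1: "norm (g p x) \<ge> 1" using graph_chart.norm_grad_ge_1[OF ch(2)[OF pf]] .
    have on: "- outer_normal \<Omega> x = g p x /\<^sub>R norm (g p x)"
      using graph_chart.outer_normal_eq[OF ch(2)[OF pf] x xb] by simp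
    have pos: "bump q x \<ge> 0" for q
      using bump(2)[of x q] bump(3)[of x q] by (cases "x \<in> ball q (r q)") auto
    have "1 \<le> bump p x * norm (g p x)" using mult_mono[OF bump(4)[OF p(2)] n1] pos[of p] by simp
    also have "\<dots> \<le> l" unfolding l_def
      by (rule member_le_sum) (use p J pos in auto)
    finally have "l \<ge> 1" .
    have "norm (G x) = l" using \<open>l \<ge> 1\<close> n1 unfolding G on by (auto simp: divide_simps)
    moreover have "G x = (l / norm (g p x)) *\<^sub>R g p x" unfolding G on by (simp add: divide_inverse)
    moreover have "l / norm (g p x) > 0" using \<open>l \<ge> 1\<close> n1 by (intro divide_pos_pos) linarith+
    ultimately show ?thesis using \<open>l \<ge> 1\<close> p(1) xb by (intro bexI[of _ p] exI[of _ "l / norm (g p x)"]) auto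
  qed
  have "defined_domain \<Omega> \<rho> G HH C"
  proof
    fix x assume x: "x \<in> frontier \<Omega>"
    obtain p l where p: "p \<in> J" "l > 0" "x \<in> ball p (r p)" "1 \<le> norm (G x)" "G x = l *\<^sub>R g p x"
      using grad[OF x] by auto
    then have pf: "p \<in> frontier \<Omega>" using J by auto
    note chp = ch(2)[OF pf]
    show "1 \<le> norm (G x)" by fact
    show "\<forall>\<^sub>F t in at_right 0. x + t *\<^sub>R v \<in> \<Omega>" if "0 < G x \<bullet> v" for v
      using graph_chart.inward[OF chp x p(3), of v] that p(2,5) by (simp add: zero_less_mult_iff)
    show "tangent_space (frontier \<Omega>) x = {v. G x \<bullet> v = 0}"
      using graph_chart.tangent_space_eq[OF chp x p(3)] p(2,5) by simp
    show "outer_normal \<Omega> x = - (G x /\<^sub>R norm (G x))"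
      using graph_chart.outer_normal_eq[OF chp x p(3)] p(2,5) by simp
  next
    show "\<rho> x \<le> C" if "x \<in> closure \<Omega>" for x using C(1)[OF that] by simp
  qed (fact bdd op td nn zero C(2,3))+
  then show ?thesis by blast
qed

section \<open>One-sided derivatives and the parabolic maximum principle\<close>

lemma directional_difference_quotient:
  fixes f :: "'a::real_normed_vector \<Rightarrow> real"
  assumes f: "(f has_derivative D) (at x within S)" and "x \<in> S"
    and S: "\<forall>\<^sub>F t in at_right 0. x + t *\<^sub>R v \<in> S"
  shows "((\<lambda>t. (f (x + t *\<^sub>R v) - f x) / t) \<longlongrightarrow> D v) (at_right 0)"
proof -
  obtain d where d: "d > 0" "\<And>t. 0 < t \<Longrightarrow> t < d \<Longrightarrow> x + t *\<^sub>R v \<in> S"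
    using S by (auto simp: eventually_at_right_field)
  have sub: "(\<lambda>t. x + t *\<^sub>R v) ` {0..<d} \<subseteq> S"
  proof
    fix y assume "y \<in> (\<lambda>t. x + t *\<^sub>R v) ` {0..<d}"
    then obtain t where "0 \<le> t" "t < d" "y = x + t *\<^sub>R v" by auto
    then show "y \<in> S" using d(2)[of t] \<open>x \<in> S\<close> by (cases "t = 0") auto
  qed
  have "((\<lambda>t. f (x + t *\<^sub>R v)) has_derivative (\<lambda>t. D (t *\<^sub>R v))) (at 0 within {0..<d})"
    by (rule has_derivative_in_compose[where g = f and f = "\<lambda>t. x + t *\<^sub>R v"])
       (use has_derivative_subset[OF f sub] in \<open>auto intro!: derivative_eq_intros\<close>)
  then have "((\<lambda>t. f (x + t *\<^sub>R v)) has_real_derivative D v) (at 0 within {0..<d})"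
    unfolding has_field_derivative_def
    by (rule has_derivative_eq_rhs) (simp add: fun_eq_iff linear_cmul[OF has_derivative_linear[OF f]])
  then have "((\<lambda>t. (f (x + t *\<^sub>R v) - f x) / t) \<longlongrightarrow> D v) (at 0 within {0..<d})"
    by (simp add: has_field_derivative_iff)
  then have "((\<lambda>t. (f (x + t *\<^sub>R v) - f x) / t) \<longlongrightarrow> D v) (at 0 within {0<..<d})"
    by (rule tendsto_within_subset) auto
  moreover have "at 0 within {0<..<d} = at_right (0::real)"
    by (rule at_within_nhd[of _ "{..<d}"]) (use d in auto)
  ultimately show ?thesis by simp
qed

context defined_domain
begin

lemma in_closure_cases:
  assumes "x \<in> closure \<Omega>"
  obtains "x \<in> \<Omega>" | "x \<in> frontier \<Omega>"
  using assms open_domain by (auto simp: frontier_def interior_open)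

lemma domain_subset: "x \<in> \<Omega> \<Longrightarrow> x \<in> closure \<Omega>" "x \<in> frontier \<Omega> \<Longrightarrow> x \<in> closure \<Omega>"
  using closure_subset by (auto simp: frontier_def)

lemma ray_inside:
  assumes "x \<in> \<Omega>"
  shows "\<forall>\<^sub>F t in at_right 0. x + t *\<^sub>R v \<in> \<Omega>"
proof -
  have "((\<lambda>t. x + t *\<^sub>R v) \<longlongrightarrow> x + 0 *\<^sub>R v) (at_right 0)"
    by (intro tendsto_intros)
  then show ?thesis using assms open_domain by (intro topological_tendstoD) auto
qed

lemma ray_inside_closure:
  assumes "x \<in> \<Omega> \<or> x \<in> frontier \<Omega> \<and> 0 < g x \<bullet> v"
  shows "\<forall>\<^sub>F t in at_right 0. x + t *\<^sub>R v \<in> closure \<Omega>"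
proof -
  have "\<forall>\<^sub>F t in at_right 0. x + t *\<^sub>R v \<in> \<Omega>" using assms ray_inside inward by blast
  then show ?thesis by eventually_elim (rule domain_subset)
qed

text \<open>
  At a boundary point a derivative is determined on the open half space of inward directions, and these
  directions span the whole space.
\<close>

lemma has_derivative_unique_closure:
  fixes f :: "'a \<Rightarrow> real"
  assumes "(f has_derivative D1) (at x within closure \<Omega>)"
    and "(f has_derivative D2) (at x within closure \<Omega>)" and x: "x \<in> closure \<Omega>"
  shows "D1 = D2"
proof
  fix v
  have *: "D1 v = D2 v" if "x \<in> \<Omega> \<or> x \<in> frontier \<Omega> \<and> 0 < g x \<bullet> v" for v
    using tendsto_unique[OF _ directional_difference_quotient[OF assms(1) x] directional_difference_quotient[OF assms(2) x]]
      ray_inside_closure[OF that] by auto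
  show "D1 v = D2 v"
    using x
  proof (cases rule: in_closure_cases)
    case 2
    have lin: "linear D1" "linear D2" using assms has_derivative_linear by blast+
    have gg: "g x \<bullet> g x > 0" using frontier_grad[OF 2] by (auto simp: zero_less_norm_iff[symmetric] simp del: zero_less_norm_iff)
    \<comment> \<open>Adding a large multiple of \<open>g x\<close> makes any direction inward.\<close>
    define s where "s = (\<bar>g x \<bullet> v\<bar> + 1) / (g x \<bullet> g x)"
    have "s * (g x \<bullet> g x) = \<bar>g x \<bullet> v\<bar> + 1" using gg by (simp add: s_def)
    then have "0 < g x \<bullet> (v + s *\<^sub>R g x)" by (simp add: inner_add_right)
    then have "D1 (v + s *\<^sub>R g x) = D2 (v + s *\<^sub>R g x)" using 2 * by blast
    moreover have "D1 (g x) = D2 (g x)" using 2 gg * by blast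
    ultimately show ?thesis using lin by (simp add: linear_add linear_cmul)
  qed (use * in blast)
qed

lemma has_vector_derivative_line_interior:
  assumes "(k has_derivative D) (at (x + s *\<^sub>R b) within closure \<Omega>)" "x + s *\<^sub>R b \<in> \<Omega>"
  shows "((\<lambda>s. k (x + s *\<^sub>R b)) has_vector_derivative D b) (at s)"
proof -
  have "(k has_derivative D) (at (x + s *\<^sub>R b) within \<Omega>)"
    using assms(1) closure_subset by (rule has_derivative_subset)
  then have k: "(k has_derivative D) (at (x + s *\<^sub>R b))"
    using at_within_open[OF assms(2) open_domain] by simp
  have "((\<lambda>s. k (x + s *\<^sub>R b)) has_derivative (\<lambda>r. D (r *\<^sub>R b))) (at s)"
    by (rule has_derivative_compose[where g = k and f = "\<lambda>s. x + s *\<^sub>R b"])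
       (auto intro!: derivative_eq_intros k)
  then show ?thesis
    unfolding has_vector_derivative_def
    by (rule has_derivative_eq_rhs) (simp add: fun_eq_iff linear_cmul[OF has_derivative_linear[OF k]])
qed

text \<open>
  The hypotheses are tested only where \<open>F > m\<close>, and they describe what a maximum over the space-time
  cylinder would violate: a positive inward derivative at a boundary point, or a Laplacian exceeding the
  time derivative at an interior critical point.  The time derivative is only known to be nonnegative,
  because the maximum may be attained at the final time.
\<close>

theorem parabolic_maximum_principle:
  fixes F :: "'a \<Rightarrow> real \<Rightarrow> real"
  assumes cont: "continuous_on (closure \<Omega> \<times> {0..\<tau>}) (\<lambda>(x, t). F x t)"
    and init: "\<And>x. x \<in> closure \<Omega> \<Longrightarrow> F x 0 \<le> m"
    and bdry: "\<And>x t. x \<in> frontier \<Omega> \<Longrightarrow> 0 < t \<Longrightarrow> t \<le> \<tau> \<Longrightarrow> m < F x t \<Longrightarrow>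
      \<exists>D. ((\<lambda>y. F y t) has_derivative D) (at x within closure \<Omega>) \<and> 0 < D (g x)"
    and inter: "\<And>x t. x \<in> \<Omega> \<Longrightarrow> 0 < t \<Longrightarrow> t \<le> \<tau> \<Longrightarrow> m < F x t \<Longrightarrow>
      \<exists>dt d1 d2. (F x has_real_derivative dt) (at t) \<and>
        (\<forall>b\<in>Basis. (\<forall>s. x + s *\<^sub>R b \<in> \<Omega> \<longrightarrow> ((\<lambda>s. F (x + s *\<^sub>R b) t) has_real_derivative d1 b s) (at s)) \<and>
           (d1 b has_real_derivative d2 b) (at 0)) \<and>
        (0 \<le> dt \<and> (\<forall>b\<in>Basis. d1 b 0 = 0) \<longrightarrow> dt < (\<Sum>b\<in>Basis. d2 b))"
    and x: "x \<in> closure \<Omega>" and t: "0 \<le> t" "t \<le> \<tau>"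
  shows "F x t \<le> m"
proof (rule ccontr)
  assume above: "\<not> F x t \<le> m"
  let ?K = "closure \<Omega> \<times> {0..\<tau>}"
  have "compact ?K" using bounded_domain by (intro compact_Times) auto
  moreover have "?K \<noteq> {}" using x t by auto
  ultimately obtain z where z: "z \<in> ?K" "\<And>y. y \<in> ?K \<Longrightarrow> (\<lambda>(x, t). F x t) y \<le> (\<lambda>(x, t). F x t) z"
    using continuous_attains_sup[OF _ _ cont] by blast
  obtain x0 t0 where zz: "z = (x0, t0)" by (cases z)
  have x0: "x0 \<in> closure \<Omega>" and t0: "0 \<le> t0" "t0 \<le> \<tau>" using z zz by auto
  have max: "F y s \<le> F x0 t0" if "y \<in> closure \<Omega>" "0 \<le> s" "s \<le> \<tau>" for y s
    using z(2)[of "(y, s)"] that zz by auto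
  have big: "m < F x0 t0" using max[OF x t] above by simp
  then have "t0 \<noteq> 0" using init[OF x0] by auto
  then have pos: "0 < t0" using t0 by simp
  show False
    using x0
  proof (cases rule: in_closure_cases)
    case 2
    obtain D where D: "((\<lambda>y. F y t0) has_derivative D) (at x0 within closure \<Omega>)" "0 < D (g x0)"
      using bdry[OF 2 pos t0(2) big] by blast
    have gg: "g x0 \<bullet> g x0 > 0" using frontier_grad[OF 2] by (auto simp: zero_less_norm_iff[symmetric] simp del: zero_less_norm_iff)
    have ray: "\<forall>\<^sub>F t in at_right 0. x0 + t *\<^sub>R g x0 \<in> closure \<Omega>"
      using ray_inside_closure 2 gg by blast
    have lim: "((\<lambda>t. (F (x0 + t *\<^sub>R g x0) t0 - F x0 t0) / t) \<longlongrightarrow> D (g x0)) (at_right 0)"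
      using directional_difference_quotient[OF D(1) x0 ray] .
    have "\<forall>\<^sub>F t in at_right 0. (F (x0 + t *\<^sub>R g x0) t0 - F x0 t0) / t \<le> 0"
      using ray eventually_at_right_less[of 0]
      by eventually_elim (use max t0 in \<open>auto intro: divide_nonpos_pos\<close>)
    then have "D (g x0) \<le> 0" by (rule tendsto_upperbound[OF lim]) simp
    then show False using D by simp
  next
    case 1
    obtain dt d1 d2 where dt: "(F x0 has_real_derivative dt) (at t0)"
      and d1: "\<And>b s. b \<in> Basis \<Longrightarrow> x0 + s *\<^sub>R b \<in> \<Omega> \<Longrightarrow> ((\<lambda>s. F (x0 + s *\<^sub>R b) t0) has_real_derivative d1 b s) (at s)"
      and d2: "\<And>b. b \<in> Basis \<Longrightarrow> (d1 b has_real_derivative d2 b) (at 0)"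
      and contra: "0 \<le> dt \<Longrightarrow> (\<And>b. b \<in> Basis \<Longrightarrow> d1 b 0 = 0) \<Longrightarrow> dt < (\<Sum>b\<in>Basis. d2 b)"
      using inter[OF 1 pos t0(2) big] by blast
    have "dt \<ge> 0"
    proof (rule ccontr)
      assume "\<not> dt \<ge> 0"
      with DERIV_neg_dec_left[OF dt] obtain d where d: "d > 0" "\<And>h. 0 < h \<Longrightarrow> h < d \<Longrightarrow> F x0 t0 < F x0 (t0 - h)"
        by auto
      define h where "h = min d t0 / 2"
      have "0 < h" "h < d" "h < t0" using d pos by (auto simp: h_def)
      then show False using d(2)[of h] max[OF x0, of "t0 - h"] t0 by simp
    qed
    obtain r where r: "r > 0" "ball x0 r \<subseteq> \<Omega>" using 1 open_domain by (meson open_contains_ball)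
    have *: "d1 b 0 = 0 \<and> d2 b \<le> 0" if b: "b \<in> Basis" for b
    proof -
      have ins: "x0 + s *\<^sub>R b \<in> \<Omega>" if "\<bar>s\<bar> < r" for s
        using r that b by (auto simp: dist_norm subset_iff)
      have mx: "F (x0 + s *\<^sub>R b) t0 \<le> F (x0 + 0 *\<^sub>R b) t0" if "\<bar>s\<bar> < r" for s
        using max[of "x0 + s *\<^sub>R b" t0] ins[OF that] domain_subset t0 by simp
      note test = second_derivative_test_max[OF r(1) d1[OF b ins] d2[OF b] mx]
      show ?thesis using test by blast
    qed
    have "(\<Sum>b\<in>Basis. d2 b) \<le> 0" using * by (intro sum_nonpos) auto
    with contra[OF \<open>0 \<le> dt\<close>] * \<open>0 \<le> dt\<close> show False by force
  qed
qed

end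

section \<open>Flows with Neumann boundary condition\<close>

text \<open>
  The pointwise facts that the maximum principle arguments use about a solution of
  \<open>u\<^sub>t = \<Delta> u - f(u)\<close>.  Here \<open>p\<close> is the spatial gradient, \<open>A x t\<close> the Hessian as a linear map, and
  \<open>T x t b\<close> the second derivative of \<open>p\<close> in the direction \<open>b\<close>; the last assumption is the gradient of
  the equation.
\<close>

locale neumann_flow = defined_domain \<Omega> \<rho> g H C
  for \<Omega> :: "'a::euclidean_space set" and \<rho> g H C +
  fixes f f' :: "real \<Rightarrow> real" and u :: "'a \<Rightarrow> real \<Rightarrow> real" and p :: "'a \<Rightarrow> real \<Rightarrow> 'a"
    and A T :: "'a \<Rightarrow> real \<Rightarrow> 'a \<Rightarrow> 'a" and ut :: "'a \<Rightarrow> real \<Rightarrow> real" and pt :: "'a \<Rightarrow> real \<Rightarrow> 'a"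
  assumes u_cont: "continuous_on (closure \<Omega> \<times> {0..}) (\<lambda>(x, t). u x t)"
    and p_cont: "continuous_on (closure \<Omega> \<times> {0..}) (\<lambda>(x, t). p x t)"
    and u_deriv: "x \<in> closure \<Omega> \<Longrightarrow> 0 < t \<Longrightarrow>
      ((\<lambda>y. u y t) has_derivative (\<lambda>v. p x t \<bullet> v)) (at x within closure \<Omega>)"
    and p_deriv: "x \<in> closure \<Omega> \<Longrightarrow> 0 < t \<Longrightarrow>
      ((\<lambda>y. p y t) has_derivative A x t) (at x within closure \<Omega>)"
    and A_sym: "x \<in> closure \<Omega> \<Longrightarrow> 0 < t \<Longrightarrow> A x t v \<bullet> w = A x t w \<bullet> v"
    and A_line: "x + s *\<^sub>R b \<in> \<Omega> \<Longrightarrow> 0 < t \<Longrightarrow> b \<in> Basis \<Longrightarrow>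
      ((\<lambda>s. A (x + s *\<^sub>R b) t b) has_vector_derivative T (x + s *\<^sub>R b) t b) (at s)"
    and u_time: "x \<in> \<Omega> \<Longrightarrow> 0 < t \<Longrightarrow> (u x has_real_derivative ut x t) (at t)"
    and p_time: "x \<in> \<Omega> \<Longrightarrow> 0 < t \<Longrightarrow> (p x has_vector_derivative pt x t) (at t)"
    and neumann: "x \<in> frontier \<Omega> \<Longrightarrow> 0 < t \<Longrightarrow> p x t \<bullet> g x = 0"
    and u_eq: "x \<in> \<Omega> \<Longrightarrow> 0 < t \<Longrightarrow> ut x t = (\<Sum>b\<in>Basis. A x t b \<bullet> b) - f (u x t)"
    and p_eq: "x \<in> \<Omega> \<Longrightarrow> 0 < t \<Longrightarrow> pt x t = (\<Sum>b\<in>Basis. T x t b) - f' (u x t) *\<^sub>R p x t"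
begin

lemma u_line:
  "x + s *\<^sub>R b \<in> \<Omega> \<Longrightarrow> 0 < t \<Longrightarrow>
    ((\<lambda>s. u (x + s *\<^sub>R b) t) has_real_derivative p (x + s *\<^sub>R b) t \<bullet> b) (at s)"
  unfolding has_real_derivative_iff_has_vector_derivative
  by (rule has_vector_derivative_line_interior[where k = "\<lambda>y. u y t", OF u_deriv]) (auto intro: domain_subset)

lemma p_line:
  "x + s *\<^sub>R b \<in> \<Omega> \<Longrightarrow> 0 < t \<Longrightarrow>
    ((\<lambda>s. p (x + s *\<^sub>R b) t) has_vector_derivative A (x + s *\<^sub>R b) t b) (at s)"
  by (rule has_vector_derivative_line_interior[where k = "\<lambda>y. p y t", OF p_deriv]) (auto intro: domain_subset)

end

lemma has_real_derivative_inner: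
  assumes "(h has_vector_derivative h') (at s within S)" "(k has_vector_derivative k') (at s within S)"
  shows "((\<lambda>s. h s \<bullet> k s) has_real_derivative h s \<bullet> k' + h' \<bullet> k s) (at s within S)"
  unfolding has_field_derivative_def
  by (rule has_derivative_eq_rhs[OF has_derivative_inner[OF assms[unfolded has_vector_derivative_def]]])
     (simp add: fun_eq_iff algebra_simps)

context defined_domain
begin

lemma grad_line: "((\<lambda>s. g (x + s *\<^sub>R b)) has_vector_derivative H (x + s *\<^sub>R b) b) (at s)"
proof -
  have "((\<lambda>s. g (x + s *\<^sub>R b)) has_derivative (\<lambda>r. H (x + s *\<^sub>R b) (r *\<^sub>R b))) (at s)"
    by (rule has_derivative_compose[where g = g and f = "\<lambda>s. x + s *\<^sub>R b"])
       (auto intro!: derivative_eq_intros twice_diffD[OF twice_diff])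
  then show ?thesis
    unfolding has_vector_derivative_def
    by (rule has_derivative_eq_rhs) (simp add: fun_eq_iff linear_cmul[OF twice_diffD(6)[OF twice_diff]])
qed

lemma rho_line: "((\<lambda>s. \<rho> (x + s *\<^sub>R b)) has_real_derivative g (x + s *\<^sub>R b) \<bullet> b) (at s)"
proof -
  have "((\<lambda>s. \<rho> (x + s *\<^sub>R b)) has_derivative (\<lambda>r. g (x + s *\<^sub>R b) \<bullet> (r *\<^sub>R b))) (at s)"
    by (rule has_derivative_compose[where g = \<rho> and f = "\<lambda>s. x + s *\<^sub>R b"])
       (auto intro!: derivative_eq_intros twice_diffD[OF twice_diff])
  then show ?thesis
    unfolding has_field_derivative_def by (rule has_derivative_eq_rhs) (simp add: fun_eq_iff)
qed

lemma grad_line_component: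
  "((\<lambda>s. g (x + s *\<^sub>R b) \<bullet> b) has_real_derivative H (x + s *\<^sub>R b) b \<bullet> b) (at s)"
  using has_real_derivative_inner[OF grad_line has_vector_derivative_const[of b]] by simp

lemma abs_trace_hess_le:
  assumes "x \<in> closure \<Omega>"
  shows "\<bar>\<Sum>b\<in>Basis. H x b \<bullet> b\<bar> \<le> C * real DIM('a)"
proof -
  have "\<bar>\<Sum>b\<in>Basis. H x b \<bullet> b\<bar> \<le> (\<Sum>b\<in>Basis. \<bar>H x b \<bullet> b\<bar>)" by (rule sum_abs)
  also have "\<dots> \<le> (\<Sum>b::'a\<in>Basis. C)"
  proof (rule sum_mono)
    fix b :: 'a assume "b \<in> Basis"
    then have "\<bar>H x b \<bullet> b\<bar> \<le> norm (H x b)" by (rule Basis_le_norm)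
    also have "\<dots> \<le> C" using hess_le[OF assms, of b] \<open>b \<in> Basis\<close> by simp
    finally show "\<bar>H x b \<bullet> b\<bar> \<le> C" .
  qed
  finally show ?thesis by (simp add: mult.commute)
qed

end

context neumann_flow
begin

lemma p_line_component:
  "x + s *\<^sub>R b \<in> \<Omega> \<Longrightarrow> 0 < t \<Longrightarrow>
    ((\<lambda>s. p (x + s *\<^sub>R b) t \<bullet> b) has_real_derivative A (x + s *\<^sub>R b) t b \<bullet> b) (at s)"
  using has_real_derivative_inner[OF p_line has_vector_derivative_const[of b]] by simp

text \<open>
  With \<open>\<sigma> = 1\<close> and \<open>\<sigma> = -1\<close> this bounds a solution by the constant solutions \<open>\<plusminus>1\<close>.  The factor
  \<open>exp (- K t)\<close> with large \<open>K\<close> compensates for the unknown sign of the reaction outside \<open>[-1, 1]\<close>, where only its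
  Lipschitz bound is available.  Subtracting \<open>\<eta> (1 + C - \<rho>)\<close> gives a strict inequality at the boundary, and
  finally \<open>\<eta>\<close> tends to 0.
\<close>

lemma signed_solution_le_1:
  assumes sgn: "\<sigma> * \<sigma> = (1::real)" and f0: "f \<sigma> = 0"
    and f': "\<And>s. (f has_real_derivative f' s) (at s)" and contf': "continuous_on UNIV f'"
    and init: "\<And>x. x \<in> closure \<Omega> \<Longrightarrow> \<sigma> * u x 0 \<le> 1"
    and x: "x \<in> closure \<Omega>" and \<tau>: "0 \<le> \<tau>"
  shows "\<sigma> * u x \<tau> \<le> 1"
proof -
  have abs\<sigma>: "\<bar>\<sigma>\<bar> = 1" using sgn abs_square_eq_1[of \<sigma>] by (simp add: power2_eq_square)
  have C0: "C \<ge> 0" using grad_le[OF x] norm_ge_zero order_trans by blast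
  have contu: "continuous_on (closure \<Omega> \<times> {0..\<tau>}) (\<lambda>(x, t). u x t)"
    by (rule continuous_on_subset[OF u_cont]) auto
  have "compact (closure \<Omega> \<times> {0..\<tau>})" using bounded_domain by (intro compact_Times) auto
  then have "bounded ((\<lambda>(x, t). u x t) ` (closure \<Omega> \<times> {0..\<tau>}))"
    by (intro compact_imp_bounded compact_continuous_image contu)
  then obtain B0 where B0: "\<forall>y\<in>(\<lambda>(x, t). u x t) ` (closure \<Omega> \<times> {0..\<tau>}). norm y \<le> B0"
    unfolding bounded_iff by blast
  define B where "B = max 1 B0"
  have B: "\<bar>u y t\<bar> \<le> B" if "y \<in> closure \<Omega>" "0 \<le> t" "t \<le> \<tau>" for y t
    using that B0 unfolding B_def by (force simp: max_def)
  have "bounded (f' ` {-B..B})"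
    by (intro compact_imp_bounded compact_continuous_image continuous_on_subset[OF contf']) auto
  then obtain L where L: "\<And>s. s \<in> {-B..B} \<Longrightarrow> norm (f' s) \<le> L" unfolding bounded_iff by blast
  have f_lip: "\<bar>f s\<bar> \<le> L * \<bar>s - \<sigma>\<bar>" if "\<bar>s\<bar> \<le> B" for s
  proof -
    have "norm (f s - f \<sigma>) \<le> L * norm (s - \<sigma>)"
      by (rule field_differentiable_bound[of "{-B..B}" f f' L])
         (use f' L that abs\<sigma> in \<open>auto simp: B_def intro: has_field_derivative_at_within\<close>)
    then show ?thesis using f0 by simp
  qed
  define n where "n = real DIM('a)"
  \<comment> \<open>\<open>L\<close> pays for the reaction, \<open>C * n\<close> for the Laplacian of \<open>\<rho>\<close>.\<close>
  define K where "K = L + C * n + 1"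
  have main: "exp (- K * \<tau>) * (\<sigma> * u x \<tau> - 1) - \<eta> * (1 + C - \<rho> x) \<le> 0" if \<eta>: "\<eta> > 0" for \<eta>
  proof (rule parabolic_maximum_principle[where F = "\<lambda>x t. exp (- K * t) * (\<sigma> * u x t - 1) - \<eta> * (1 + C - \<rho> x)" and \<tau> = \<tau>])
    show "continuous_on (closure \<Omega> \<times> {0..\<tau>}) (\<lambda>(x, t). exp (- K * t) * (\<sigma> * u x t - 1) - \<eta> * (1 + C - \<rho> x))"
    proof -
      have "continuous_on (closure \<Omega> \<times> {0..\<tau>}) (\<lambda>z. \<rho> (fst z))"
        by (rule continuous_on_compose2[OF twice_diffD(4)[OF twice_diff, of UNIV]]) (auto intro: continuous_intros)
      then show ?thesis using contu by (auto simp: case_prod_unfold intro!: continuous_intros)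
    qed
    show "exp (- K * 0) * (\<sigma> * u y 0 - 1) - \<eta> * (1 + C - \<rho> y) \<le> 0" if "y \<in> closure \<Omega>" for y
    proof -
      have "\<eta> * (1 + C - \<rho> y) \<ge> 0" using le[OF that] \<eta> by simp
      then show ?thesis using init[OF that] by simp
    qed
    show "\<exists>D. ((\<lambda>y. exp (- K * t) * (\<sigma> * u y t - 1) - \<eta> * (1 + C - \<rho> y)) has_derivative D) (at y within closure \<Omega>) \<and> 0 < D (g y)"
      if y: "y \<in> frontier \<Omega>" and t: "0 < t" for y t
    proof (intro exI conjI)
      have cl: "y \<in> closure \<Omega>" using domain_subset y by blast
      show "((\<lambda>y. exp (- K * t) * (\<sigma> * u y t - 1) - \<eta> * (1 + C - \<rho> y)) has_derivative
         (\<lambda>v. exp (- K * t) * (\<sigma> * (p y t \<bullet> v)) + \<eta> * (g y \<bullet> v))) (at y within closure \<Omega>)"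
        using u_deriv[OF cl t] has_derivative_at_withinI[OF twice_diffD(1)[OF twice_diff]]
        by (auto intro!: derivative_eq_intros simp: algebra_simps)
      have "g y \<bullet> g y > 0" using frontier_grad[OF y] by (auto simp: zero_less_norm_iff[symmetric] simp del: zero_less_norm_iff)
      then show "0 < exp (- K * t) * (\<sigma> * (p y t \<bullet> g y)) + \<eta> * (g y \<bullet> g y)"
        using neumann[OF y t] \<eta> by simp
    qed
    show "\<exists>dt d1 d2. ((\<lambda>t. exp (- K * t) * (\<sigma> * u y t - 1) - \<eta> * (1 + C - \<rho> y)) has_real_derivative dt) (at t) \<and>
        (\<forall>b\<in>Basis. (\<forall>s. y + s *\<^sub>R b \<in> \<Omega> \<longrightarrow> ((\<lambda>s. exp (- K * t) * (\<sigma> * u (y + s *\<^sub>R b) t - 1) - \<eta> * (1 + C - \<rho> (y + s *\<^sub>R b))) has_real_derivative d1 b s) (at s)) \<and>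
           (d1 b has_real_derivative d2 b) (at 0)) \<and>
        (0 \<le> dt \<and> (\<forall>b\<in>Basis. d1 b 0 = 0) \<longrightarrow> dt < (\<Sum>b\<in>Basis. d2 b))"
      if y: "y \<in> \<Omega>" and t: "0 < t" "t \<le> \<tau>" 
        and big: "0 < exp (- K * t) * (\<sigma> * u y t - 1) - \<eta> * (1 + C - \<rho> y)" for y t
    proof -
      have cl: "y \<in> closure \<Omega>" using domain_subset y by blast
      define E where "E = exp (- K * t)"
      have E: "E > 0" by (simp add: E_def)
      define e where "e = E * (\<sigma> * u y t - 1)"
      have "e > \<eta> * (1 + C - \<rho> y)" using big by (simp add: e_def E_def)
      moreover have "\<eta> * (1 + C - \<rho> y) \<ge> \<eta> * 1" using le[OF cl] \<eta> by (intro mult_left_mono) auto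
      ultimately have e: "e > \<eta>" by simp
      then have su: "\<sigma> * u y t > 1" using \<eta> E unfolding e_def
        by (metis diff_gt_0_iff_gt less_trans zero_less_mult_pos)
      have dt: "((\<lambda>t. exp (- K * t) * (\<sigma> * u y t - 1) - \<eta> * (1 + C - \<rho> y)) has_real_derivative
          E * (\<sigma> * ut y t) - K * e) (at t)"
        using u_time[OF y t(1)] unfolding E_def e_def
        by (auto intro!: derivative_eq_intros simp: algebra_simps)
      have d1: "((\<lambda>s. exp (- K * t) * (\<sigma> * u (y + s *\<^sub>R b) t - 1) - \<eta> * (1 + C - \<rho> (y + s *\<^sub>R b))) has_real_derivative
          E * (\<sigma> * (p (y + s *\<^sub>R b) t \<bullet> b)) + \<eta> * (g (y + s *\<^sub>R b) \<bullet> b)) (at s)" if "y + s *\<^sub>R b \<in> \<Omega>" for s b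
        using u_line[OF that t(1)] rho_line[of y b s] unfolding E_def
        by (auto intro!: derivative_eq_intros simp: algebra_simps)
      have d2: "((\<lambda>s. E * (\<sigma> * (p (y + s *\<^sub>R b) t \<bullet> b)) + \<eta> * (g (y + s *\<^sub>R b) \<bullet> b)) has_real_derivative
          E * (\<sigma> * (A y t b \<bullet> b)) + \<eta> * (H y b \<bullet> b)) (at 0)" for b
        using p_line_component[of y 0 b t] grad_line_component[of y b 0] y t
        by (auto intro!: derivative_eq_intros simp: algebra_simps)
      have "u y t - \<sigma> = \<sigma> * (\<sigma> * u y t - 1)" using sgn by (simp add: algebra_simps flip: mult.assoc)
      then have "(\<bar>u y t - \<sigma>\<bar>) = \<sigma> * u y t - 1" using su abs\<sigma> by (simp add: abs_mult)
      moreover have "\<bar>f (u y t)\<bar> \<le> L * \<bar>u y t - \<sigma>\<bar>" using f_lip[OF B[OF cl, of t]] t by simp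
      ultimately have "\<bar>f (u y t)\<bar> \<le> L * (\<sigma> * u y t - 1)" by simp
      then have "E * \<bar>f (u y t)\<bar> \<le> E * (L * (\<sigma> * u y t - 1))" using E by simp
      then have "\<bar>E * (\<sigma> * f (u y t))\<bar> \<le> L * e" using E abs\<sigma> by (simp add: e_def abs_mult algebra_simps)
      then have fE: "E * (\<sigma> * f (u y t)) \<ge> - (L * e)" by linarith
      have "\<bar>\<eta> * (\<Sum>b\<in>Basis. H y b \<bullet> b)\<bar> \<le> \<eta> * (C * n)" 
        using abs_trace_hess_le[OF cl] \<eta> by (simp add: abs_mult n_def)
      then have HH: "\<eta> * (\<Sum>b\<in>Basis. H y b \<bullet> b) \<ge> - (\<eta> * (C * n))" by linarith
      have Cn: "C * n \<ge> 0" using C0 by (simp add: n_def)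
      have "\<eta> * (C * n) \<le> e * (C * n)" using e Cn by (intro mult_right_mono) auto
      then have "0 < E * (\<sigma> * f (u y t)) + \<eta> * (\<Sum>b\<in>Basis. H y b \<bullet> b) + K * e"
        using fE HH e \<eta> by (simp add: K_def algebra_simps)
      also have "\<dots> = (\<Sum>b\<in>Basis. E * (\<sigma> * (A y t b \<bullet> b)) + \<eta> * (H y b \<bullet> b)) - (E * (\<sigma> * ut y t) - K * e)"
        unfolding u_eq[OF y t(1)] sum.distrib sum_distrib_left[symmetric] by (simp add: algebra_simps)
      finally have "E * (\<sigma> * ut y t) - K * e
          < (\<Sum>b\<in>Basis. E * (\<sigma> * (A y t b \<bullet> b)) + \<eta> * (H y b \<bullet> b))" by simp
      with dt d1 d2 show ?thesis
        by (intro exI[of _ "E * (\<sigma> * ut y t) - K * e"]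
            exI[of _ "\<lambda>b s. E * (\<sigma> * (p (y + s *\<^sub>R b) t \<bullet> b)) + \<eta> * (g (y + s *\<^sub>R b) \<bullet> b)"]
            exI[of _ "\<lambda>b. E * (\<sigma> * (A y t b \<bullet> b)) + \<eta> * (H y b \<bullet> b)"]) blast
    qed
  qed (use x \<tau> in auto)
  have "exp (- K * \<tau>) * (\<sigma> * u x \<tau> - 1) \<le> 0"
  proof (rule field_le_epsilon)
    fix d :: real assume "d > 0"
    have "exp (- K * \<tau>) * (\<sigma> * u x \<tau> - 1) \<le> d / (1 + C) * (1 + C - \<rho> x)"
      using main[of "d / (1 + C)"] \<open>d > 0\<close> C0 by simp
    also have "\<dots> \<le> d / (1 + C) * (1 + C)" using nonneg[OF x] \<open>d > 0\<close> C0 by (intro mult_left_mono) auto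
    finally show "exp (- K * \<tau>) * (\<sigma> * u x \<tau> - 1) \<le> 0 + d" using C0 by simp
  qed
  then show ?thesis by (simp add: mult_le_0_iff)
qed

end

section \<open>The barrier and the discrepancy\<close>

text \<open>
  Here \<open>E\<close> is the weight and \<open>q\<close> the gradient of its logarithm.  The hypothesis \<open>crit\<close> says that
  \<open>E w\<close> minus a function of \<open>u\<close> with derivative \<open>N\<close> has a critical point; it determines the
  vector \<open>\<nabla>w\<close>, and Cauchy--Schwarz in each coordinate bounds the Hessian from below by it.
\<close>

lemma hessian_norm_lower_bound:
  fixes p q :: "'a::euclidean_space" and A :: "'a \<Rightarrow> 'a"
  assumes "0 < E" "0 < \<epsilon>" "p \<noteq> 0"
    and w: "w = \<epsilon>\<^sup>2 * (p \<bullet> p) / 2"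
    and crit: "\<And>b. b \<in> Basis \<Longrightarrow> E * \<epsilon>\<^sup>2 * (p \<bullet> A b) = N * (p \<bullet> b) - E * w * (q \<bullet> b)"
  shows "N\<^sup>2 / (E * \<epsilon>\<^sup>2) - N * (p \<bullet> q) + E * w * (q \<bullet> q) / 2 \<le> E * \<epsilon>\<^sup>2 * (\<Sum>b\<in>Basis. A b \<bullet> A b)"
proof -
  have pp: "p \<bullet> p > 0" using assms(3) by simp
  have *: "(N * (p \<bullet> b) - E * w * (q \<bullet> b))\<^sup>2 \<le> (E * \<epsilon>\<^sup>2)\<^sup>2 * ((p \<bullet> p) * (A b \<bullet> A b))" if "b \<in> Basis" for b
    unfolding crit[OF that, symmetric] power_mult_distrib
    using Cauchy_Schwarz_ineq[of p "A b"] by (intro mult_left_mono) auto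
  have expand: "(N * (p \<bullet> b) - E * w * (q \<bullet> b))\<^sup>2 = N\<^sup>2 * ((p \<bullet> b) * (p \<bullet> b)) 
      - 2 * N * E * w * ((p \<bullet> b) * (q \<bullet> b)) + E\<^sup>2 * w\<^sup>2 * ((q \<bullet> b) * (q \<bullet> b))" for b
    by (simp add: power2_eq_square algebra_simps)
  have "N\<^sup>2 * (p \<bullet> p) - 2 * N * E * w * (p \<bullet> q) + E\<^sup>2 * w\<^sup>2 * (q \<bullet> q)
      = (\<Sum>b\<in>Basis. (N * (p \<bullet> b) - E * w * (q \<bullet> b))\<^sup>2)"
    unfolding expand sum.distrib sum_subtractf sum_distrib_left[symmetric] euclidean_inner[symmetric] by simp
  also have "\<dots> \<le> (\<Sum>b\<in>Basis. (E * \<epsilon>\<^sup>2)\<^sup>2 * ((p \<bullet> p) * (A b \<bullet> A b)))"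
    using * by (rule sum_mono)
  also have "\<dots> = (E * \<epsilon>\<^sup>2 * (p \<bullet> p)) * (E * \<epsilon>\<^sup>2 * (\<Sum>b\<in>Basis. A b \<bullet> A b))"
    by (simp add: sum_distrib_left[symmetric] power2_eq_square algebra_simps)
  finally have "(N\<^sup>2 * (p \<bullet> p) - 2 * N * E * w * (p \<bullet> q) + E\<^sup>2 * w\<^sup>2 * (q \<bullet> q)) / (E * \<epsilon>\<^sup>2 * (p \<bullet> p))
      \<le> E * \<epsilon>\<^sup>2 * (\<Sum>b\<in>Basis. A b \<bullet> A b)"
    using pp assms(1,2) by (simp add: pos_divide_le_eq mult.commute)
  moreover have "(N\<^sup>2 * (p \<bullet> p) - 2 * N * E * w * (p \<bullet> q) + E\<^sup>2 * w\<^sup>2 * (q \<bullet> q)) / (E * \<epsilon>\<^sup>2 * (p \<bullet> p))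
      = N\<^sup>2 / (E * \<epsilon>\<^sup>2) - N * (p \<bullet> q) + E * w * (q \<bullet> q) / 2"
    using pp assms(1,2) by (simp add: w field_simps power2_eq_square)
  ultimately show ?thesis by simp
qed

text \<open>
  Here \<open>a\<close> stands for the norm of the gradient: \<open>w > S\<^sup>2 d\<close> means \<open>\<epsilon>\<^sup>2 a\<^sup>2 > 2 S\<^sup>2 d\<close>, and \<open>\<epsilon>\<^sup>2 \<le> d\<^sup>3\<close> turns
  this into \<open>(d a)\<^sup>2 > 2 S\<^sup>2\<close>.
\<close>

lemma gradient_term_absorbs:
  fixes d \<epsilon> w S a :: real
  assumes "0 < d" "0 < \<epsilon>" "\<epsilon>\<^sup>2 \<le> d ^ 3" "0 \<le> a" "0 \<le> S"
    and w: "w = \<epsilon>\<^sup>2 * a\<^sup>2 / 2" "S\<^sup>2 * d < w"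
  shows "S * a < d * a\<^sup>2" 
proof -
  have "0 < w" using w(2) assms(1) by (meson less_le_trans not_le zero_le_mult_iff zero_le_power2 less_imp_le)
  then have a: "a > 0" using w(1) assms(4) by (cases "a = 0") auto
  have "S\<^sup>2 * d < d ^ 3 * a\<^sup>2 / 2" using w assms(3) mult_right_mono[OF assms(3), of "a\<^sup>2"] by simp
  then have "S\<^sup>2 * d < d * (d * a)\<^sup>2" using assms(1) a
    by (smt (verit) power_mult_distrib power3_eq_cube power2_eq_square mult.assoc mult_pos_pos field_sum_of_halves)
  then have "S\<^sup>2 < (d * a)\<^sup>2" using assms(1) by (simp add: mult.commute)
  then have "S < d * a" using a assms(1) by (auto intro: power_less_imp_less_base)
  then show ?thesis using a by (simp add: power2_eq_square)
qed

text \<open>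
  Constants of the barrier construction: \<open>C\<close> bounds the geometry, \<open>B\<close> bounds the potential and
  its first two derivatives on \<open>[-1, 1]\<close>, \<open>n\<close> is the dimension and \<open>c\<close> the initial bound.  The slope beats the boundary term,
  the tilt beats the interior errors quadratic in the gradient, and the threshold is the value of
  \<open>w / d\<close> beyond which the linear errors are absorbed.
\<close>

definition barrier_slope :: "real \<Rightarrow> real" where
  "barrier_slope C = 2 * C + 1"

definition well_tilt :: "real \<Rightarrow> real \<Rightarrow> real \<Rightarrow> real" where
  "well_tilt C B n = barrier_slope C * B + barrier_slope C * (C * n + C\<^sup>2) / 2 + (barrier_slope C * C)\<^sup>2 / 4 + 1"

definition gradient_threshold :: "real \<Rightarrow> real \<Rightarrow> real \<Rightarrow> real" where
  "gradient_threshold C B n = ((B + 4 * well_tilt C B n) * (barrier_slope C * C))\<^sup>2"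

definition discrepancy_const :: "real \<Rightarrow> real \<Rightarrow> real \<Rightarrow> real \<Rightarrow> real" where
  "discrepancy_const C B n c = exp (barrier_slope C) *
     (gradient_threshold C B n + max c 0 + 4 * well_tilt C B n + barrier_slope C * B)"

context neumann_flow
begin

text \<open>
  The gradient is tangential at the boundary, so it is the velocity of a curve in the boundary.  Along
  this curve \<open>p \<bullet> g = 0\<close>; differentiate.
\<close>

lemma normal_derivative_gradient:
  assumes x: "x \<in> frontier \<Omega>" and t: "0 < t"
  shows "A x t (p x t) \<bullet> g x = - (p x t \<bullet> H x (p x t))"
proof -
  have cl: "x \<in> closure \<Omega>" using domain_subset x by blast
  have "p x t \<in> tangent_space (frontier \<Omega>) x"
    using tangent[OF x] neumann[OF x t] by (simp add: inner_commute)
  then obtain c where c: "c 0 = x" "\<forall>\<^sub>F s in nhds 0. c s \<in> frontier \<Omega>" "(c has_vector_derivative p x t) (at (0::real))"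
    by (auto simp: tangent_space_def)
  obtain S where S: "open S" "0 \<in> S" "\<And>s. s \<in> S \<Longrightarrow> c s \<in> frontier \<Omega>"
    using c(2) unfolding eventually_nhds by blast
  have sub: "c ` S \<subseteq> closure \<Omega>" using S(3) domain_subset by blast
  have c': "(c has_derivative (\<lambda>s. s *\<^sub>R p x t)) (at 0 within S)"
    using c(3) unfolding has_vector_derivative_def by (rule has_derivative_at_withinI)
  have lin: "linear (A x t)" using p_deriv[OF cl t] has_derivative_linear by blast
  have "((\<lambda>s. p (c s) t) has_derivative (\<lambda>s. A x t (s *\<^sub>R p x t))) (at 0 within S)"
    using has_derivative_in_compose[OF c', of "\<lambda>y. p y t" "A x t"] has_derivative_subset[OF p_deriv[OF cl t] sub] c(1)
    by simp
  then have 1: "((\<lambda>s. p (c s) t) has_vector_derivative A x t (p x t)) (at 0 within S)"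
    unfolding has_vector_derivative_def by (simp add: linear_cmul[OF lin])
  have "((\<lambda>s. g (c s)) has_derivative (\<lambda>s. H x (s *\<^sub>R p x t))) (at 0 within S)"
    using has_derivative_compose[OF c' twice_diffD(2)[OF twice_diff]] by (simp add: c(1))
  then have 2: "((\<lambda>s. g (c s)) has_vector_derivative H x (p x t)) (at 0 within S)"
    unfolding has_vector_derivative_def by (simp add: linear_cmul[OF twice_diffD(6)[OF twice_diff]])
  have "((\<lambda>s. p (c s) t \<bullet> g (c s)) has_real_derivative p (c 0) t \<bullet> H x (p x t) + A x t (p x t) \<bullet> g (c 0)) (at 0)"
    using has_real_derivative_inner[OF 1 2] by (simp add: at_within_open[OF S(2,1)])
  moreover have "\<forall>\<^sub>F s in nhds 0. p (c s) t \<bullet> g (c s) = 0"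
    using c(2) by eventually_elim (use neumann t in blast)
  ultimately have "((\<lambda>s. 0) has_real_derivative p (c 0) t \<bullet> H x (p x t) + A x t (p x t) \<bullet> g (c 0)) (at 0)"
    using DERIV_cong_ev[of 0 0 "\<lambda>s. p (c s) t \<bullet> g (c s)" "\<lambda>s. 0"
        "p (c 0) t \<bullet> H x (p x t) + A x t (p x t) \<bullet> g (c 0)" "p (c 0) t \<bullet> H x (p x t) + A x t (p x t) \<bullet> g (c 0)"]
    by simp
  then have "p (c 0) t \<bullet> H x (p x t) + A x t (p x t) \<bullet> g (c 0) = 0" by (rule DERIV_unique[OF _ DERIV_const])
  then show ?thesis using c(1) by simp
qed

end

text \<open>
  \<open>d\<close> is the size of the discrepancy, \<open>\<epsilon> powr (1 - lam)\<close> in the application.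
\<close>

locale allen_cahn_flow = neumann_flow \<Omega> \<rho> g H C "\<lambda>s. W' s / \<epsilon>\<^sup>2" "\<lambda>s. W'' s / \<epsilon>\<^sup>2" u p A T ut pt
  for \<Omega> :: "'a::euclidean_space set" and \<rho> g H C W' \<epsilon> W'' u p A T ut pt +
  fixes W :: "real \<Rightarrow> real" and d \<gamma> B c :: real
  assumes W_deriv: "(W has_real_derivative W' s) (at s)" "(W' has_real_derivative W'' s) (at s)"
    and W_nonneg: "0 \<le> W s"
    and W_bound: "\<bar>s\<bar> \<le> 1 \<Longrightarrow> W s \<le> B" "\<bar>s\<bar> \<le> 1 \<Longrightarrow> \<bar>W' s\<bar> \<le> B" "\<bar>s\<bar> \<le> 1 \<Longrightarrow> \<bar>W'' s\<bar> \<le> B"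
    and W_monotone: "\<bar>s\<bar> \<le> 1 \<Longrightarrow> W' s * (s - \<gamma>) \<le> 0" and gamma: "\<bar>\<gamma>\<bar> \<le> 1"
    and eps: "0 < \<epsilon>" and d: "0 < d" "d \<le> 1" "\<epsilon>\<^sup>2 \<le> d ^ 3"
    and C_nonneg: "0 \<le> C"
    and u_le: "x \<in> closure \<Omega> \<Longrightarrow> 0 \<le> t \<Longrightarrow> \<bar>u x t\<bar> \<le> 1"
    and initial: "x \<in> closure \<Omega> \<Longrightarrow> \<epsilon>\<^sup>2 * (p x 0 \<bullet> p x 0) / 2 - W (u x 0) \<le> c * d"
begin

text \<open>
  \<open>q\<close> is the gradient of \<open>\<phi>\<close>, \<open>\<phi>2 x b\<close> its second derivative in the direction \<open>b\<close>, and \<open>N\<close> the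
  derivative of \<open>W + G\<close>.
\<close>

definition M where "M = barrier_slope C"
definition k where "k = well_tilt C B (real DIM('a))"

definition \<phi> :: "'a \<Rightarrow> real" where "\<phi> x = - M * d * exp (- (\<rho> x / d))"
definition q :: "'a \<Rightarrow> 'a" where "q x = (M * exp (- (\<rho> x / d))) *\<^sub>R g x"
definition \<phi>2 :: "'a \<Rightarrow> 'a \<Rightarrow> real" where
  "\<phi>2 x b = M * exp (- (\<rho> x / d)) * (H x b \<bullet> b - (g x \<bullet> b)\<^sup>2 / d)"
definition w :: "'a \<Rightarrow> real \<Rightarrow> real" where "w x t = \<epsilon>\<^sup>2 * (p x t \<bullet> p x t) / 2"
definition G :: "real \<Rightarrow> real" where "G s = k * d * (4 - (s - \<gamma>)\<^sup>2)"
definition N :: "real \<Rightarrow> real" where "N s = W' s - 2 * k * d * (s - \<gamma>)"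
definition Q :: "'a \<Rightarrow> real \<Rightarrow> real" where "Q x t = exp (\<phi> x) * w x t - (W (u x t) + G (u x t))"

lemma B_nonneg: "0 \<le> B"
  using W_bound(1)[of 0] W_nonneg[of 0] by simp

lemma M_eq: "M = 2 * C + 1"
  by (simp add: M_def barrier_slope_def)

lemma constants: "1 \<le> M" "1 \<le> k"
  and k_eq: "2 * k = M * B + M * (C * real DIM('a) + C\<^sup>2) / 2 + (M * C)\<^sup>2 / 4 + 1 + k"
proof -
  show "1 \<le> M" using C_nonneg by (simp add: M_eq)
  then have "0 \<le> M * B" "0 \<le> M * (C * real DIM('a) + C\<^sup>2) / 2" using C_nonneg B_nonneg by auto
  then show "1 \<le> k" "2 * k = M * B + M * (C * real DIM('a) + C\<^sup>2) / 2 + (M * C)\<^sup>2 / 4 + 1 + k"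
    unfolding k_def well_tilt_def M_def[symmetric] by auto
qed

lemma G_bounds:
  assumes "\<bar>s\<bar> \<le> 1"
  shows "0 \<le> G s" "G s \<le> 4 * k * d"
proof -
  have "(s - \<gamma>)\<^sup>2 \<le> 2\<^sup>2" using assms gamma by (intro abs_le_square_iff[THEN iffD1]) simp
  moreover have "0 \<le> k * d" using constants d by simp
  ultimately show "0 \<le> G s" "G s \<le> 4 * k * d"
    using mult_left_mono[of "4 - (s - \<gamma>)\<^sup>2" 4 "k * d"] by (auto simp: G_def mult.commute mult.left_commute)
qed

lemma barrier_bounds:
  assumes "x \<in> closure \<Omega>"
  shows "- (M * d) \<le> \<phi> x" "\<phi> x \<le> 0" "exp (\<phi> x) \<le> 1" "1 - exp (\<phi> x) \<le> M * d"
    "norm (q x) \<le> M * C" "- (M * (C * real DIM('a) + C\<^sup>2) / d) \<le> (\<Sum>b\<in>Basis. \<phi>2 x b)"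
proof -
  define y where "y = exp (- (\<rho> x / d))"
  have y: "0 < y" "y \<le> 1" using nonneg[OF assms] d by (auto simp: y_def)
  have M: "M > 0" using constants by simp
  show 1: "- (M * d) \<le> \<phi> x" "\<phi> x \<le> 0" using M d y by (auto simp: \<phi>_def y_def)
  show "exp (\<phi> x) \<le> 1" using 1 by simp
  show "1 - exp (\<phi> x) \<le> M * d" using 1 exp_ge_add_one_self[of "\<phi> x"] by linarith
  have "norm (q x) = M * y * norm (g x)" using M y by (simp add: q_def y_def[symmetric])
  also have "\<dots> \<le> M * 1 * C" using M y grad_le[OF assms] by (intro mult_mono) auto
  finally show "norm (q x) \<le> M * C" by simp
  have gg: "(\<Sum>b\<in>Basis. (g x \<bullet> b)\<^sup>2) = g x \<bullet> g x"
    by (simp add: euclidean_inner[of "g x" "g x"] power2_eq_square)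
  have "g x \<bullet> g x \<le> C\<^sup>2" using grad_le[OF assms] by (simp add: power_mono flip: power2_norm_eq_inner)
  then have ggd: "(g x \<bullet> g x) / d \<le> C\<^sup>2 / d" using d by (intro divide_right_mono) auto
  have "C * real DIM('a) \<le> C * real DIM('a) / d" using C_nonneg d 
    by (simp add: pos_le_divide_eq mult_left_le)
  then have tr: "\<bar>\<Sum>b\<in>Basis. H x b \<bullet> b\<bar> \<le> C * real DIM('a) / d"
    using abs_trace_hess_le[OF assms] by linarith
  define z where "z = (\<Sum>b\<in>Basis. H x b \<bullet> b) - (g x \<bullet> g x) / d"
  have "(\<Sum>b\<in>Basis. \<phi>2 x b) = M * y * z"
    by (simp add: \<phi>2_def y_def z_def sum_distrib_left[symmetric] sum_subtractf sum_divide_distrib[symmetric] gg)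
  moreover have z: "- ((C * real DIM('a) + C\<^sup>2) / d) \<le> z" using tr ggd by (simp add: z_def add_divide_distrib)
  moreover have "(- ((C * real DIM('a) + C\<^sup>2) / d)) * (M * 1) \<le> z * (M * y)"
  proof -
    have "(- ((C * real DIM('a) + C\<^sup>2) / d)) * (M * 1) \<le> (- ((C * real DIM('a) + C\<^sup>2) / d)) * (M * y)"
    proof (rule mult_left_mono_neg)
      show "M * y \<le> M * 1" using M y by (intro mult_left_mono) auto
      show "- ((C * real DIM('a) + C\<^sup>2) / d) \<le> 0" using C_nonneg d by simp
    qed
    also have "\<dots> \<le> z * (M * y)" using z M y by (intro mult_right_mono) auto
    finally show ?thesis .
  qed
  ultimately show "- (M * (C * real DIM('a) + C\<^sup>2) / d) \<le> (\<Sum>b\<in>Basis. \<phi>2 x b)"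
    by (simp add: algebra_simps)
qed

lemma phi_deriv: "(\<phi> has_derivative (\<lambda>v. q x \<bullet> v)) (at x)"
  unfolding \<phi>_def[abs_def] q_def using d
  by (auto intro!: derivative_eq_intros twice_diffD(1)[OF twice_diff] simp: algebra_simps)

lemma line_derivatives:
  shows "((\<lambda>s. \<phi> (x + s *\<^sub>R b)) has_real_derivative q (x + s *\<^sub>R b) \<bullet> b) (at s)"
    and "((\<lambda>s. q (x + s *\<^sub>R b) \<bullet> b) has_real_derivative \<phi>2 (x + s *\<^sub>R b) b) (at s)"
  unfolding \<phi>_def q_def \<phi>2_def using d
  by (auto intro!: derivative_eq_intros rho_line grad_line_component simp: algebra_simps power2_eq_square)

lemma w_line:
  assumes "x + s *\<^sub>R b \<in> \<Omega>" "0 < t"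
  shows "((\<lambda>s. w (x + s *\<^sub>R b) t) has_real_derivative
    \<epsilon>\<^sup>2 * (p (x + s *\<^sub>R b) t \<bullet> A (x + s *\<^sub>R b) t b)) (at s)"
  unfolding w_def
  using has_real_derivative_inner[OF p_line[OF assms] p_line[OF assms]]
  by (auto intro!: derivative_eq_intros simp: inner_commute)

lemma WG_deriv:
  "((\<lambda>s. W s + G s) has_real_derivative N s) (at s)"
  "(N has_real_derivative W'' s - 2 * k * d) (at s)"
  unfolding G_def N_def[abs_def]
  by (auto intro!: derivative_eq_intros W_deriv simp: algebra_simps power2_eq_square)

lemma Q_line:
  assumes x: "x + s *\<^sub>R b \<in> \<Omega>" and t: "0 < t"
  defines "y \<equiv> x + s *\<^sub>R b"
  shows "((\<lambda>s. Q (x + s *\<^sub>R b) t) has_real_derivative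
    exp (\<phi> y) * (q y \<bullet> b) * w y t + exp (\<phi> y) * \<epsilon>\<^sup>2 * (p y t \<bullet> A y t b) - N (u y t) * (p y t \<bullet> b)) (at s)"
proof -
  have "((\<lambda>s. W (u (x + s *\<^sub>R b) t) + G (u (x + s *\<^sub>R b) t)) has_real_derivative N (u y t) * (p y t \<bullet> b)) (at s)"
    using DERIV_chain2[OF WG_deriv(1) u_line[OF x t]] by (simp add: y_def)
  moreover have "((\<lambda>s. exp (\<phi> (x + s *\<^sub>R b))) has_real_derivative exp (\<phi> y) * (q y \<bullet> b)) (at s)"
    using DERIV_chain2[OF DERIV_exp line_derivatives(1)] by (simp add: y_def)
  ultimately show ?thesis
    unfolding Q_def
    by (intro DERIV_cong[OF DERIV_diff[OF DERIV_mult[OF _ w_line[OF x t]]]])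
       (auto simp: y_def algebra_simps)
qed

lemma Q_line2:
  assumes x: "x \<in> \<Omega>" and t: "0 < t" and b: "b \<in> Basis"
  shows "((\<lambda>s. let y = x + s *\<^sub>R b in exp (\<phi> y) * (q y \<bullet> b) * w y t + exp (\<phi> y) * \<epsilon>\<^sup>2 * (p y t \<bullet> A y t b)
      - N (u y t) * (p y t \<bullet> b)) has_real_derivative
    exp (\<phi> x) * (\<phi>2 x b + (q x \<bullet> b)\<^sup>2) * w x t + 2 * (q x \<bullet> b) * (exp (\<phi> x) * \<epsilon>\<^sup>2 * (p x t \<bullet> A x t b))
      + exp (\<phi> x) * \<epsilon>\<^sup>2 * (A x t b \<bullet> A x t b + p x t \<bullet> T x t b)
      - (W'' (u x t) - 2 * k * d) * (p x t \<bullet> b)\<^sup>2 - N (u x t) * (A x t b \<bullet> b)) (at 0)"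
proof -
  have x0: "x + 0 *\<^sub>R b \<in> \<Omega>" using x by simp
  have 1: "((\<lambda>s. N (u (x + s *\<^sub>R b) t)) has_real_derivative (W'' (u x t) - 2 * k * d) * (p x t \<bullet> b)) (at 0)"
    using DERIV_chain2[OF WG_deriv(2) u_line[OF x0 t]] by simp
  have 2: "((\<lambda>s. exp (\<phi> (x + s *\<^sub>R b))) has_real_derivative exp (\<phi> x) * (q x \<bullet> b)) (at 0)"
    using DERIV_chain2[OF DERIV_exp line_derivatives(1)[of x b 0]] by simp
  have 3: "((\<lambda>s. p (x + s *\<^sub>R b) t \<bullet> A (x + s *\<^sub>R b) t b) has_real_derivative
      p x t \<bullet> T x t b + A x t b \<bullet> A x t b) (at 0)"
    using has_real_derivative_inner[OF p_line[OF x0 t] A_line[OF x0 t b]] by simp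
  have 4: "((\<lambda>s. w (x + s *\<^sub>R b) t) has_real_derivative \<epsilon>\<^sup>2 * (p x t \<bullet> A x t b)) (at 0)"
    using w_line[OF x0 t] by simp
  have 5: "((\<lambda>s. p (x + s *\<^sub>R b) t \<bullet> b) has_real_derivative A x t b \<bullet> b) (at 0)"
    using p_line_component[OF x0 t] by simp
  have 6: "((\<lambda>s. q (x + s *\<^sub>R b) \<bullet> b) has_real_derivative \<phi>2 x b) (at 0)"
    using line_derivatives(2)[of x b 0] by simp
  show ?thesis
    unfolding Let_def
    by (rule derivative_eq_intros 1 2 3 4 5 6 refl)+ (simp add: algebra_simps power2_eq_square)
qed

lemma Q_time:
  assumes x: "x \<in> \<Omega>" and t: "0 < t"
  shows "(Q x has_real_derivative exp (\<phi> x) * \<epsilon>\<^sup>2 * (p x t \<bullet> pt x t) - N (u x t) * ut x t) (at t)"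
proof -
  have "((\<lambda>t. W (u x t) + G (u x t)) has_real_derivative N (u x t) * ut x t) (at t)"
    using DERIV_chain2[OF WG_deriv(1) u_time[OF x t]] by simp
  moreover have "((\<lambda>t. w x t) has_real_derivative \<epsilon>\<^sup>2 * (p x t \<bullet> pt x t)) (at t)"
    unfolding w_def using has_real_derivative_inner[OF p_time[OF x t] p_time[OF x t]]
    by (auto intro!: derivative_eq_intros simp: inner_commute)
  ultimately show ?thesis
    unfolding Q_def[abs_def]
    by (intro DERIV_cong[OF DERIV_diff[OF DERIV_cmult]]) (auto simp: algebra_simps)
qed

lemma w_large:
  assumes "x \<in> closure \<Omega>" "0 \<le> t" "K * d < Q x t" "0 \<le> K"
  shows "K * d < w x t" "p x t \<noteq> 0"
proof -
  have "0 \<le> w x t" by (simp add: w_def)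
  then have "exp (\<phi> x) * w x t \<le> w x t"
    using barrier_bounds(3)[OF assms(1)] by (simp add: mult_left_le_one_le)
  moreover have "0 \<le> W (u x t) + G (u x t)"
    using W_nonneg G_bounds(1) u_le assms(1,2) by simp
  ultimately show "K * d < w x t" using assms(3) by (simp add: Q_def)
  moreover have "0 \<le> K * d" using assms(4) d by simp
  ultimately show "p x t \<noteq> 0" by (auto simp: w_def)
qed

text \<open>
  At the boundary \<open>q = M g\<close>, so the weight contributes \<open>M |g|\<^sup>2 w\<close> with \<open>|g| \<ge> 1\<close>, whereas
  \<open>normal_derivative_gradient\<close> costs at most \<open>2 C w\<close>; the term with \<open>N\<close> drops out by the Neumann condition.
\<close>

lemma boundary_strict:
  assumes x: "x \<in> frontier \<Omega>" and t: "0 < t" and big: "0 < Q x t"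
  shows "\<exists>D. ((\<lambda>y. Q y t) has_derivative D) (at x within closure \<Omega>) \<and> 0 < D (g x)"
proof (intro exI conjI)
  have cl: "x \<in> closure \<Omega>" using domain_subset x by blast
  have phi: "(\<phi> has_derivative (\<lambda>v. q x \<bullet> v)) (at x within closure \<Omega>)"
    using phi_deriv by (rule has_derivative_at_withinI)
  have WG: "((\<lambda>y. W (u y t) + G (u y t)) has_derivative (\<lambda>v. N (u x t) * (p x t \<bullet> v))) (at x within closure \<Omega>)"
    using has_derivative_compose[OF u_deriv[OF cl t] WG_deriv(1)[unfolded has_field_derivative_def]] by simp
  have ww: "((\<lambda>y. w y t) has_derivative (\<lambda>v. \<epsilon>\<^sup>2 * (p x t \<bullet> A x t v))) (at x within closure \<Omega>)"
    unfolding w_def using p_deriv[OF cl t]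
    by (auto intro!: derivative_eq_intros simp: inner_commute)
  show "((\<lambda>y. Q y t) has_derivative (\<lambda>v. exp (\<phi> x) * (q x \<bullet> v) * w x t
      + exp (\<phi> x) * \<epsilon>\<^sup>2 * (p x t \<bullet> A x t v) - N (u x t) * (p x t \<bullet> v))) (at x within closure \<Omega>)"
    unfolding Q_def
    by (rule derivative_eq_intros phi WG ww refl)+ (simp add: algebra_simps)
  have q: "q x = M *\<^sub>R g x" using frontier_zero[OF x] by (simp add: q_def)
  have pp: "p x t \<bullet> p x t > 0" using w_large(2)[OF cl, of t 0] t big by simp
  have "1 \<le> (norm (g x))\<^sup>2" using frontier_grad[OF x] power_mono[of 1 "norm (g x)" 2] by simp
  then have gg: "1 \<le> g x \<bullet> g x" by (simp add: power2_norm_eq_inner)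
  have "p x t \<bullet> A x t (g x) = A x t (p x t) \<bullet> g x" using A_sym[OF cl t] by (simp add: inner_commute)
  also have "\<dots> = - (p x t \<bullet> H x (p x t))" by (rule normal_derivative_gradient[OF x t])
  also have "\<dots> \<ge> - (C * (p x t \<bullet> p x t))"
  proof -
    have "p x t \<bullet> H x (p x t) \<le> norm (p x t) * norm (H x (p x t))" by (rule norm_cauchy_schwarz)
    also have "\<dots> \<le> norm (p x t) * (C * norm (p x t))" by (intro mult_left_mono hess_le cl) simp
    finally show ?thesis by (simp add: power2_eq_square algebra_simps flip: power2_norm_eq_inner)
  qed
  finally have nd: "p x t \<bullet> A x t (g x) \<ge> - (C * (p x t \<bullet> p x t))" .
  have "M \<le> M * (g x \<bullet> g x)" using gg constants by simp
  then have "(M * (g x \<bullet> g x)) * ((p x t \<bullet> p x t) / 2) \<ge> M * ((p x t \<bullet> p x t) / 2)"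
    using pp by (intro mult_right_mono) auto
  then have "0 < (M * (g x \<bullet> g x)) * ((p x t \<bullet> p x t) / 2) + p x t \<bullet> A x t (g x)"
  proof -
    have "M * ((p x t \<bullet> p x t) / 2) = C * (p x t \<bullet> p x t) + (p x t \<bullet> p x t) / 2"
      by (simp add: M_eq algebra_simps)
    with \<open>(M * (g x \<bullet> g x)) * ((p x t \<bullet> p x t) / 2) \<ge> M * ((p x t \<bullet> p x t) / 2)\<close> nd pp show ?thesis by linarith
  qed
  then have "0 < exp (\<phi> x) * \<epsilon>\<^sup>2 * ((M * (g x \<bullet> g x)) * ((p x t \<bullet> p x t) / 2) + p x t \<bullet> A x t (g x))"
    using eps by (intro mult_pos_pos) auto
  also have "\<dots> = exp (\<phi> x) * (q x \<bullet> g x) * w x t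
      + exp (\<phi> x) * \<epsilon>\<^sup>2 * (p x t \<bullet> A x t (g x)) - N (u x t) * (p x t \<bullet> g x)"
    using neumann[OF x t] by (simp add: q w_def algebra_simps)
  finally show "0 < exp (\<phi> x) * (q x \<bullet> g x) * w x t
      + exp (\<phi> x) * \<epsilon>\<^sup>2 * (p x t \<bullet> A x t (g x)) - N (u x t) * (p x t \<bullet> g x)" .
qed

text \<open>
  The terms of third order are removed with the gradient of the equation.  What remains is the balance
  of the good term \<open>2 k d |p|\<^sup>2\<close> against the effects of the weight.  Two signs are essential:
  \<open>W' G' \<ge> 0\<close> gives \<open>N W' \<le> N\<^sup>2\<close>, and \<open>\<phi> \<le> 0\<close> gives \<open>N\<^sup>2 \<le> N\<^sup>2 / exp \<phi>\<close>, so the contribution of size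
  \<open>1 / \<epsilon>\<^sup>2\<close>, which has no factor \<open>|p|\<^sup>2\<close> and could not be absorbed, has the right sign.
\<close>

lemma interior_strict:
  assumes x: "x \<in> \<Omega>" and t: "0 < t" 
    and big: "gradient_threshold C B (real DIM('a)) * d < Q x t"
    and crit: "\<And>b. b \<in> Basis \<Longrightarrow> exp (\<phi> x) * (q x \<bullet> b) * w x t
      + exp (\<phi> x) * \<epsilon>\<^sup>2 * (p x t \<bullet> A x t b) - N (u x t) * (p x t \<bullet> b) = 0"
  shows "exp (\<phi> x) * \<epsilon>\<^sup>2 * (p x t \<bullet> pt x t) - N (u x t) * ut x t <
    (\<Sum>b\<in>Basis. exp (\<phi> x) * (\<phi>2 x b + (q x \<bullet> b)\<^sup>2) * w x t + 2 * (q x \<bullet> b) * (exp (\<phi> x) * \<epsilon>\<^sup>2 * (p x t \<bullet> A x t b))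
      + exp (\<phi> x) * \<epsilon>\<^sup>2 * (A x t b \<bullet> A x t b + p x t \<bullet> T x t b)
      - (W'' (u x t) - 2 * k * d) * (p x t \<bullet> b)\<^sup>2 - N (u x t) * (A x t b \<bullet> b))"
proof -
  have cl: "x \<in> closure \<Omega>" using domain_subset x by blast
  define E where "E = exp (\<phi> x)"
  define P where "P = p x t"
  define v where "v = u x t"
  define ww where "ww = w x t"
  define S where "S = (B + 4 * k) * (M * C)"
  have wP: "ww = \<epsilon>\<^sup>2 * (P \<bullet> P) / 2" by (simp add: ww_def w_def P_def)
  have S0: "0 \<le> S" using B_nonneg constants C_nonneg by (simp add: S_def)
  have thr: "gradient_threshold C B (real DIM('a)) = S\<^sup>2"
    by (simp add: gradient_threshold_def S_def M_def k_def)
  have large: "S\<^sup>2 * d < ww" "P \<noteq> 0"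
    using w_large[OF cl _ big] t by (auto simp: thr ww_def P_def)
  have v1: "\<bar>v\<bar> \<le> 1" using u_le[OF cl] t by (simp add: v_def)
  have E: "0 < E" "E \<le> 1" "1 - E \<le> M * d" using barrier_bounds[OF cl] by (auto simp: E_def)
  have PP: "P \<bullet> P > 0" using large by simp
  have crit': "E * \<epsilon>\<^sup>2 * (P \<bullet> A x t b) = N v * (P \<bullet> b) - E * ww * (q x \<bullet> b)" if "b \<in> Basis" for b
    using crit[OF that] by (simp add: E_def P_def v_def ww_def algebra_simps)
  note hess = hessian_norm_lower_bound[OF E(1) eps large(2) wP crit']
  have qq: "(\<Sum>b\<in>Basis. (q x \<bullet> b)\<^sup>2) = q x \<bullet> q x" "(\<Sum>b\<in>Basis. (P \<bullet> b)\<^sup>2) = P \<bullet> P"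
    by (simp_all add: euclidean_inner[of "q x" "q x"] euclidean_inner[of P P] power2_eq_square)
  have cross: "(\<Sum>b\<in>Basis. 2 * (q x \<bullet> b) * (E * \<epsilon>\<^sup>2 * (P \<bullet> A x t b)))
      = 2 * N v * (P \<bullet> q x) - 2 * E * ww * (q x \<bullet> q x)"
  proof -
    have "(\<Sum>b\<in>Basis. 2 * (q x \<bullet> b) * (E * \<epsilon>\<^sup>2 * (P \<bullet> A x t b)))
        = (\<Sum>b\<in>Basis. 2 * N v * ((P \<bullet> b) * (q x \<bullet> b)) - 2 * E * ww * (q x \<bullet> b)\<^sup>2)"
    proof (rule sum.cong[OF refl])
      fix b :: 'a assume b: "b \<in> Basis"
      show "2 * (q x \<bullet> b) * (E * \<epsilon>\<^sup>2 * (P \<bullet> A x t b))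
          = 2 * N v * ((P \<bullet> b) * (q x \<bullet> b)) - 2 * E * ww * (q x \<bullet> b)\<^sup>2"
        unfolding crit'[OF b] by (simp add: power2_eq_square algebra_simps)
    qed
    then show ?thesis
      by (simp add: sum_subtractf sum_distrib_left[symmetric] qq euclidean_inner[of P "q x"])
  qed
  \<comment> \<open>The equation and its gradient trade the third derivatives of \<open>u\<close> for time derivatives.\<close>
  have sumT: "(\<Sum>b\<in>Basis. P \<bullet> T x t b) = P \<bullet> pt x t + W'' v / \<epsilon>\<^sup>2 * (P \<bullet> P)"
    using p_eq[OF x t] by (simp add: inner_sum_right[symmetric] inner_diff_right P_def v_def)
  have sumA: "(\<Sum>b\<in>Basis. A x t b \<bullet> b) = ut x t + W' v / \<epsilon>\<^sup>2"
    using u_eq[OF x t] by (simp add: v_def)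
  define lap where "lap = (\<Sum>b\<in>Basis. \<phi>2 x b)"
  define AA where "AA = (\<Sum>b\<in>Basis. A x t b \<bullet> A x t b)"
  have total: "(\<Sum>b\<in>Basis. E * (\<phi>2 x b + (q x \<bullet> b)\<^sup>2) * ww + 2 * (q x \<bullet> b) * (E * \<epsilon>\<^sup>2 * (P \<bullet> A x t b))
      + E * \<epsilon>\<^sup>2 * (A x t b \<bullet> A x t b + P \<bullet> T x t b)
      - (W'' v - 2 * k * d) * (P \<bullet> b)\<^sup>2 - N v * (A x t b \<bullet> b))
    = E * (lap + q x \<bullet> q x) * ww + (2 * N v * (P \<bullet> q x) - 2 * E * ww * (q x \<bullet> q x))
      + E * \<epsilon>\<^sup>2 * (AA + (P \<bullet> pt x t + W'' v / \<epsilon>\<^sup>2 * (P \<bullet> P)))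
      - (W'' v - 2 * k * d) * (P \<bullet> P) - N v * (ut x t + W' v / \<epsilon>\<^sup>2)"
  proof -
    have 1: "(\<Sum>b\<in>Basis. E * (\<phi>2 x b + (q x \<bullet> b)\<^sup>2) * ww) = E * (lap + q x \<bullet> q x) * ww"
      by (simp only: sum_distrib_left[symmetric] sum_distrib_right[symmetric] sum.distrib lap_def qq)
    have 2: "(\<Sum>b\<in>Basis. E * \<epsilon>\<^sup>2 * (A x t b \<bullet> A x t b + P \<bullet> T x t b))
        = E * \<epsilon>\<^sup>2 * (AA + (P \<bullet> pt x t + W'' v / \<epsilon>\<^sup>2 * (P \<bullet> P)))"
      by (simp only: sum_distrib_left[symmetric] sum.distrib AA_def sumT)
    have 3: "(\<Sum>b\<in>Basis. (W'' v - 2 * k * d) * (P \<bullet> b)\<^sup>2) = (W'' v - 2 * k * d) * (P \<bullet> P)"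
      by (simp only: sum_distrib_left[symmetric] qq)
    have 4: "(\<Sum>b\<in>Basis. N v * (A x t b \<bullet> b)) = N v * (ut x t + W' v / \<epsilon>\<^sup>2)"
      by (simp only: sum_distrib_left[symmetric] sumA)
    show ?thesis by (simp only: sum_subtractf sum.distrib 1 2 3 4 cross)
  qed
  \<comment> \<open>The term without a factor \<open>|p|\<^sup>2\<close> has a sign.\<close>
  have reaction: "N v * W' v / \<epsilon>\<^sup>2 \<le> (N v)\<^sup>2 / (E * \<epsilon>\<^sup>2)"
  proof -
    have "N v * W' v = (N v)\<^sup>2 + 2 * k * d * (W' v * (v - \<gamma>)) - (2 * k * d * (v - \<gamma>))\<^sup>2"
      by (simp add: N_def power2_eq_square algebra_simps)
    also have "\<dots> \<le> (N v)\<^sup>2"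
    proof -
      have "2 * k * d * (W' v * (v - \<gamma>)) \<le> 0"
        by (rule mult_nonneg_nonpos) (use W_monotone[OF v1] constants d in simp_all)
      moreover have "0 \<le> (2 * k * d * (v - \<gamma>))\<^sup>2" by simp
      ultimately show ?thesis by linarith
    qed
    also have "\<dots> \<le> (N v)\<^sup>2 / E" using E by (simp add: pos_le_divide_eq mult_left_le)
    finally have "N v * W' v / \<epsilon>\<^sup>2 \<le> (N v)\<^sup>2 / E / \<epsilon>\<^sup>2" by (intro divide_right_mono) auto
    then show ?thesis by simp
  qed
  have Nb: "\<bar>N v\<bar> \<le> B + 4 * k"
  proof -
    have "\<bar>v - \<gamma>\<bar> \<le> 2" using v1 gamma by simp
    then have "d * \<bar>v - \<gamma>\<bar> \<le> 1 * 2" using d by (intro mult_mono) auto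
    then have "2 * k * (d * \<bar>v - \<gamma>\<bar>) \<le> 2 * k * 2" using constants by (intro mult_left_mono) auto
    then have "\<bar>2 * k * d * (v - \<gamma>)\<bar> \<le> 4 * k" using constants d by (simp add: abs_mult mult.assoc)
    then show ?thesis using W_bound(2)[OF v1] unfolding N_def by linarith
  qed
  have drift: "\<bar>N v * (P \<bullet> q x)\<bar> \<le> S * norm P"
  proof -
    have "\<bar>N v * (P \<bullet> q x)\<bar> \<le> (B + 4 * k) * (norm P * norm (q x))"
      unfolding abs_mult using Nb Cauchy_Schwarz_ineq2[of P "q x"] B_nonneg constants by (intro mult_mono) auto
    also have "\<dots> \<le> (B + 4 * k) * (norm P * (M * C))"
      using barrier_bounds(5)[OF cl] B_nonneg constants by (intro mult_left_mono) auto
    finally show ?thesis by (simp add: S_def algebra_simps)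
  qed
  have absorb: "S * norm P < d * (P \<bullet> P)"
    using gradient_term_absorbs[OF d(1) eps d(3) _ S0, of "norm P" ww] large wP
    by (simp add: power2_norm_eq_inner)
  have ww0: "ww > 0" unfolding wP using PP eps by simp
  have wd: "ww \<le> d * (d * (P \<bullet> P) / 2)"
  proof -
    have "\<epsilon>\<^sup>2 \<le> d * d" using d by (smt (verit) mult_left_le power3_eq_cube zero_le_square mult.commute)
    then have "\<epsilon>\<^sup>2 * (P \<bullet> P) \<le> d * d * (P \<bullet> P)" using PP by (intro mult_right_mono) auto
    then show ?thesis by (simp add: wP)
  qed
  have lapb: "- (M * (C * real DIM('a) + C\<^sup>2) / 2 * (d * (P \<bullet> P))) \<le> E * lap * ww"
  proof -
    define c2 where "c2 = M * (C * real DIM('a) + C\<^sup>2)"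
    have c2: "0 \<le> c2" using constants C_nonneg by (simp add: c2_def)
    have lb: "- (c2 / d) \<le> lap" using barrier_bounds(6)[OF cl] by (simp add: lap_def c2_def)
    have "- (E * lap * ww) \<le> E * (c2 / d) * ww" 
      using mult_right_mono[OF mult_left_mono[OF lb, of E], of ww] E ww0 by simp
    also have "\<dots> \<le> 1 * (c2 / d) * (d * (d * (P \<bullet> P) / 2))"
      using E wd c2 d ww0 by (intro mult_mono) auto
    also have "\<dots> = c2 / 2 * (d * (P \<bullet> P))" using d by simp
    finally show ?thesis by (simp add: c2_def)
  qed
  have qb: "E * ww * (q x \<bullet> q x) / 2 \<le> (M * C)\<^sup>2 / 4 * (d * (P \<bullet> P))"
  proof -
    have a1: "q x \<bullet> q x \<le> (M * C)\<^sup>2" using barrier_bounds(5)[OF cl] by (simp add: power_mono flip: power2_norm_eq_inner)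
    have a2: "E * ww \<le> 1 * (d * (P \<bullet> P) / 2)"
    proof -
      have "ww \<le> d * (P \<bullet> P) / 2" using wd d PP by (smt (verit) mult_left_le_one_le half_gt_zero mult_pos_pos)
      then show ?thesis using E ww0 by (intro mult_mono) auto
    qed
    have "E * ww * (q x \<bullet> q x) \<le> 1 * (d * (P \<bullet> P) / 2) * (M * C)\<^sup>2"
      by (rule mult_mono[OF a2 a1]) (use d in simp_all)
    then show ?thesis by (simp add: algebra_simps)
  qed
  have curv: "(1 - E) * W'' v * (P \<bullet> P) \<le> M * B * (d * (P \<bullet> P))"
  proof -
    have "(1 - E) * W'' v \<le> (1 - E) * B" using E W_bound(3)[OF v1] by (intro mult_left_mono) auto
    also have "\<dots> \<le> M * d * B" using E B_nonneg by (intro mult_right_mono) auto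
    finally have "(1 - E) * W'' v \<le> M * d * B" .
    from mult_right_mono[OF this, of "P \<bullet> P"] show ?thesis by (simp add: algebra_simps)
  qed
  have key: "0 < E * lap * ww - E * ww * (q x \<bullet> q x) / 2 + N v * (P \<bullet> q x) 
      + 2 * k * (d * (P \<bullet> P)) - (1 - E) * W'' v * (P \<bullet> P)"
  proof -
    define X where "X = d * (P \<bullet> P)"
    have "0 < X" using d PP by (simp add: X_def)
    then have "0 \<le> k * X" using constants by simp
    have "2 * k * X = (M * B) * X + (M * (C * real DIM('a) + C\<^sup>2) / 2) * X + (M * C)\<^sup>2 / 4 * X + X + k * X"
      unfolding k_eq by (simp add: algebra_simps)
    moreover have "S * norm P < X" using absorb by (simp add: X_def)
    ultimately show ?thesis
      using lapb qb curv drift \<open>0 \<le> k * X\<close> unfolding X_def[symmetric] abs_le_iff by linarith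
  qed
  \<comment> \<open>Adding the reaction term completes \<open>key\<close> to the difference of the Laplacian and the time derivative.\<close>
  have eps2: "\<epsilon>\<^sup>2 \<noteq> 0" using eps by simp
  have "0 < E * lap * ww - E * ww * (q x \<bullet> q x) / 2 + N v * (P \<bullet> q x) 
      + 2 * k * (d * (P \<bullet> P)) - (1 - E) * W'' v * (P \<bullet> P)
      + ((N v)\<^sup>2 / (E * \<epsilon>\<^sup>2) - N v * W' v / \<epsilon>\<^sup>2)"
    using key reaction by linarith
  also have "\<dots> = E * (lap + q x \<bullet> q x) * ww + (2 * N v * (P \<bullet> q x) - 2 * E * ww * (q x \<bullet> q x))
      + (((N v)\<^sup>2 / (E * \<epsilon>\<^sup>2) - N v * (P \<bullet> q x) + E * ww * (q x \<bullet> q x) / 2) + E * W'' v * (P \<bullet> P))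
      - (W'' v - 2 * k * d) * (P \<bullet> P) - N v * W' v / \<epsilon>\<^sup>2"
    by (simp add: algebra_simps)
  also have "\<dots> \<le> E * (lap + q x \<bullet> q x) * ww + (2 * N v * (P \<bullet> q x) - 2 * E * ww * (q x \<bullet> q x))
      + (E * \<epsilon>\<^sup>2 * AA + E * W'' v * (P \<bullet> P))
      - (W'' v - 2 * k * d) * (P \<bullet> P) - N v * W' v / \<epsilon>\<^sup>2"
    by (intro diff_right_mono add_left_mono add_right_mono hess[folded AA_def])
  also have "\<dots> = E * (lap + q x \<bullet> q x) * ww + (2 * N v * (P \<bullet> q x) - 2 * E * ww * (q x \<bullet> q x))
      + E * \<epsilon>\<^sup>2 * (AA + (P \<bullet> pt x t + W'' v / \<epsilon>\<^sup>2 * (P \<bullet> P)))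
      - (W'' v - 2 * k * d) * (P \<bullet> P) - N v * (ut x t + W' v / \<epsilon>\<^sup>2)
      - (E * \<epsilon>\<^sup>2 * (P \<bullet> pt x t) - N v * ut x t)"
    using eps2 by (simp add: field_simps)
  finally have "E * \<epsilon>\<^sup>2 * (P \<bullet> pt x t) - N v * ut x t <
      (\<Sum>b\<in>Basis. E * (\<phi>2 x b + (q x \<bullet> b)\<^sup>2) * ww + 2 * (q x \<bullet> b) * (E * \<epsilon>\<^sup>2 * (P \<bullet> A x t b))
      + E * \<epsilon>\<^sup>2 * (A x t b \<bullet> A x t b + P \<bullet> T x t b)
      - (W'' v - 2 * k * d) * (P \<bullet> b)\<^sup>2 - N v * (A x t b \<bullet> b))"
    unfolding total by simp
  then show ?thesis by (simp only: E_def P_def v_def ww_def)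
qed

theorem discrepancy_le:
  assumes x: "x \<in> closure \<Omega>" and t: "0 \<le> t"
  shows "\<epsilon>\<^sup>2 * (p x t \<bullet> p x t) / 2 - W (u x t) \<le> discrepancy_const C B (real DIM('a)) c * d"
proof -
  define K where "K = gradient_threshold C B (real DIM('a))"
  define m where "m = (K + max c 0) * d"
  have K: "0 \<le> K" by (simp add: K_def gradient_threshold_def)
  have m: "0 \<le> m" "K * d \<le> m" using K d by (auto simp: m_def algebra_simps)
  have "Q x t \<le> m"
  proof (rule parabolic_maximum_principle[where \<tau> = t, OF _ _ _ _ x t order_refl])
    have uc: "continuous_on (closure \<Omega> \<times> {0..t}) (\<lambda>z. u (fst z) (snd z))"
      by (rule continuous_on_subset[OF u_cont[unfolded case_prod_unfold]]) auto
    have pc: "continuous_on (closure \<Omega> \<times> {0..t}) (\<lambda>z. p (fst z) (snd z))"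
      by (rule continuous_on_subset[OF p_cont[unfolded case_prod_unfold]]) auto
    have phic: "continuous_on UNIV \<phi>" using phi_deriv
      by (meson continuous_at_imp_continuous_on has_derivative_continuous)
    have WGc: "continuous_on UNIV (\<lambda>s. W s + G s)" using WG_deriv(1)
      by (meson continuous_at_imp_continuous_on DERIV_isCont)
    show "continuous_on (closure \<Omega> \<times> {0..t}) (\<lambda>(x, t). Q x t)"
      unfolding Q_def w_def case_prod_unfold
      by (intro continuous_intros pc continuous_on_compose2[OF WGc uc] continuous_on_compose2[OF phic]) auto
  next
    fix y assume y: "y \<in> closure \<Omega>"
    have "0 \<le> w y 0" by (simp add: w_def)
    then have "exp (\<phi> y) * w y 0 \<le> w y 0"
      using barrier_bounds(3)[OF y] by (simp add: mult_left_le_one_le)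
    moreover have "w y 0 - W (u y 0) \<le> c * d" using initial[OF y] by (simp add: w_def)
    moreover have "0 \<le> G (u y 0)" using G_bounds(1) u_le[OF y] by simp
    moreover have "c * d \<le> m" unfolding m_def using K d by (intro mult_right_mono) auto
    ultimately show "Q y 0 \<le> m" by (simp add: Q_def)
  next
    fix y s assume "y \<in> frontier \<Omega>" "0 < s" "m < Q y s"
    then show "\<exists>D. ((\<lambda>y. Q y s) has_derivative D) (at y within closure \<Omega>) \<and> 0 < D (g y)"
      using boundary_strict m by simp
  next
    fix y s assume y: "y \<in> \<Omega>" and s: "0 < s" and big: "m < Q y s"
    have big': "gradient_threshold C B (real DIM('a)) * d < Q y s" using big m(2) by (simp add: K_def)
    show "\<exists>dt d1 d2. (Q y has_real_derivative dt) (at s) \<and>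
        (\<forall>b\<in>Basis. (\<forall>r. y + r *\<^sub>R b \<in> \<Omega> \<longrightarrow> ((\<lambda>r. Q (y + r *\<^sub>R b) s) has_real_derivative d1 b r) (at r)) \<and>
           (d1 b has_real_derivative d2 b) (at 0)) \<and>
        (0 \<le> dt \<and> (\<forall>b\<in>Basis. d1 b 0 = 0) \<longrightarrow> dt < (\<Sum>b\<in>Basis. d2 b))"
      using Q_time[OF y s] Q_line[OF _ s, of y] Q_line2[OF y s] interior_strict[OF y s big']
      by (intro exI[of _ "exp (\<phi> y) * \<epsilon>\<^sup>2 * (p y s \<bullet> pt y s) - N (u y s) * ut y s"]
          exI[of _ "\<lambda>b r. let z = y + r *\<^sub>R b in exp (\<phi> z) * (q z \<bullet> b) * w z s
             + exp (\<phi> z) * \<epsilon>\<^sup>2 * (p z s \<bullet> A z s b) - N (u z s) * (p z s \<bullet> b)"]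
          exI[of _ "\<lambda>b. exp (\<phi> y) * (\<phi>2 y b + (q y \<bullet> b)\<^sup>2) * w y s
             + 2 * (q y \<bullet> b) * (exp (\<phi> y) * \<epsilon>\<^sup>2 * (p y s \<bullet> A y s b))
             + exp (\<phi> y) * \<epsilon>\<^sup>2 * (A y s b \<bullet> A y s b + p y s \<bullet> T y s b)
             - (W'' (u y s) - 2 * k * d) * (p y s \<bullet> b)\<^sup>2 - N (u y s) * (A y s b \<bullet> b)"]
          conjI ballI allI impI)
        (auto simp: Let_def)
  qed
  define E where "E = exp (- \<phi> x)"
  have u1: "\<bar>u x t\<bar> \<le> 1" using u_le[OF x t] .
  have "exp (\<phi> x) * w x t \<le> m + (W (u x t) + G (u x t))" using \<open>Q x t \<le> m\<close> by (simp add: Q_def)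
  then have "E * (exp (\<phi> x) * w x t) \<le> E * (m + (W (u x t) + G (u x t)))" by (simp add: E_def)
  moreover have "E * (exp (\<phi> x) * w x t) = w x t"
    by (simp add: E_def mult.assoc[symmetric] exp_add[symmetric])
  ultimately have "w x t \<le> E * (m + (W (u x t) + G (u x t)))" by simp
  then have "w x t - W (u x t) \<le> E * (m + G (u x t)) + (E - 1) * W (u x t)" by (simp add: algebra_simps)
  also have "\<dots> \<le> exp M * (m + 4 * k * d) + (exp M * (M * d)) * B"
  proof (intro add_mono mult_mono)
    have ph: "- \<phi> x \<le> M * d" "0 \<le> - \<phi> x" using barrier_bounds(1,2)[OF x] by auto
    have "M * d \<le> M" using constants d by (simp add: mult_left_le)
    then show EM: "E \<le> exp M" using ph by (simp add: E_def)
    have "(1 + \<phi> x) * E \<le> exp (\<phi> x) * E"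
      using exp_ge_add_one_self[of "\<phi> x"] by (intro mult_right_mono) (auto simp: E_def)
    then have "E - 1 \<le> E * (- \<phi> x)" by (simp add: E_def exp_add[symmetric] algebra_simps)
    also have "\<dots> \<le> exp M * (M * d)" using EM ph by (intro mult_mono) auto
    finally show "E - 1 \<le> exp M * (M * d)" .
    show "0 \<le> exp M * (M * d)" using constants d by simp
  qed (use G_bounds[OF u1] W_bound(1)[OF u1] W_nonneg m in auto)
  also have "\<dots> = discrepancy_const C B (real DIM('a)) c * d"
    by (simp add: discrepancy_const_def m_def K_def M_def k_def algebra_simps)
  finally show ?thesis by (simp add: w_def)
qed

end

section \<open>Regularity of solutions of the Allen--Cahn equation\<close>

definition partial_deriv :: "'a::euclidean_space set \<Rightarrow> 'a \<Rightarrow> ('a \<Rightarrow> real) \<Rightarrow> 'a \<Rightarrow> real" where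
  "partial_deriv S c f z = frechet_derivative f (at z within S) c"

lemma smooth_on_partial_deriv:
  assumes "smooth_on f S"
  shows "c \<in> Basis \<Longrightarrow> smooth_on (partial_deriv S c f) S"
    and "z \<in> S \<Longrightarrow> (f has_derivative (\<lambda>c. partial_deriv S c f z)) (at z within S)"
    and "continuous_on S f"
proof -
  have 1: "Ck_on (Suc k) f S" for k using assms unfolding smooth_on_def by blast
  show "smooth_on (partial_deriv S c f) S" if "c \<in> Basis"
    using 1 that by (simp add: smooth_on_def partial_deriv_def[abs_def])
  show "(f has_derivative (\<lambda>c. partial_deriv S c f z)) (at z within S)" if "z \<in> S"
    using 1[of 0] that by (simp add: partial_deriv_def frechet_derivative_works[symmetric] differentiable_on_def)
  show "continuous_on S f"
    using assms unfolding smooth_on_def by (metis Ck_on.simps(1))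
qed

lemma partial_deriv_interior:
  assumes "smooth_on f S" "open V" "V \<subseteq> S" "z \<in> V"
  shows "(f has_derivative (\<lambda>c. partial_deriv S c f z)) (at z)"
  using has_derivative_subset[OF smooth_on_partial_deriv(2)[OF assms(1), of z] assms(3)] assms at_within_open[of z V] by auto

lemma partial_deriv_cong_open:
  assumes "smooth_on f S" "smooth_on h S" "open V" "V \<subseteq> S" "z \<in> V" "\<And>y. y \<in> V \<Longrightarrow> f y = h y"
  shows "partial_deriv S c f z = partial_deriv S c h z"
proof -
  have "(h has_derivative (\<lambda>c. partial_deriv S c f z)) (at z)"
    by (rule has_derivative_transform_within_open[OF partial_deriv_interior[OF assms(1,3,4,5)] assms(3,5,6)])
  then have "(\<lambda>c. partial_deriv S c f z) = (\<lambda>c. partial_deriv S c h z)"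
    using partial_deriv_interior[OF assms(2,3,4,5)] has_derivative_unique by blast
  then show ?thesis by metis
qed

lemma partial_deriv_commute:
  assumes f: "smooth_on f S" and V: "open V" "V \<subseteq> S" "z \<in> V" and ab: "a \<in> Basis" "b \<in> Basis"
  shows "partial_deriv S a (partial_deriv S b f) z = partial_deriv S b (partial_deriv S a f) z"
proof (rule mixed_derivatives_commute[where f = f and F = "\<lambda>y c. partial_deriv S c f y" and a = a and b = b
      and Fa = "\<lambda>y c. partial_deriv S c (partial_deriv S a f) y" and Fb = "\<lambda>y c. partial_deriv S c (partial_deriv S b f) y",
      OF V(1,3), symmetric])
  show "(f has_derivative (\<lambda>c. partial_deriv S c f y)) (at y)" if "y \<in> V" for y
    by (rule partial_deriv_interior[OF f V(1,2) that])
  show "((\<lambda>y. partial_deriv S a f y) has_derivative (\<lambda>c. partial_deriv S c (partial_deriv S a f) y)) (at y)" if "y \<in> V" for y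
    by (rule partial_deriv_interior[OF smooth_on_partial_deriv(1)[OF f ab(1)] V(1,2) that])
  show "((\<lambda>y. partial_deriv S b f y) has_derivative (\<lambda>c. partial_deriv S c (partial_deriv S b f) y)) (at y)" if "y \<in> V" for y
    by (rule partial_deriv_interior[OF smooth_on_partial_deriv(1)[OF f ab(2)] V(1,2) that])
  show "continuous_on V (partial_deriv S b (partial_deriv S a f))" "continuous_on V (partial_deriv S a (partial_deriv S b f))"
    by (intro continuous_on_subset[OF smooth_on_partial_deriv(3) V(2)] smooth_on_partial_deriv(1) f ab)+
qed

text \<open>
  \<open>N s t\<close> is a modulus of continuity in time that is uniform in space.
\<close>

lemma jointly_continuous:
  fixes F :: "'a::metric_space \<Rightarrow> real \<Rightarrow> 'b::metric_space"
  assumes slice: "\<And>s. 0 \<le> s \<Longrightarrow> continuous_on K (\<lambda>x. F x s)"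
    and unif: "\<And>x s t. x \<in> K \<Longrightarrow> 0 \<le> s \<Longrightarrow> 0 \<le> t \<Longrightarrow> dist (F x t) (F x s) \<le> N s t"
    and lim: "\<And>s. 0 \<le> s \<Longrightarrow> (N s \<longlongrightarrow> 0) (at s within {0..})"
  shows "continuous_on (K \<times> {0..}) (\<lambda>(x, t). F x t)"
  unfolding continuous_on_iff
proof (intro ballI allI impI)
  fix z :: "'a \<times> real" and e :: real assume "z \<in> K \<times> {0..}" and e: "0 < e"
  then obtain x s where z: "z = (x, s)" "x \<in> K" "0 \<le> s" by auto
  from slice[OF z(3)] z(2) e obtain d1 where d1: "d1 > 0"
    "\<And>y. y \<in> K \<Longrightarrow> dist y x < d1 \<Longrightarrow> dist (F y s) (F x s) < e / 2"
    unfolding continuous_on_iff by (meson half_gt_zero)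
  have "\<forall>\<^sub>F t in at s within {0..}. dist (N s t) 0 < e / 2"
    using lim[OF z(3)] e unfolding tendsto_iff by (meson half_gt_zero)
  then obtain d2 where d2: "d2 > 0"
    "\<And>t. 0 \<le> t \<Longrightarrow> t \<noteq> s \<Longrightarrow> dist t s < d2 \<Longrightarrow> dist (N s t) 0 < e / 2"
    unfolding eventually_at by auto
  show "\<exists>d>0. \<forall>z'\<in>K \<times> {0..}. dist z' z < d \<longrightarrow> dist (case z' of (x, t) \<Rightarrow> F x t) (case z of (x, t) \<Rightarrow> F x t) < e"
  proof (intro exI[of _ "min d1 d2"] conjI ballI impI)
    fix z' assume z': "z' \<in> K \<times> {0..}" "dist z' z < min d1 d2"
    then obtain y t where y: "z' = (y, t)" "y \<in> K" "0 \<le> t" by auto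
    have "dist y x < d1" "dist t s < d2"
      using z'(2) dist_fst_le[of z' z] dist_snd_le[of z' z] by (auto simp: y z)
    then have 1: "dist (F y s) (F x s) < e / 2" using d1(2) y by blast
    have "dist (F y t) (F y s) < e / 2"
    proof (cases "t = s")
      case False
      have "dist (F y t) (F y s) \<le> N s t" using unif[OF y(2) z(3) y(3)] .
      also have "\<dots> < e / 2" using d2(2)[OF y(3) False \<open>dist t s < d2\<close>] by simp
      finally show ?thesis .
    qed (use e in simp)
    then have "dist (F y t) (F x s) < e" using 1 dist_triangle_half_r[of "F y s" "F y t" e "F x s"]
      by (simp add: dist_commute)
    then show "dist (case z' of (x, t) \<Rightarrow> F x t) (case z of (x, t) \<Rightarrow> F x t) < e" by (simp add: y z)
  qed (use d1 d2 in auto)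
qed

lemma C1_norm_bounds:
  assumes "Ck_on 1 f K" "compact K" "x \<in> K"
  shows "\<bar>f x\<bar> \<le> C1_norm K f" "norm (grad K f x) \<le> C1_norm K f"
proof -
  have f: "continuous_on K f" and "\<And>b. b \<in> Basis \<Longrightarrow> continuous_on K (\<lambda>x. frechet_derivative f (at x within K) b)"
    using assms(1) by (auto simp: differentiable_imp_continuous_on)
  then have "continuous_on K (grad K f)" unfolding grad_def by (auto intro!: continuous_intros)
  then have "bounded ((\<lambda>x. norm (grad K f x)) ` K)" "bounded ((\<lambda>x. \<bar>f x\<bar>) ` K)"
    using f assms(2) by (auto intro!: compact_imp_bounded compact_continuous_image continuous_intros)
  then have bd: "bdd_above ((\<lambda>x. norm (grad K f x)) ` K)" "bdd_above ((\<lambda>x. \<bar>f x\<bar>) ` K)"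
    by (auto intro: bounded_imp_bdd_above)
  have 1: "\<bar>f x\<bar> \<le> (SUP x\<in>K. \<bar>f x\<bar>)" using cSUP_upper[OF assms(3) bd(2)] .
  have 2: "norm (grad K f x) \<le> (SUP x\<in>K. norm (grad K f x))" using cSUP_upper[OF assms(3) bd(1)] .
  show "\<bar>f x\<bar> \<le> C1_norm K f" "norm (grad K f x) \<le> C1_norm K f"
    using 1 2 order_trans[OF norm_ge_zero 2] order_trans[OF abs_ge_zero 1] by (auto simp: C1_norm_def)
qed

lemma grad_continuous:
  assumes "Ck_on 1 f K"
  shows "continuous_on K (grad K f)"
  using assms unfolding grad_def by (auto intro!: continuous_intros)

context defined_domain
begin

lemma grad_unique:
  assumes "((f :: 'a \<Rightarrow> real) has_derivative (\<lambda>v. a \<bullet> v)) (at x within closure \<Omega>)" "x \<in> closure \<Omega>"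
  shows "grad (closure \<Omega>) f x = a"
proof -
  have "f differentiable (at x within closure \<Omega>)" using assms(1) by (rule differentiableI)
  from frechet_derivative_eq_grad[OF this]
  have "(\<lambda>v. grad (closure \<Omega>) f x \<bullet> v) = (\<lambda>v. a \<bullet> v)"
    using has_derivative_unique_closure assms by blast
  then have "\<forall>v. grad (closure \<Omega>) f x \<bullet> v = a \<bullet> v" by metis
  then show ?thesis by (rule iffD1[OF vector_eq_rdot])
qed

lemma Ck1_has_grad:
  assumes "Ck_on 1 f (closure \<Omega>)" "x \<in> closure \<Omega>"
  shows "(f has_derivative (\<lambda>v. grad (closure \<Omega>) f x \<bullet> v)) (at x within closure \<Omega>)"
  using assms by (intro frechet_derivative_eq_grad) (simp add: differentiable_on_def)

lemma grad_diff:
  assumes "Ck_on 1 f (closure \<Omega>)" "Ck_on 1 h (closure \<Omega>)" "x \<in> closure \<Omega>"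
  shows "grad (closure \<Omega>) (\<lambda>x. f x - h x) x = grad (closure \<Omega>) f x - grad (closure \<Omega>) h x"
  using Ck1_has_grad[OF assms(1,3)] Ck1_has_grad[OF assms(2,3)] assms(3)
  by (intro grad_unique) (auto intro!: derivative_eq_intros simp: inner_diff_left)

lemma Ck1_diff:
  assumes f: "Ck_on 1 f (closure \<Omega>)" and h: "Ck_on 1 h (closure \<Omega>)"
  shows "Ck_on 1 (\<lambda>x. f x - h x) (closure \<Omega>)"
proof -
  have d: "(\<lambda>x. f x - h x) differentiable_on closure \<Omega>"
    using f h by (simp add: differentiable_on_diff)
  have "frechet_derivative (\<lambda>x. f x - h x) (at x within closure \<Omega>) b = 
      (grad (closure \<Omega>) f x - grad (closure \<Omega>) h x) \<bullet> b" if "x \<in> closure \<Omega>" "b \<in> Basis" for x b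
    unfolding grad_diff[OF f h that(1), symmetric] using that by (simp add: grad_def)
  moreover have "continuous_on (closure \<Omega>) (\<lambda>x. (grad (closure \<Omega>) f x - grad (closure \<Omega>) h x) \<bullet> b)" for b
    by (intro continuous_intros grad_continuous f h)
  ultimately have "continuous_on (closure \<Omega>) (\<lambda>x. frechet_derivative (\<lambda>x. f x - h x) (at x within closure \<Omega>) b)"
    if "b \<in> Basis" for b using that by (simp cong: continuous_on_cong)
  with d show ?thesis by simp
qed

lemma C1_path_continuous:
  fixes u :: "'a \<Rightarrow> real \<Rightarrow> real"
  assumes C1: "\<And>t. 0 \<le> t \<Longrightarrow> Ck_on 1 (\<lambda>x. u x t) (closure \<Omega>)"
    and lim: "\<And>s. 0 \<le> s \<Longrightarrow> ((\<lambda>t. C1_norm (closure \<Omega>) (\<lambda>x. u x t - u x s)) \<longlongrightarrow> 0) (at s within {0..})"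
  shows "continuous_on (closure \<Omega> \<times> {0..}) (\<lambda>(x, t). u x t)"
    and "continuous_on (closure \<Omega> \<times> {0..}) (\<lambda>(x, t). grad (closure \<Omega>) (\<lambda>y. u y t) x)"
proof -
  have K: "compact (closure \<Omega>)" using bounded_domain by simp
  note bds = C1_norm_bounds[OF Ck1_diff[OF C1 C1] K]
  show "continuous_on (closure \<Omega> \<times> {0..}) (\<lambda>(x, t). u x t)"
  proof (rule jointly_continuous[OF _ _ lim])
    show "continuous_on (closure \<Omega>) (\<lambda>x. u x s)" if "0 \<le> s" for s
      using C1[OF that] by (simp add: differentiable_imp_continuous_on)
    show "dist (u x t) (u x s) \<le> C1_norm (closure \<Omega>) (\<lambda>x. u x t - u x s)"
      if "x \<in> closure \<Omega>" "0 \<le> s" "0 \<le> t" for x s t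
      using bds(1)[of t s x] that by (simp add: dist_real_def)
  qed
  show "continuous_on (closure \<Omega> \<times> {0..}) (\<lambda>(x, t). grad (closure \<Omega>) (\<lambda>y. u y t) x)"
  proof (rule jointly_continuous[OF _ _ lim])
    show "continuous_on (closure \<Omega>) (\<lambda>x. grad (closure \<Omega>) (\<lambda>y. u y s) x)" if "0 \<le> s" for s
      using grad_continuous[OF C1[OF that]] by simp
    show "dist (grad (closure \<Omega>) (\<lambda>y. u y t) x) (grad (closure \<Omega>) (\<lambda>y. u y s) x)
        \<le> C1_norm (closure \<Omega>) (\<lambda>x. u x t - u x s)"
      if "x \<in> closure \<Omega>" "0 \<le> s" "0 \<le> t" for x s t
      using bds(2)[of t s x] that grad_diff[OF C1 C1, of t s x] by (simp add: dist_norm)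
  qed
qed

lemma space_slice_derivative:
  fixes f :: "'a \<times> real \<Rightarrow> real"
  assumes f: "smooth_on f (closure \<Omega> \<times> {0<..})" and x: "x \<in> closure \<Omega>" and t: "0 < t"
  shows "((\<lambda>y. f (y, t)) has_derivative (\<lambda>v. partial_deriv (closure \<Omega> \<times> {0<..}) (v, 0) f (x, t))) (at x within closure \<Omega>)"
proof -
  have "((\<lambda>y. (y, t)) has_derivative (\<lambda>v. (v, 0))) (at x within closure \<Omega>)"
    by (intro derivative_intros)
  moreover have "(f has_derivative (\<lambda>c. partial_deriv (closure \<Omega> \<times> {0<..}) c f (x, t))) (at (x, t) within (\<lambda>y. (y, t)) ` closure \<Omega>)"
    by (rule has_derivative_subset[OF smooth_on_partial_deriv(2)[OF f]]) (use x t in auto)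
  ultimately show ?thesis by (rule has_derivative_in_compose)
qed

lemma time_slice_derivative:
  fixes f :: "'a \<times> real \<Rightarrow> real"
  assumes f: "smooth_on f (closure \<Omega> \<times> {0<..})" and x: "x \<in> closure \<Omega>" and t: "0 < t"
  shows "((\<lambda>s. f (x, s)) has_real_derivative partial_deriv (closure \<Omega> \<times> {0<..}) (0, 1) f (x, t)) (at t)"
proof -
  note fd = smooth_on_partial_deriv(2)[OF f, of "(x, t)"]
  have lin: "linear (\<lambda>c. partial_deriv (closure \<Omega> \<times> {0<..}) c f (x, t))" 
    using has_derivative_linear[OF fd] x t by simp
  have "((\<lambda>s. (x, s)) has_derivative (\<lambda>r. (0, r))) (at t within {0<..})"
    by (intro derivative_intros)
  moreover have "(f has_derivative (\<lambda>c. partial_deriv (closure \<Omega> \<times> {0<..}) c f (x, t))) (at (x, t) within (\<lambda>s. (x, s)) ` {0<..})"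
    by (rule has_derivative_subset[OF fd]) (use x t in auto)
  ultimately have "((\<lambda>s. f (x, s)) has_derivative (\<lambda>r. partial_deriv (closure \<Omega> \<times> {0<..}) (0, r) f (x, t))) (at t within {0<..})"
    by (rule has_derivative_in_compose)
  then have "((\<lambda>s. f (x, s)) has_derivative (\<lambda>r. partial_deriv (closure \<Omega> \<times> {0<..}) (0, r) f (x, t))) (at t)"
    using at_within_open[of t "{0<..}"] t by simp
  moreover have "(\<lambda>r. partial_deriv (closure \<Omega> \<times> {0<..}) (0, r) f (x, t)) = (*) (partial_deriv (closure \<Omega> \<times> {0<..}) (0, 1) f (x, t))"
  proof
    show "partial_deriv (closure \<Omega> \<times> {0<..}) (0, r) f (x, t) = partial_deriv (closure \<Omega> \<times> {0<..}) (0, 1) f (x, t) * r" for r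
      using linear_cmul[OF lin, of r "(0, 1)"] by simp
  qed
  ultimately show ?thesis unfolding has_field_derivative_def by (rule has_derivative_eq_rhs)
qed

text \<open>
  In the open cylinder mixed partial derivatives commute, which gives both the symmetry of the Hessian
  and the gradient of the equation.  At boundary points the Hessian is symmetric because its entries are
  continuous up to the boundary.
\<close>

theorem allen_cahn_solution_neumann_flow:
  fixes u :: "'a \<Rightarrow> real \<Rightarrow> real"
  assumes sol: "allen_cahn_solution \<Omega> W \<epsilon> u\<^sub>0 u"
    and W'': "\<And>s. (deriv W has_real_derivative W'' s) (at s)"
  shows "\<exists>A T ut pt. neumann_flow \<Omega> \<rho> g H C (\<lambda>s. deriv W s / \<epsilon>\<^sup>2) (\<lambda>s. W'' s / \<epsilon>\<^sup>2) u
    (\<lambda>x t. grad (closure \<Omega>) (\<lambda>y. u y t) x) A T ut pt"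
proof -
  define S :: "('a \<times> real) set" where "S = closure \<Omega> \<times> {0<..}"
  define V :: "('a \<times> real) set" where "V = \<Omega> \<times> {0<..}"
  define U where "U = (\<lambda>(x, t). u x t)"
  have U: "smooth_on U S" using sol by (simp add: allen_cahn_solution_def U_def S_def)
  have V: "open V" "V \<subseteq> S" using open_domain closure_subset by (auto simp: V_def S_def open_Times)
  have Basis: "(b, 0) \<in> (Basis :: ('a \<times> real) set)" if "b \<in> Basis" for b :: 'a
    using that by (simp add: Basis_prod_def)
  have Basis_t: "(0, 1) \<in> (Basis :: ('a \<times> real) set)" by (simp add: Basis_prod_def)
  define p where "p x t = grad (closure \<Omega>) (\<lambda>y. u y t) x" for x t
  define U1 where "U1 b = partial_deriv S (b, 0) U" for b
  define U2 where "U2 a b = partial_deriv S (a, 0) (U1 b)" for a b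
  define A where "A x t v = (\<Sum>b\<in>Basis. U2 v b (x, t) *\<^sub>R b)" for x t v
  define T where "T x t a = (\<Sum>b\<in>Basis. partial_deriv S (a, 0) (U2 a b) (x, t) *\<^sub>R b)" for x t a
  define ut where "ut x t = partial_deriv S (0, 1) U (x, t)" for x t
  define pt where "pt x t = (\<Sum>b\<in>Basis. partial_deriv S (0, 1) (U1 b) (x, t) *\<^sub>R b)" for x t
  have U1: "smooth_on (U1 b) S" if "b \<in> Basis" for b
    unfolding U1_def by (intro smooth_on_partial_deriv(1) U Basis that)
  have U2: "smooth_on (U2 a b) S" if "a \<in> Basis" "b \<in> Basis" for a b
    unfolding U2_def by (intro smooth_on_partial_deriv(1) U1 Basis that)
  note slice = space_slice_derivative[folded S_def] and tslice = time_slice_derivative[folded S_def]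
  have u_slice: "((\<lambda>y. u y t) has_derivative (\<lambda>v. partial_deriv S (v, 0) U (x, t))) (at x within closure \<Omega>)"
    if "x \<in> closure \<Omega>" "0 < t" for x t
    using slice[OF U that] by (simp add: U_def)
  have u_deriv: "((\<lambda>y. u y t) has_derivative (\<lambda>v. p x t \<bullet> v)) (at x within closure \<Omega>)"
    if "x \<in> closure \<Omega>" "0 < t" for x t
    unfolding p_def by (rule frechet_derivative_eq_grad) (rule differentiableI[OF u_slice[OF that]])
  have pU: "partial_deriv S (v, 0) U (x, t) = p x t \<bullet> v" if "x \<in> closure \<Omega>" "0 < t" for x t v
    using has_derivative_unique_closure[OF u_slice[OF that] u_deriv[OF that] that(1)] by metis
  have p_eq: "p x t = (\<Sum>b\<in>Basis. U1 b (x, t) *\<^sub>R b)" if "x \<in> closure \<Omega>" "0 < t" for x t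
    by (simp add: U1_def pU[OF that] euclidean_representation)
  have sym_open: "U2 a b z = U2 b a z" if "z \<in> V" "a \<in> Basis" "b \<in> Basis" for a b z
    unfolding U2_def U1_def by (rule partial_deriv_commute[OF U V that(1)]) (intro Basis that)+
  have sym: "U2 a b (x, t) = U2 b a (x, t)" if x: "x \<in> closure \<Omega>" and t: "0 < t" and ab: "a \<in> Basis" "b \<in> Basis" for a b x t
  proof -
    \<comment> \<open>Both entries are continuous up to the boundary and agree inside.\<close>
    have "continuous_on (closure \<Omega>) (\<lambda>y. U2 a b (y, t) - U2 b a (y, t))"
      using t by (intro continuous_intros continuous_on_compose2[OF smooth_on_partial_deriv(3)[OF U2]] ab) (auto simp: S_def)
    then have "U2 a b (x, t) - U2 b a (x, t) = 0"
      by (rule continuous_constant_on_closure[of \<Omega> _ 0]) (use sym_open ab t x in \<open>auto simp: V_def\<close>)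
    then show ?thesis by simp
  qed
  have U2_lin: "U2 v b (x, t) = (\<Sum>a\<in>Basis. (v \<bullet> a) * U2 a b (x, t))"
    if "x \<in> closure \<Omega>" "0 < t" "b \<in> Basis" for v b x t
  proof -
    have lin: "linear (\<lambda>v. U2 v b (x, t))"
      unfolding U2_def by (rule has_derivative_linear[OF slice[OF U1[OF that(3)] that(1,2)]])
    have "U2 v b (x, t) = U2 (\<Sum>a\<in>Basis. (v \<bullet> a) *\<^sub>R a) b (x, t)" by (simp add: euclidean_representation)
    also have "\<dots> = (\<Sum>a\<in>Basis. (v \<bullet> a) * U2 a b (x, t))"
      by (simp only: linear_sum[OF lin] linear_cmul[OF lin] real_scaleR_def)
    finally show ?thesis .
  qed
  have A_form: "A x t v \<bullet> y = (\<Sum>a\<in>Basis. \<Sum>b\<in>Basis. (v \<bullet> a) * (y \<bullet> b) * U2 a b (x, t))"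
    if "x \<in> closure \<Omega>" "0 < t" for x t v y
  proof -
    have "A x t v \<bullet> y = (\<Sum>b\<in>Basis. U2 v b (x, t) * (y \<bullet> b))"
      unfolding A_def inner_sum_left inner_scaleR_left by (simp add: inner_commute)
    also have "\<dots> = (\<Sum>b\<in>Basis. \<Sum>a\<in>Basis. (v \<bullet> a) * (y \<bullet> b) * U2 a b (x, t))"
    proof (rule sum.cong[OF refl])
      fix b :: 'a assume b: "b \<in> Basis"
      show "U2 v b (x, t) * (y \<bullet> b) = (\<Sum>a\<in>Basis. (v \<bullet> a) * (y \<bullet> b) * U2 a b (x, t))"
        unfolding U2_lin[OF that b, of v] sum_distrib_right by (intro sum.cong refl) (simp only: ac_simps)
    qed
    finally show ?thesis by (subst sum.swap)
  qed
  have A_diag: "A x t b \<bullet> b = U2 b b (x, t)" if "b \<in> Basis" for x t b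
    using that by (simp add: A_def)
  have lap: "laplacian (\<lambda>y. u y t) x = (\<Sum>b\<in>Basis. U2 b b (x, t))" if x: "x \<in> \<Omega>" and t: "0 < t" for x t
    unfolding laplacian_def
  proof (rule sum.cong[OF refl])
    fix b :: 'a assume b: "b \<in> Basis"
    have at: "at y within closure \<Omega> = at y" if "y \<in> \<Omega>" for y
      using that open_domain closure_subset by (meson at_within_interior interior_maximal subsetD)
    have 1: "U1 b (y, t) = frechet_derivative (\<lambda>y. u y t) (at y) b" if "y \<in> \<Omega>" for y
      using frechet_derivative_at[OF u_slice[OF domain_subset(1)[OF that] t, unfolded at[OF that]]]
      by (metis U1_def)
    have 2: "((\<lambda>y. U1 b (y, t)) has_derivative (\<lambda>v. U2 v b (x, t))) (at x)"
      using slice[OF U1[OF b] domain_subset(1)[OF x] t] by (simp add: at[OF x] U2_def)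
    have "((\<lambda>y. frechet_derivative (\<lambda>y. u y t) (at y) b) has_derivative (\<lambda>v. U2 v b (x, t))) (at x)"
      by (rule has_derivative_transform_within_open[OF 2 open_domain x 1])
    from frechet_derivative_at[OF this]
    show "frechet_derivative (\<lambda>y. frechet_derivative (\<lambda>y. u y t) (at y) b) (at x) b = U2 b b (x, t)"
      by metis
  qed
  have u_time: "(u x has_real_derivative ut x t) (at t)" if "x \<in> closure \<Omega>" "0 < t" for x t
    using tslice[OF U that] by (simp add: U_def ut_def)
  have eq: "ut x t = (\<Sum>b\<in>Basis. U2 b b (x, t)) - deriv W (u x t) / \<epsilon>\<^sup>2" if "x \<in> \<Omega>" "0 < t" for x t
    using sol that DERIV_imp_deriv[OF u_time[OF domain_subset(1)[OF that(1)] that(2)]] lap[OF that]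
    by (simp add: allen_cahn_solution_def)
  have eq_grad: "partial_deriv S (0, 1) (U1 c) z = (\<Sum>b\<in>Basis. partial_deriv S (b, 0) (U2 b c) z) - W'' (U z) / \<epsilon>\<^sup>2 * U1 c z"
    if z: "z \<in> V" and c: "c \<in> Basis" for z c
  proof -
    have "partial_deriv S (0, 1) (U1 c) z = partial_deriv S (c, 0) (partial_deriv S (0, 1) U) z"
      unfolding U1_def by (rule partial_deriv_commute[OF U V z Basis_t Basis[OF c]])
    also have "\<dots> = (\<Sum>b\<in>Basis. partial_deriv S (c, 0) (U2 b b) z) - W'' (U z) * partial_deriv S (c, 0) U z / \<epsilon>\<^sup>2"
    proof -
      have l: "(partial_deriv S (0, 1) U has_derivative (\<lambda>v. partial_deriv S v (partial_deriv S (0, 1) U) z)) (at z)"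
        by (rule partial_deriv_interior[OF smooth_on_partial_deriv(1)[OF U Basis_t] V z])
      have dU: "(U has_derivative (\<lambda>v. partial_deriv S v U z)) (at z)" by (rule partial_deriv_interior[OF U V z])
      have dW: "((\<lambda>z. deriv W (U z)) has_derivative (\<lambda>v. W'' (U z) * partial_deriv S v U z)) (at z)"
        using has_derivative_compose[OF dU, of "deriv W" "(*) (W'' (U z))"] W'' by (simp add: has_field_derivative_def)
      have "((\<lambda>z. (\<Sum>b\<in>Basis. U2 b b z) - deriv W (U z) / \<epsilon>\<^sup>2) has_derivative
          (\<lambda>v. (\<Sum>b\<in>Basis. partial_deriv S v (U2 b b) z) - W'' (U z) * partial_deriv S v U z / \<epsilon>\<^sup>2)) (at z)"
        by (intro has_derivative_diff has_derivative_sum bounded_linear.has_derivative[OF bounded_linear_divide dW] partial_deriv_interior[OF U2 V z])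
      then have r: "(partial_deriv S (0, 1) U has_derivative
          (\<lambda>v. (\<Sum>b\<in>Basis. partial_deriv S v (U2 b b) z) - W'' (U z) * partial_deriv S v U z / \<epsilon>\<^sup>2)) (at z)"
        by (rule has_derivative_transform_within_open[OF _ V(1) z]) (use eq in \<open>auto simp: V_def ut_def U_def\<close>)
      show ?thesis using has_derivative_unique[OF l r] by metis
    qed
    also have "(\<Sum>b\<in>Basis. partial_deriv S (c, 0) (U2 b b) z) = (\<Sum>b\<in>Basis. partial_deriv S (b, 0) (U2 b c) z)"
    proof (rule sum.cong[OF refl])
      fix b :: 'a assume b: "b \<in> Basis"
      have "partial_deriv S (c, 0) (U2 b b) z = partial_deriv S (b, 0) (U2 c b) z"
        unfolding U2_def by (rule partial_deriv_commute[OF U1[OF b] V z Basis[OF c] Basis[OF b]])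
      also have "\<dots> = partial_deriv S (b, 0) (U2 b c) z"
        by (rule partial_deriv_cong_open[OF U2[OF c b] U2[OF b c] V z sym_open[OF _ c b]])
      finally show "partial_deriv S (c, 0) (U2 b b) z = partial_deriv S (b, 0) (U2 b c) z" .
    qed
    finally show ?thesis by (simp add: U1_def)
  qed
  have "neumann_flow \<Omega> \<rho> g H C (\<lambda>s. deriv W s / \<epsilon>\<^sup>2) (\<lambda>s. W'' s / \<epsilon>\<^sup>2) u p A T ut pt"
  proof
    have C1: "\<And>t. 0 \<le> t \<Longrightarrow> Ck_on 1 (\<lambda>x. u x t) (closure \<Omega>)"
      and lim: "\<And>s. 0 \<le> s \<Longrightarrow> ((\<lambda>t. C1_norm (closure \<Omega>) (\<lambda>x. u x t - u x s)) \<longlongrightarrow> 0) (at s within {0..})"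
      using sol unfolding allen_cahn_solution_def by blast+
    show "continuous_on (closure \<Omega> \<times> {0..}) (\<lambda>(x, t). u x t)"
      "continuous_on (closure \<Omega> \<times> {0..}) (\<lambda>(x, t). p x t)"
      unfolding p_def by (rule C1_path_continuous[OF C1 lim]; assumption)+
  next
    fix x :: 'a and t :: real assume x: "x \<in> closure \<Omega>" and t: "0 < t"
    show "((\<lambda>y. u y t) has_derivative (\<bullet>) (p x t)) (at x within closure \<Omega>)" by (rule u_deriv[OF x t])
    have "((\<lambda>y. \<Sum>b\<in>Basis. U1 b (y, t) *\<^sub>R b) has_derivative A x t) (at x within closure \<Omega>)"
      unfolding A_def U2_def by (intro has_derivative_sum has_derivative_scaleR_left slice[OF U1 x t])
    from has_derivative_transform[OF x p_eq[OF _ t] this]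
    show "((\<lambda>y. p y t) has_derivative A x t) (at x within closure \<Omega>)" by blast
    show "A x t v \<bullet> y = A x t y \<bullet> v" for v y
    proof -
      have "A x t v \<bullet> y = (\<Sum>b\<in>Basis. \<Sum>a\<in>Basis. (v \<bullet> a) * (y \<bullet> b) * U2 a b (x, t))"
        unfolding A_form[OF x t] by (rule sum.swap)
      also have "\<dots> = A x t y \<bullet> v"
        unfolding A_form[OF x t] by (intro sum.cong refl) (simp add: sym[OF x t] mult.commute)
      finally show ?thesis .
    qed
  next
    fix x b :: 'a and s t :: real assume x: "x + s *\<^sub>R b \<in> \<Omega>" and t: "0 < t" and b: "b \<in> Basis"
    show "((\<lambda>s. A (x + s *\<^sub>R b) t b) has_vector_derivative T (x + s *\<^sub>R b) t b) (at s)"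
      unfolding A_def T_def
      by (rule has_vector_derivative_line_interior[where D = "\<lambda>v. \<Sum>c\<in>Basis. partial_deriv S (v, 0) (U2 b c) (x + s *\<^sub>R b, t) *\<^sub>R c"
            and k = "\<lambda>y. \<Sum>c\<in>Basis. U2 b c (y, t) *\<^sub>R c", OF _ x])
         (intro has_derivative_sum has_derivative_scaleR_left slice[OF U2[OF b] domain_subset(1)[OF x] t])
  next
    fix x :: 'a and t :: real assume x: "x \<in> \<Omega>" and t: "0 < t"
    note cl = domain_subset(1)[OF x]
    show "(u x has_real_derivative ut x t) (at t)" by (rule u_time[OF cl t])
    have "((\<lambda>s. \<Sum>b\<in>Basis. U1 b (x, s) *\<^sub>R b) has_vector_derivative pt x t) (at t)"
      unfolding pt_def using tslice[OF U1 cl t]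
      by (intro has_vector_derivative_sum) 
         (auto intro!: derivative_eq_intros simp: has_real_derivative_iff_has_vector_derivative[symmetric])
    then show "(p x has_vector_derivative pt x t) (at t)"
      unfolding has_vector_derivative_def
      by (rule has_derivative_transform_within_open[where s = "{0<..}"]) (use t p_eq[OF cl] in auto)
    show "ut x t = (\<Sum>b\<in>Basis. A x t b \<bullet> b) - deriv W (u x t) / \<epsilon>\<^sup>2"
      using eq[OF x t] A_diag by simp
    show "pt x t = (\<Sum>b\<in>Basis. T x t b) - (W'' (u x t) / \<epsilon>\<^sup>2) *\<^sub>R p x t"
    proof (rule euclidean_eqI)
      fix c :: 'a assume c: "c \<in> Basis"
      have "(x, t) \<in> V" using x t by (simp add: V_def)
      note grad_c = eq_grad[OF this c]
      have "(\<Sum>b\<in>Basis. T x t b) \<bullet> c = (\<Sum>b\<in>Basis. partial_deriv S (b, 0) (U2 b c) (x, t))"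
        unfolding inner_sum_left by (intro sum.cong refl) (use c in \<open>simp add: T_def\<close>)
      with grad_c
      show "pt x t \<bullet> c = ((\<Sum>b\<in>Basis. T x t b) - (W'' (u x t) / \<epsilon>\<^sup>2) *\<^sub>R p x t) \<bullet> c"
        using c by (simp add: pt_def inner_diff_left p_eq[OF cl t] U_def)
    qed
  next
    fix x :: 'a and t :: real assume x: "x \<in> frontier \<Omega>" and t: "0 < t"
    have "p x t \<bullet> outer_normal \<Omega> x = 0" using sol x t by (simp add: allen_cahn_solution_def p_def)
    then show "p x t \<bullet> g x = 0" using normal[OF x] frontier_grad[OF x] by auto
  qed
  then show ?thesis unfolding p_def[abs_def] by blast
qed

end

section \<open>The discrepancy bound\<close>

text \<open>
  \<open>W\<close> has minima at \<open>\<plusminus>1\<close>, so \<open>W'\<close> vanishes there; together with the sign conditions on the open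
  intervals this gives the sign of \<open>W' s * (s - \<gamma>)\<close> on the whole of \<open>[-1, 1]\<close>.
\<close>

lemma double_well_facts:
  assumes "double_well W"
  obtains W'' B \<gamma> where "\<And>s. (W has_real_derivative deriv W s) (at s)"
    "\<And>s. (deriv W has_real_derivative W'' s) (at s)" "continuous_on UNIV W''" "\<And>s. 0 \<le> W s"
    "\<And>s. \<bar>s\<bar> \<le> 1 \<Longrightarrow> W s \<le> B" "\<And>s. \<bar>s\<bar> \<le> 1 \<Longrightarrow> \<bar>deriv W s\<bar> \<le> B" "\<And>s. \<bar>s\<bar> \<le> 1 \<Longrightarrow> \<bar>W'' s\<bar> \<le> B"
    "\<bar>\<gamma>\<bar> \<le> 1" "\<And>s. \<bar>s\<bar> \<le> 1 \<Longrightarrow> deriv W s * (s - \<gamma>) \<le> 0" "deriv W 1 = 0" "deriv W (-1) = 0"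
proof -
  have C3: "Ck_on (Suc (Suc (Suc 0))) W UNIV" and zero: "W 1 = 0" "W (-1) = 0"
    and pos: "\<And>s. s \<noteq> 1 \<Longrightarrow> s \<noteq> -1 \<Longrightarrow> W s > 0"
    using assms by (auto simp: double_well_def numeral_3_eq_3)
  have fd: "frechet_derivative f (at x) 1 = deriv f x" if diff: "f differentiable (at x)" for f :: "real \<Rightarrow> real" and x
  proof -
    obtain D where D: "(f has_real_derivative D) (at x)"
      using diff unfolding real_differentiable_def by blast
    have "frechet_derivative f (at x) = (*) D"
      by (rule frechet_derivative_at[OF D[unfolded has_field_derivative_def], symmetric])
    with DERIV_imp_deriv[OF D] show ?thesis by simp
  qed
  have DD: "(f has_real_derivative deriv f x) (at x)" if "f differentiable (at x)" for f :: "real \<Rightarrow> real" and x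
    using that DERIV_deriv_iff_real_differentiable by blast
  have d0: "W differentiable (at x)" for x using C3 by (simp add: differentiable_on_def)
  have e0: "(\<lambda>x. frechet_derivative W (at x) 1) = deriv W" using fd[OF d0] by blast
  have d1: "deriv W differentiable (at x)" for x using C3 by (simp add: differentiable_on_def e0)
  have e1: "(\<lambda>x. frechet_derivative (deriv W) (at x) 1) = deriv (deriv W)" using fd[OF d1] by blast
  have d2: "deriv (deriv W) differentiable (at x)" for x using C3 by (simp add: differentiable_on_def e0 e1)
  have cont: "continuous_on S W" "continuous_on S (deriv W)" "continuous_on S (deriv (deriv W))" for S
    using d0 d1 d2 by (meson continuous_at_imp_continuous_on differentiable_imp_continuous_within)+
  have bd: "\<exists>B. \<forall>s\<in>{-1..1}. \<bar>f s\<bar> \<le> B" if "continuous_on {-1..1} f" for f :: "real \<Rightarrow> real"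
    using compact_imp_bounded[OF compact_continuous_image[OF that]] by (auto simp: bounded_iff)
  obtain B0 B1 B2 where B: "\<And>s. \<bar>s\<bar> \<le> 1 \<Longrightarrow> \<bar>W s\<bar> \<le> B0" "\<And>s. \<bar>s\<bar> \<le> 1 \<Longrightarrow> \<bar>deriv W s\<bar> \<le> B1"
    "\<And>s. \<bar>s\<bar> \<le> 1 \<Longrightarrow> \<bar>deriv (deriv W) s\<bar> \<le> B2"
    using bd[OF cont(1)] bd[OF cont(2)] bd[OF cont(3)] by (force simp: abs_le_iff)
  define B where "B = max B0 (max B1 B2)"
  have nonneg: "0 \<le> W s" for s using pos[of s] zero by (cases "s = 1 \<or> s = -1") auto
  have min: "deriv W s = 0" if "W s = 0" for s
    by (rule DERIV_local_min[OF DD[OF d0] zero_less_one]) (use nonneg that in auto)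
  obtain \<gamma> where \<gamma>: "-1 < \<gamma>" "\<gamma> < 1" "\<And>s. \<gamma> < s \<Longrightarrow> s < 1 \<Longrightarrow> deriv W s < 0"
    "\<And>s. -1 < s \<Longrightarrow> s < \<gamma> \<Longrightarrow> deriv W s > 0"
    using assms unfolding double_well_def by auto
  show ?thesis
  proof (rule that[of "deriv (deriv W)" B \<gamma>])
    show "deriv W s * (s - \<gamma>) \<le> 0" if s: "\<bar>s\<bar> \<le> 1" for s
    proof -
      consider "s = 1 \<or> s = -1" | "s = \<gamma>" | "\<gamma> < s" "s < 1" | "-1 < s" "s < \<gamma>" using s by linarith
      then show ?thesis
      proof cases
        case 1
        then have "W s = 0" using zero by auto
        then show ?thesis by (simp add: min)
      next
        case 3
        then show ?thesis using \<gamma>(3) by (intro mult_nonpos_nonneg) (auto intro: less_imp_le)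
      next
        case 4
        then show ?thesis using \<gamma>(4) by (intro mult_nonneg_nonpos) (auto intro: less_imp_le)
      qed simp
    qed
    show "\<bar>\<gamma>\<bar> \<le> 1" using \<gamma> by simp
    show "W s \<le> B" "\<bar>deriv W s\<bar> \<le> B" "\<bar>deriv (deriv W) s\<bar> \<le> B" if "\<bar>s\<bar> \<le> 1" for s
      using B[OF that] by (auto simp: B_def)
  qed (use DD d0 d1 cont nonneg min zero in auto)
qed

text \<open>
  A nonempty open set is not negligible.
\<close>

lemma AE_le_imp_le_closure:
  fixes f :: "'a::euclidean_space \<Rightarrow> real"
  assumes "open \<Omega>" and cont: "continuous_on (closure \<Omega>) f"
    and ae: "AE x in lebesgue_on \<Omega>. f x \<le> c" and x: "x \<in> closure \<Omega>"
  shows "f x \<le> c"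
proof -
  have contO: "continuous_on \<Omega> f" using cont closure_subset by (rule continuous_on_subset)
  have "f y \<le> c" if y: "y \<in> \<Omega>" for y
  proof (rule ccontr)
    assume "\<not> f y \<le> c"
    define V where "V = {y \<in> \<Omega>. c < f y}"
    have "open V" unfolding V_def
      using continuous_open_preimage[OF contO assms(1), of "{c<..}"] by (simp add: vimage_def Int_def)
    have "AE x in lebesgue. x \<in> \<Omega> \<longrightarrow> f x \<le> c"
      using ae assms(1) by (simp add: AE_restrict_space_iff)
    then have "AE x in lebesgue. x \<notin> V" by eventually_elim (auto simp: V_def)
    moreover have "V \<in> sets lebesgue" using \<open>open V\<close> by (simp add: borel_open sets_completionI_sets)
    ultimately have "V \<in> null_sets lebesgue" by (simp add: AE_iff_null_sets)
    then have "negligible V" by (simp add: negligible_iff_null_sets)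
    moreover have "V \<noteq> {}" using y \<open>\<not> f y \<le> c\<close> by (auto simp: V_def)
    ultimately show False using open_not_negligible[OF \<open>open V\<close>] by blast
  qed
  then show ?thesis using continuous_le_on_closure[OF cont x] by blast
qed

lemma grad_cong:
  assumes "\<And>y. y \<in> S \<Longrightarrow> f y = h y" "x \<in> S"
  shows "grad S f x = grad S h x"
proof -
  have "(f has_derivative D) (at x within S) \<longleftrightarrow> (h has_derivative D) (at x within S)" for D
    using has_derivative_transform[OF assms(2), of f h] has_derivative_transform[OF assms(2), of h f] assms(1)
    by metis
  then have "frechet_derivative f (at x within S) = frechet_derivative h (at x within S)"
    by (simp add: frechet_derivative_def)
  then show ?thesis by (simp add: grad_def)
qed

text \<open>
  The exponent enters through \<open>\<epsilon>\<^sup>2 \<le> d\<^sup>3\<close> for \<open>d = \<epsilon> powr (1 - lam)\<close>, that is, \<open>lam \<ge> 1 / 3\<close>.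
\<close>

theorem (in defined_domain) discrepancy_bound:
  assumes sol: "allen_cahn_solution \<Omega> W \<epsilon> u\<^sub>0 u" and \<epsilon>: "0 < \<epsilon>" "\<epsilon> < 1" and lam: "1 / 3 \<le> lam" "lam < 1"
    and u0: "Ck_on 1 u\<^sub>0 (closure \<Omega>)" "AE x in lebesgue_on \<Omega>. \<bar>u\<^sub>0 x\<bar> \<le> 1"
    and disc0: "\<And>x. x \<in> closure \<Omega> \<Longrightarrow> discrepancy \<Omega> W \<epsilon> u\<^sub>0 x \<le> c * \<epsilon> powr (- lam)"
    and W: "\<And>s. (W has_real_derivative deriv W s) (at s)"
      "\<And>s. (deriv W has_real_derivative W'' s) (at s)" "continuous_on UNIV W''" "\<And>s. 0 \<le> W s"
      "\<And>s. \<bar>s\<bar> \<le> 1 \<Longrightarrow> W s \<le> B" "\<And>s. \<bar>s\<bar> \<le> 1 \<Longrightarrow> \<bar>deriv W s\<bar> \<le> B" "\<And>s. \<bar>s\<bar> \<le> 1 \<Longrightarrow> \<bar>W'' s\<bar> \<le> B"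
      "\<bar>\<gamma>\<bar> \<le> 1" "\<And>s. \<bar>s\<bar> \<le> 1 \<Longrightarrow> deriv W s * (s - \<gamma>) \<le> 0" "deriv W 1 = 0" "deriv W (-1) = 0"
    and x: "x \<in> closure \<Omega>" and t: "0 \<le> t"
  shows "discrepancy \<Omega> W \<epsilon> (\<lambda>y. u y t) x \<le> discrepancy_const C B (real DIM('a)) c * \<epsilon> powr (- lam)"
proof -
  obtain A T ut pt where "neumann_flow \<Omega> \<rho> g H C (\<lambda>s. deriv W s / \<epsilon>\<^sup>2) (\<lambda>s. W'' s / \<epsilon>\<^sup>2) u
    (\<lambda>x t. grad (closure \<Omega>) (\<lambda>y. u y t) x) A T ut pt"
    using allen_cahn_solution_neumann_flow[OF sol W(2)] by blast
  then interpret flow: neumann_flow \<Omega> \<rho> g H C "\<lambda>s. deriv W s / \<epsilon>\<^sup>2" "\<lambda>s. W'' s / \<epsilon>\<^sup>2" u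
    "\<lambda>x t. grad (closure \<Omega>) (\<lambda>y. u y t) x" A T ut pt .
  define d where "d = \<epsilon> powr (1 - lam)"
  have d: "0 < d" "d \<le> 1" "\<epsilon>\<^sup>2 \<le> d ^ 3"
  proof -
    show "0 < d" using \<epsilon> by (simp add: d_def)
    show "d \<le> 1" unfolding d_def using \<epsilon> lam by (intro powr_le1) auto
    have "\<epsilon>\<^sup>2 = \<epsilon> powr 2" using \<epsilon> by (simp add: powr_numeral)
    also have "\<dots> \<le> \<epsilon> powr (3 * (1 - lam))" using \<epsilon> lam by (intro powr_mono') auto
    also have "\<dots> = d ^ 3" using \<epsilon> by (simp add: d_def powr_power mult.commute)
    finally show "\<epsilon>\<^sup>2 \<le> d ^ 3" .
  qed
  have d_eq: "d = \<epsilon> * \<epsilon> powr (- lam)" using \<epsilon> by (simp add: d_def powr_diff powr_minus divide_inverse)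
  have scale: "discrepancy \<Omega> W \<epsilon> f y
      = (\<epsilon>\<^sup>2 * (grad (closure \<Omega>) f y \<bullet> grad (closure \<Omega>) f y) / 2 - W (f y)) / \<epsilon>" for f y
    unfolding discrepancy_def power2_norm_eq_inner using \<epsilon> by (simp add: field_simps power2_eq_square)
  have agree: "u y 0 = u\<^sub>0 y" if y: "y \<in> closure \<Omega>" for y
  proof -
    have "Ck_on 1 (\<lambda>x. u x 0) (closure \<Omega>)" using sol unfolding allen_cahn_solution_def by blast
    then have "continuous_on (closure \<Omega>) (\<lambda>y. u y 0 - u\<^sub>0 y)"
      using u0(1) by (auto intro!: continuous_intros simp: differentiable_imp_continuous_on)
    then have "u y 0 - u\<^sub>0 y = 0"
      by (rule continuous_constant_on_closure[OF _ _ y]) (use sol in \<open>auto simp: allen_cahn_solution_def\<close>)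
    then show ?thesis by simp
  qed
  have "continuous_on (closure \<Omega>) (\<lambda>x. \<bar>u\<^sub>0 x\<bar>)"
    using u0(1) by (auto intro!: continuous_intros simp: differentiable_imp_continuous_on)
  then have "\<bar>u\<^sub>0 y\<bar> \<le> 1" if "y \<in> closure \<Omega>" for y
    by (rule AE_le_imp_le_closure[OF open_domain _ u0(2) that])
  then have init: "\<bar>u y 0\<bar> \<le> 1" if "y \<in> closure \<Omega>" for y using agree that by simp
  have f': "((\<lambda>s. deriv W s / \<epsilon>\<^sup>2) has_real_derivative W'' s / \<epsilon>\<^sup>2) (at s)" for s
    by (intro DERIV_cdivide W(2))
  have cf': "continuous_on UNIV (\<lambda>s. W'' s / \<epsilon>\<^sup>2)"
    using \<epsilon> by (intro continuous_intros W(3)) auto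
  have le1: "\<bar>u y s\<bar> \<le> 1" if "y \<in> closure \<Omega>" "0 \<le> s" for y s
  proof -
    have "1 * u y s \<le> 1"
      by (rule flow.signed_solution_le_1[OF _ _ f' cf' _ that]) (use W(10) init in \<open>force simp: abs_le_iff\<close>)+
    moreover have "(-1) * u y s \<le> 1"
      by (rule flow.signed_solution_le_1[OF _ _ f' cf' _ that]) (use W(11) init in \<open>force simp: abs_le_iff\<close>)+
    ultimately show ?thesis by simp
  qed
  interpret ac: allen_cahn_flow \<Omega> \<rho> g H C "deriv W" \<epsilon> W'' u "\<lambda>x t. grad (closure \<Omega>) (\<lambda>y. u y t) x" A T ut pt W d \<gamma> B c
  proof
    show "0 \<le> C" using grad_le[OF x] norm_ge_zero order_trans by blast
    fix y assume y: "y \<in> closure \<Omega>"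
    have gr: "grad (closure \<Omega>) (\<lambda>y. u y 0) y = grad (closure \<Omega>) u\<^sub>0 y"
      by (rule grad_cong[OF agree y])
    show "\<epsilon>\<^sup>2 * (grad (closure \<Omega>) (\<lambda>y. u y 0) y \<bullet> grad (closure \<Omega>) (\<lambda>y. u y 0) y) / 2 - W (u y 0) \<le> c * d"
      using disc0[OF y] \<epsilon> unfolding scale gr agree[OF y] d_eq by (simp add: pos_divide_le_eq mult.assoc mult.commute mult.left_commute)
  qed (use W d \<epsilon> le1 in blast)+
  show ?thesis
    using divide_right_mono[OF ac.discrepancy_le[OF x t], of \<epsilon>] \<epsilon> unfolding scale d_eq by simp
qed

theorem proposition5p1:
  fixes \<Omega> :: "(real ^ 'n) set" and W :: "real \<Rightarrow> real" and c\<^sub>1 c\<^sub>2 c\<^sub>4 :: real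
  assumes "smooth_bounded_domain \<Omega>"
    and "double_well W"
    and "tubular_constant \<Omega> c\<^sub>4"
  shows "\<exists>c\<^sub>7::real.
    \<forall>(D\<^sub>0::real) (lam::real) (\<epsilon>::nat \<Rightarrow> real) (u\<^sub>0::nat \<Rightarrow> real ^ 'n \<Rightarrow> real)
      (u::nat \<Rightarrow> real ^ 'n \<Rightarrow> real \<Rightarrow> real).
      3 / 5 \<le> lam \<and> lam < 1 \<and>
      admissible_initial_data \<Omega> W D\<^sub>0 c\<^sub>1 c\<^sub>2 lam \<epsilon> u\<^sub>0 \<and>
      (\<forall>i. allen_cahn_solution \<Omega> W (\<epsilon> i) (u\<^sub>0 i) (u i)) \<longrightarrow>
      (\<forall>i. \<epsilon> i < 1 \<longrightarrow>
        (\<forall>x\<in>\<Omega>. \<forall>t\<ge>0. discrepancy \<Omega> W (\<epsilon> i) (\<lambda>y. u i y t) x \<le> c\<^sub>7 * \<epsilon> i powr (- lam)))"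
proof -
  obtain \<rho> g H C where "defined_domain \<Omega> \<rho> g H C"
    using smooth_bounded_domain_defined[OF assms(1)] by blast
  then interpret defined_domain \<Omega> \<rho> g H C .
  obtain W'' B \<gamma> where W: "\<And>s. (W has_real_derivative deriv W s) (at s)"
    "\<And>s. (deriv W has_real_derivative W'' s) (at s)" "continuous_on UNIV W''" "\<And>s. 0 \<le> W s"
    "\<And>s. \<bar>s\<bar> \<le> 1 \<Longrightarrow> W s \<le> B" "\<And>s. \<bar>s\<bar> \<le> 1 \<Longrightarrow> \<bar>deriv W s\<bar> \<le> B" "\<And>s. \<bar>s\<bar> \<le> 1 \<Longrightarrow> \<bar>W'' s\<bar> \<le> B"
    "\<bar>\<gamma>\<bar> \<le> 1" "\<And>s. \<bar>s\<bar> \<le> 1 \<Longrightarrow> deriv W s * (s - \<gamma>) \<le> 0" "deriv W 1 = 0" "deriv W (-1) = 0"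
    by (rule double_well_facts[OF assms(2)]) (rule that)
  show ?thesis
  proof (intro exI[of _ "discrepancy_const C B (real DIM(real ^ 'n)) c\<^sub>2"] allI impI ballI)
    fix D\<^sub>0 lam :: real and \<epsilon> :: "nat \<Rightarrow> real" and u\<^sub>0 :: "nat \<Rightarrow> real ^ 'n \<Rightarrow> real"
      and u :: "nat \<Rightarrow> real ^ 'n \<Rightarrow> real \<Rightarrow> real" and i x and t :: real
    assume hyp: "3 / 5 \<le> lam \<and> lam < 1 \<and> admissible_initial_data \<Omega> W D\<^sub>0 c\<^sub>1 c\<^sub>2 lam \<epsilon> u\<^sub>0 \<and>
        (\<forall>i. allen_cahn_solution \<Omega> W (\<epsilon> i) (u\<^sub>0 i) (u i))"
      and \<epsilon>: "\<epsilon> i < 1" and x: "x \<in> \<Omega>" and t: "0 \<le> t"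
    from hyp have data: "\<epsilon> i > 0" "Ck_on 1 (u\<^sub>0 i) (closure \<Omega>)" "AE x in lebesgue_on \<Omega>. \<bar>u\<^sub>0 i x\<bar> \<le> 1"
      "\<And>x. x \<in> closure \<Omega> \<Longrightarrow> discrepancy \<Omega> W (\<epsilon> i) (u\<^sub>0 i) x \<le> c\<^sub>2 * \<epsilon> i powr (- lam)"
      and sol: "allen_cahn_solution \<Omega> W (\<epsilon> i) (u\<^sub>0 i) (u i)" and lam: "1 / 3 \<le> lam" "lam < 1"
      unfolding admissible_initial_data_def by auto
    show "discrepancy \<Omega> W (\<epsilon> i) (\<lambda>y. u i y t) x \<le> discrepancy_const C B (real DIM(real ^ 'n)) c\<^sub>2 * \<epsilon> i powr (- lam)"
      by (rule discrepancy_bound[OF sol data(1) \<epsilon> lam data(2-4) W domain_subset(1)[OF x] t])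
  qed
qed

end
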